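(* Let $(R,\mathfrak{m})$ be a commutative Noetherian local ring with $\mathfrak{m}$-adic completion $\widehat{R}$ and total quotient ring $K$, and let $E = E(R/\mathfrak{m})$ be the injective hull of the residue field. Then the simple divisible $R$-submodules of $E$ correspond exactly to the maximal ideals of the ring $\widehat{R} \otimes_R K$: the assignment $$N \longmapsto \operatorname{Ann}_{\widehat{R}}(N)\cdot(\widehat{R} \otimes_R K)$$ is a bijection from the set of $R$-submodules $N \subseteq E$ that are simple divisible as $R$-modules onto the set of maximal ideals of $\widehat{R} \otimes_R K$.
   Context: An $R$-module $N$ is divisible if $rN = N$ for every non-zero-divisor $r \in R$. $N$ is called simple divisible if $N$ is divisible, $N \neq 0$, and every submodule $0 \neq V \subsetneq N$ is not divisible. $E$ is an Artinian $R$-module, every element being annihilated by a power of $\mathfrak{m}$; hence $E$ and its $R$-submodules are naturally $\widehat{R}$-modules, and $\operatorname{Ann}_{\widehat{R}}(N)$ is formed with respect to this structure. $\operatorname{Ann}_{\widehat{R}}(N)\cdot(\widehat{R} \otimes_R K)$ denotes the extension of this ideal along $\widehat{R} \to \widehat{R} \otimes_R K$, $u \mapsto u \otimes 1$. *)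

theory Defs
  imports
    "HOL-Algebra.Ring_Divisibility"
    "HOL-Algebra.Ideal_Product"
    "HOL-Algebra.Generated_Groups"
    "HOL-Algebra.QuotRing"
    "HOL-Algebra.Module"
    "HOL-Library.Poly_Mapping"
begin

section \<open>Noetherian local rings\<close>

definition noetherian_local_ring :: "('a, 'r) ring_scheme \<Rightarrow> 'a set \<Rightarrow> bool" where
  "noetherian_local_ring R \<mm> \<longleftrightarrow>
     cring R \<and> noetherian_ring R \<and> {J. maximalideal J R} = {\<mm>}"

definition non_zero_divisors :: "('a, 'r) ring_scheme \<Rightarrow> 'a set" where
  "non_zero_divisors R =
     {r \<in> carrier R. \<forall>s \<in> carrier R. r \<otimes>\<^bsub>R\<^esub> s = \<zero>\<^bsub>R\<^esub> \<longrightarrow> s = \<zero>\<^bsub>R\<^esub>}"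


section \<open>Modules\<close>

definition mod_hom ::
    "('a, 'r) ring_scheme \<Rightarrow> ('a, 'b, 'm) module_scheme \<Rightarrow> ('a, 'c, 'n) module_scheme \<Rightarrow> ('b \<Rightarrow> 'c) set" where
  "mod_hom R M N =
     {f \<in> carrier M \<rightarrow> carrier N.
        (\<forall>x \<in> carrier M. \<forall>y \<in> carrier M. f (x \<oplus>\<^bsub>M\<^esub> y) = f x \<oplus>\<^bsub>N\<^esub> f y) \<and>
        (\<forall>r \<in> carrier R. \<forall>x \<in> carrier M. f (r \<odot>\<^bsub>M\<^esub> x) = r \<odot>\<^bsub>N\<^esub> f x)}"

definition annihilator ::
    "('a, 'r) ring_scheme \<Rightarrow> ('a, 'e, 'm) module_scheme \<Rightarrow> 'e set \<Rightarrow> 'a set" where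
  "annihilator R M N = {r \<in> carrier R. \<forall>x \<in> N. r \<odot>\<^bsub>M\<^esub> x = \<zero>\<^bsub>M\<^esub>}"

definition divisible_module :: "('a, 'r) ring_scheme \<Rightarrow> ('a, 'e, 'm) module_scheme \<Rightarrow> bool" where
  "divisible_module R M \<longleftrightarrow>
     (\<forall>r \<in> non_zero_divisors R. (\<lambda>x. r \<odot>\<^bsub>M\<^esub> x) ` carrier M = carrier M)"

definition simple_divisible_module :: "('a, 'r) ring_scheme \<Rightarrow> ('a, 'e, 'm) module_scheme \<Rightarrow> bool" where
  "simple_divisible_module R M \<longleftrightarrow>
     divisible_module R M \<and> carrier M \<noteq> {\<zero>\<^bsub>M\<^esub>} \<and>
     (\<forall>V. submodule V R M \<and> V \<noteq> {\<zero>\<^bsub>M\<^esub>} \<and> V \<noteq> carrier M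
        \<longrightarrow> \<not> divisible_module R (M\<lparr>carrier := V\<rparr>))"

text \<open>A ring \<open>B\<close> with a ring homomorphism \<open>h\<close> from \<open>R\<close>, viewed as an \<open>R\<close>-algebra.\<close>

definition algebra_via :: "('a \<Rightarrow> 'b) \<Rightarrow> ('b, 'm) ring_scheme \<Rightarrow> ('a, 'b) module" where
  "algebra_via h B =
     \<lparr>carrier = carrier B, mult = mult B, one = one B, zero = zero B, add = add B,
      smult = (\<lambda>r x. h r \<otimes>\<^bsub>B\<^esub> x)\<rparr>"

abbreviation residue_module :: "('a, 'r) ring_scheme \<Rightarrow> 'a set \<Rightarrow> ('a, 'a set) module" where
  "residue_module R I \<equiv> algebra_via (\<lambda>r. I +>\<^bsub>R\<^esub> r) (R Quot I)"


section \<open>Injective hulls\<close>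

text \<open>
  HOL cannot quantify over modules of all types inside a formula, so the test modules \<open>M\<close>, \<open>N\<close>
  live in the one type \<open>('a \<times> 'e) set\<close>. This is no restriction: by Baer's criterion the extension
  property then holds for modules of arbitrary types; see \<open>injective_module_extends\<close> below.
\<close>

definition injective_module :: "('a, 'r) ring_scheme \<Rightarrow> ('a, 'e, 'm) module_scheme \<Rightarrow> bool" where
  "injective_module R E \<longleftrightarrow> module R E \<and>
     (\<forall>(M :: ('a, ('a \<times> 'e) set) module) (N :: ('a, ('a \<times> 'e) set) module).
        module R M \<and> module R N \<longrightarrow>
        (\<forall>i \<in> mod_hom R M N. inj_on i (carrier M) \<longrightarrow>
          (\<forall>f \<in> mod_hom R M E. \<exists>g \<in> mod_hom R N E. \<forall>x \<in> carrier M. g (i x) = f x)))"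

text \<open>The ideal \<open>H\<close> as an \<open>R\<close>-module, transported to another type along an injection \<open>\<phi>\<close>.\<close>

definition embedded_ideal :: "('a, 'r) ring_scheme \<Rightarrow> ('a \<Rightarrow> 'u) \<Rightarrow> 'a set \<Rightarrow> ('a, 'u) module" where
  "embedded_ideal R \<phi> H =
     \<lparr>carrier = \<phi> ` H, mult = (\<lambda>x y. x), one = \<phi> \<zero>\<^bsub>R\<^esub>, zero = \<phi> \<zero>\<^bsub>R\<^esub>,
      add = (\<lambda>x y. \<phi> (inv_into UNIV \<phi> x \<oplus>\<^bsub>R\<^esub> inv_into UNIV \<phi> y)), smult = (\<lambda>r x. \<phi> (r \<otimes>\<^bsub>R\<^esub> inv_into UNIV \<phi> x))\<rparr>"

lemma module_embedded_ideal:
  fixes R (structure)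
  assumes "cring R" "ideal H R" "inj \<phi>"
  shows "module R (embedded_ideal R \<phi> H)"
proof -
  interpret cring R by fact
  interpret ideal H R by fact
  have [simp]: "inv_into UNIV \<phi> (\<phi> x) = x" for x using assms(3) by simp
  have [simp]: "\<And>x. x \<in> H \<Longrightarrow> x \<in> carrier R" using a_subset by blast
  show ?thesis
  proof (rule moduleI)
    show "abelian_group (embedded_ideal R \<phi> H)"
      unfolding embedded_ideal_def
    proof (rule abelian_groupI, goal_cases)
      case (6 x)
      then obtain h where "h \<in> H" "x = \<phi> h" by auto
      then show ?case by (auto intro!: bexI[of _ "\<ominus> h"] simp: l_neg a_inv_closed)
    qed (auto simp: a_ac)
  qed (auto simp: embedded_ideal_def assms l_distr r_distr m_assoc I_l_closed)
qed

lemma baer_criterion: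
  fixes R (structure) and E :: "('a, 'e, 'm) module_scheme" (structure)
  assumes inj: "injective_module R E" and "ideal H R"
    and h: "h \<in> H \<rightarrow> carrier E"
    and h_add: "\<And>x y. x \<in> H \<Longrightarrow> y \<in> H \<Longrightarrow> h (x \<oplus> y) = h x \<oplus>\<^bsub>E\<^esub> h y"
    and h_smult: "\<And>r x. r \<in> carrier R \<Longrightarrow> x \<in> H \<Longrightarrow> h (r \<otimes> x) = r \<odot>\<^bsub>E\<^esub> h x"
  obtains e where "e \<in> carrier E" "\<And>x. x \<in> H \<Longrightarrow> h x = x \<odot>\<^bsub>E\<^esub> e"
proof -
  interpret module R E using inj by (simp add: injective_module_def)
  interpret ideal H R by fact
  define \<phi> :: "'a \<Rightarrow> ('a \<times> 'e) set" where "\<phi> x = {(x, undefined)}" for x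
  have \<phi>: "inj \<phi>" by (auto simp: \<phi>_def inj_def)
  have [simp]: "inv_into UNIV \<phi> (\<phi> x) = x" for x using \<phi> by simp
  have [simp]: "\<And>x. x \<in> H \<Longrightarrow> x \<in> carrier R" using a_subset by blast
  let ?M = "embedded_ideal R \<phi> H" and ?N = "embedded_ideal R \<phi> (carrier R)"
  have M: "module R ?M" and N: "module R ?N"
    using module_embedded_ideal \<phi> \<open>ideal H R\<close> oneideal is_cring by blast+
  have i: "(\<lambda>x. x) \<in> mod_hom R ?M ?N" "inj_on (\<lambda>x. x) (carrier ?M)"
    by (auto simp: mod_hom_def embedded_ideal_def)
  have f: "(\<lambda>x. h (inv_into UNIV \<phi> x)) \<in> mod_hom R ?M E"
    using h by (auto simp: mod_hom_def embedded_ideal_def h_add h_smult)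
  obtain g where g: "g \<in> mod_hom R ?N E" "\<forall>x \<in> carrier ?M. g x = h (inv_into UNIV \<phi> x)"
    using inj[unfolded injective_module_def, THEN conjunct2, rule_format, OF conjI[OF M N] i f] by auto
  show thesis
  proof
    show e: "g (\<phi> \<one>) \<in> carrier E" using g(1) by (auto simp: mod_hom_def embedded_ideal_def)
    fix x assume x: "x \<in> H"
    have "g (x \<odot>\<^bsub>?N\<^esub> \<phi> \<one>) = x \<odot>\<^bsub>E\<^esub> g (\<phi> \<one>)"
      using g(1) x unfolding mod_hom_def by (auto simp: embedded_ideal_def simp del: r_one)
    moreover have "x \<odot>\<^bsub>?N\<^esub> \<phi> \<one> = \<phi> x" using x by (simp add: embedded_ideal_def)
    moreover have "g (\<phi> x) = h x" using g(2) x by (simp add: embedded_ideal_def)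
    ultimately show "h x = x \<odot>\<^bsub>E\<^esub> g (\<phi> \<one>)" by simp
  qed
qed

lemma injective_module_extends:
  fixes M :: "('a, 'b, 'k) module_scheme" and N :: "('a, 'c, 'l) module_scheme"
    and E :: "('a, 'e, 'm) module_scheme"
  assumes inj: "injective_module R E" and "module R M" "module R N"
    and i: "i \<in> mod_hom R M N" "inj_on i (carrier M)" and f: "f \<in> mod_hom R M E"
  shows "\<exists>g \<in> mod_hom R N E. \<forall>x \<in> carrier M. g (i x) = f x"
proof -
  interpret M: module R M by fact
  interpret N: module R N by fact
  interpret E: module R E using inj by (simp add: injective_module_def)
  define S where "S = {G. G \<subseteq> carrier N \<times> carrier E \<and>
      (\<lambda>x. (i x, f x)) ` carrier M \<subseteq> G \<and>
      (\<forall>x y x' y'. (x, y) \<in> G \<and> (x', y') \<in> G \<longrightarrow> (x \<oplus>\<^bsub>N\<^esub> x', y \<oplus>\<^bsub>E\<^esub> y') \<in> G) \<and>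
      (\<forall>r x y. r \<in> carrier R \<and> (x, y) \<in> G \<longrightarrow> (r \<odot>\<^bsub>N\<^esub> x, r \<odot>\<^bsub>E\<^esub> y) \<in> G) \<and>
      (\<forall>x y y'. (x, y) \<in> G \<and> (x, y') \<in> G \<longrightarrow> y = y')}"
  have Sc: "\<And>A x y. A \<in> S \<Longrightarrow> (x, y) \<in> A \<Longrightarrow> x \<in> carrier N \<and> y \<in> carrier E"
    and S0: "\<And>A x. A \<in> S \<Longrightarrow> x \<in> carrier M \<Longrightarrow> (i x, f x) \<in> A"
    by (auto simp: S_def)
  have Sadd: "\<And>A x y x' y'. A \<in> S \<Longrightarrow> (x, y) \<in> A \<Longrightarrow> (x', y') \<in> A \<Longrightarrow> (x \<oplus>\<^bsub>N\<^esub> x', y \<oplus>\<^bsub>E\<^esub> y') \<in> A"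
    by (simp add: S_def)
  have Ssm: "\<And>A r x y. A \<in> S \<Longrightarrow> r \<in> carrier R \<Longrightarrow> (x, y) \<in> A \<Longrightarrow> (r \<odot>\<^bsub>N\<^esub> x, r \<odot>\<^bsub>E\<^esub> y) \<in> A"
    by (simp add: S_def)
  have Ssv: "\<And>A x y y'. A \<in> S \<Longrightarrow> (x, y) \<in> A \<Longrightarrow> (x, y') \<in> A \<Longrightarrow> y = y'"
    unfolding S_def mem_Collect_eq by (elim conjE) metis
  have i': "\<And>x. x \<in> carrier M \<Longrightarrow> i x \<in> carrier N"
    "\<And>x y. x \<in> carrier M \<Longrightarrow> y \<in> carrier M \<Longrightarrow> i (x \<oplus>\<^bsub>M\<^esub> y) = i x \<oplus>\<^bsub>N\<^esub> i y"
    "\<And>r x. r \<in> carrier R \<Longrightarrow> x \<in> carrier M \<Longrightarrow> i (r \<odot>\<^bsub>M\<^esub> x) = r \<odot>\<^bsub>N\<^esub> i x"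
    using i(1) by (auto simp: mod_hom_def)
  have f': "\<And>x. x \<in> carrier M \<Longrightarrow> f x \<in> carrier E"
    "\<And>x y. x \<in> carrier M \<Longrightarrow> y \<in> carrier M \<Longrightarrow> f (x \<oplus>\<^bsub>M\<^esub> y) = f x \<oplus>\<^bsub>E\<^esub> f y"
    "\<And>r x. r \<in> carrier R \<Longrightarrow> x \<in> carrier M \<Longrightarrow> f (r \<odot>\<^bsub>M\<^esub> x) = r \<odot>\<^bsub>E\<^esub> f x"
    using f by (auto simp: mod_hom_def)
  have "(\<lambda>x. (i x, f x)) ` carrier M \<in> S"
    unfolding S_def mem_Collect_eq
  proof (intro conjI allI impI, goal_cases)
    case 1 then show ?case using i' f' by auto
  next
    case 2 then show ?case by simp
  next
    case (3 x y x' y')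
    then obtain a b where "a \<in> carrier M" "b \<in> carrier M" "x = i a" "y = f a" "x' = i b" "y' = f b"
      by auto
    then show ?case using i' f' by (auto intro!: image_eqI[of _ _ "a \<oplus>\<^bsub>M\<^esub> b"])
  next
    case (4 r x y)
    then obtain a where "a \<in> carrier M" "x = i a" "y = f a" by auto
    then show ?case using 4 i' f' by (auto intro!: image_eqI[of _ _ "r \<odot>\<^bsub>M\<^esub> a"])
  next
    case (5 x y y') then show ?case using i(2) by (auto dest: inj_onD)
  qed
  then have ne: "S \<noteq> {}" by blast
  obtain G where G: "G \<in> S" and max: "\<And>X. X \<in> S \<Longrightarrow> G \<subseteq> X \<Longrightarrow> X = G"
  proof -
    have "\<exists>G\<in>S. \<forall>X\<in>S. G \<subseteq> X \<longrightarrow> X = G"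
    proof (rule subset_Zorn_nonempty[OF ne])
      fix C assume C: "C \<noteq> {}" "subset.chain S C"
      have sub: "\<And>A. A \<in> C \<Longrightarrow> A \<in> S" using C(2) by (auto simp: subset.chain_def)
      have common: "\<exists>A\<in>C. p \<in> A \<and> q \<in> A" if pq: "p \<in> \<Union>C" "q \<in> \<Union>C" for p q
      proof -
        obtain A B where "A \<in> C" "B \<in> C" "p \<in> A" "q \<in> B" using pq by auto
        moreover have "A \<subseteq> B \<or> B \<subseteq> A" 
          using C(2) \<open>A \<in> C\<close> \<open>B \<in> C\<close> unfolding subset_chain_def by blast
        ultimately show ?thesis by blast
      qed
      show "\<Union>C \<in> S"
        unfolding S_def mem_Collect_eq
      proof (intro conjI allI impI, goal_cases)
        case 1 show ?case using Sc[OF sub] by auto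
      next
        case 2
        obtain A where "A \<in> C" using C(1) by blast
        then show ?case using S0[OF sub] by auto
      next
        case (3 x y x' y')
        then obtain A where "A \<in> C" "(x, y) \<in> A" "(x', y') \<in> A" using common by blast
        then show ?case using Sadd[OF sub] by blast
      next
        case (4 r x y)
        then obtain A where "A \<in> C" "(x, y) \<in> A" by blast
        with 4 show ?case using Ssm[OF sub] by blast
      next
        case (5 x y y')
        then obtain A where "A \<in> C" "(x, y) \<in> A" "(x, y') \<in> A" using common by blast
        then show ?case using Ssv[OF sub] by blast
      qed
    qed
    then show thesis using that by metis
  qed
  have Gc: "\<And>x y. (x, y) \<in> G \<Longrightarrow> x \<in> carrier N \<and> y \<in> carrier E"
    and G0: "\<And>x. x \<in> carrier M \<Longrightarrow> (i x, f x) \<in> G"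
    and Gadd: "\<And>x y x' y'. (x, y) \<in> G \<Longrightarrow> (x', y') \<in> G \<Longrightarrow> (x \<oplus>\<^bsub>N\<^esub> x', y \<oplus>\<^bsub>E\<^esub> y') \<in> G"
    and Gsm: "\<And>r x y. r \<in> carrier R \<Longrightarrow> (x, y) \<in> G \<Longrightarrow> (r \<odot>\<^bsub>N\<^esub> x, r \<odot>\<^bsub>E\<^esub> y) \<in> G"
    and Gsv: "\<And>x y y'. (x, y) \<in> G \<Longrightarrow> (x, y') \<in> G \<Longrightarrow> y = y'"
    by (fact Sc[OF G] S0[OF G] Sadd[OF G] Ssm[OF G] Ssv[OF G])+
  have Gz: "(\<zero>\<^bsub>N\<^esub>, \<zero>\<^bsub>E\<^esub>) \<in> G"
    using Gsm[OF M.R.zero_closed G0[OF M.M.zero_closed]] i'(1) f'(1) by simp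
  have Gmin: "(x \<ominus>\<^bsub>N\<^esub> x', y \<ominus>\<^bsub>E\<^esub> y') \<in> G" if "(x, y) \<in> G" "(x', y') \<in> G" for x y x' y'
    using Gadd[OF that(1) Gsm[OF M.R.a_inv_closed[OF M.R.one_closed] that(2)]] Gc[OF that(1)] Gc[OF that(2)]
    by (simp add: N.smult_l_minus E.smult_l_minus a_minus_def)
  have total: "\<exists>y. (n, y) \<in> G" if n: "n \<in> carrier N" for n
  proof -
    define H where "H = {r \<in> carrier R. \<exists>y. (r \<odot>\<^bsub>N\<^esub> n, y) \<in> G}"
    define h where "h r = (THE y. (r \<odot>\<^bsub>N\<^esub> n, y) \<in> G)" for r
    have hI: "h r = y" if "(r \<odot>\<^bsub>N\<^esub> n, y) \<in> G" for r y
      unfolding h_def using that Gsv by blast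
    have hG: "(r \<odot>\<^bsub>N\<^esub> n, h r) \<in> G" if "r \<in> H" for r
      using that hI unfolding H_def by auto
    have Hc: "H \<subseteq> carrier R" by (auto simp: H_def)
    have Hadd: "r \<oplus>\<^bsub>R\<^esub> s \<in> H \<and> h (r \<oplus>\<^bsub>R\<^esub> s) = h r \<oplus>\<^bsub>E\<^esub> h s" if "r \<in> H" "s \<in> H" for r s
    proof -
      have "((r \<oplus>\<^bsub>R\<^esub> s) \<odot>\<^bsub>N\<^esub> n, h r \<oplus>\<^bsub>E\<^esub> h s) \<in> G"
        using Gadd[OF hG hG] that Hc n by (auto simp: N.smult_l_distr subset_iff)
      then show ?thesis using that Hc hI unfolding H_def by auto
    qed
    have Hsm: "r \<otimes>\<^bsub>R\<^esub> s \<in> H \<and> h (r \<otimes>\<^bsub>R\<^esub> s) = r \<odot>\<^bsub>E\<^esub> h s" if "r \<in> carrier R" "s \<in> H" for r s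
    proof -
      have "((r \<otimes>\<^bsub>R\<^esub> s) \<odot>\<^bsub>N\<^esub> n, r \<odot>\<^bsub>E\<^esub> h s) \<in> G"
        using Gsm[OF that(1) hG] that Hc n by (auto simp: N.smult_assoc1 subset_iff)
      then show ?thesis using that Hc hI unfolding H_def by auto
    qed
    have "\<zero>\<^bsub>R\<^esub> \<in> H" using Gz n by (auto simp: H_def)
    have "\<ominus>\<^bsub>R\<^esub> s \<in> H" if "s \<in> H" for s
      using Hsm[of "\<ominus>\<^bsub>R\<^esub> \<one>\<^bsub>R\<^esub>" s] that Hc by (simp add: M.R.l_minus subset_iff)
    moreover have "s \<otimes>\<^bsub>R\<^esub> r \<in> H" if "r \<in> carrier R" "s \<in> H" for r s
      using Hsm[OF that] that Hc M.R.m_comm[of r s] by auto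
    ultimately have "ideal H R"
      using Hc Hadd Hsm \<open>\<zero>\<^bsub>R\<^esub> \<in> H\<close>
      by (intro idealI M.R.ring_axioms)
        (auto intro!: group.subgroupI[OF M.R.a_group] simp: subset_iff a_inv_def[symmetric])
    moreover have "h \<in> H \<rightarrow> carrier E" using hG Gc by blast
    ultimately obtain e where e: "e \<in> carrier E" "\<And>r. r \<in> H \<Longrightarrow> h r = r \<odot>\<^bsub>E\<^esub> e"
      using baer_criterion[OF inj] Hadd Hsm by metis
    define G' where "G' = {(x \<oplus>\<^bsub>N\<^esub> r \<odot>\<^bsub>N\<^esub> n, y \<oplus>\<^bsub>E\<^esub> r \<odot>\<^bsub>E\<^esub> e) | x y r. (x, y) \<in> G \<and> r \<in> carrier R}"
    have sub: "G \<subseteq> G'"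
    proof clarify
      fix x y assume "(x, y) \<in> G"
      then show "(x, y) \<in> G'" unfolding G'_def using Gc[of x y] n e(1)
        by (auto intro!: exI[of _ x] exI[of _ y] exI[of _ "\<zero>\<^bsub>R\<^esub>"])
    qed
    have "G' \<in> S"
      unfolding S_def mem_Collect_eq
    proof (intro conjI allI impI, goal_cases)
      case 1 then show ?case using Gc n e(1) by (auto simp: G'_def)
    next
      case 2 then show ?case using G0 sub by blast
    next
      case (3 x y x' y')
      then obtain a b r a' b' r' where *: "(a, b) \<in> G" "r \<in> carrier R" "(a', b') \<in> G" "r' \<in> carrier R"
        "x = a \<oplus>\<^bsub>N\<^esub> r \<odot>\<^bsub>N\<^esub> n" "y = b \<oplus>\<^bsub>E\<^esub> r \<odot>\<^bsub>E\<^esub> e"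
        "x' = a' \<oplus>\<^bsub>N\<^esub> r' \<odot>\<^bsub>N\<^esub> n" "y' = b' \<oplus>\<^bsub>E\<^esub> r' \<odot>\<^bsub>E\<^esub> e"
        unfolding G'_def by blast
      have "x \<oplus>\<^bsub>N\<^esub> x' = (a \<oplus>\<^bsub>N\<^esub> a') \<oplus>\<^bsub>N\<^esub> (r \<oplus>\<^bsub>R\<^esub> r') \<odot>\<^bsub>N\<^esub> n"
        using * Gc[OF *(1)] Gc[OF *(3)] n by (simp add: N.smult_l_distr N.M.a_ac)
      moreover have "y \<oplus>\<^bsub>E\<^esub> y' = (b \<oplus>\<^bsub>E\<^esub> b') \<oplus>\<^bsub>E\<^esub> (r \<oplus>\<^bsub>R\<^esub> r') \<odot>\<^bsub>E\<^esub> e"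
        using * Gc[OF *(1)] Gc[OF *(3)] e(1) by (simp add: E.smult_l_distr E.M.a_ac)
      ultimately show ?case
        unfolding G'_def using Gadd[OF *(1) *(3)] *(2,4) by blast
    next
      case (4 s x y)
      then obtain a b r where *: "(a, b) \<in> G" "r \<in> carrier R"
        "x = a \<oplus>\<^bsub>N\<^esub> r \<odot>\<^bsub>N\<^esub> n" "y = b \<oplus>\<^bsub>E\<^esub> r \<odot>\<^bsub>E\<^esub> e"
        unfolding G'_def by blast
      have "s \<odot>\<^bsub>N\<^esub> x = s \<odot>\<^bsub>N\<^esub> a \<oplus>\<^bsub>N\<^esub> (s \<otimes>\<^bsub>R\<^esub> r) \<odot>\<^bsub>N\<^esub> n"
        using * 4 Gc[OF *(1)] n by (simp add: N.smult_r_distr N.smult_assoc1)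
      moreover have "s \<odot>\<^bsub>E\<^esub> y = s \<odot>\<^bsub>E\<^esub> b \<oplus>\<^bsub>E\<^esub> (s \<otimes>\<^bsub>R\<^esub> r) \<odot>\<^bsub>E\<^esub> e"
        using * 4 Gc[OF *(1)] e(1) by (simp add: E.smult_r_distr E.smult_assoc1)
      moreover have "s \<otimes>\<^bsub>R\<^esub> r \<in> carrier R" using 4 *(2) by simp
      ultimately show ?case
        unfolding G'_def using Gsm[of s, OF _ *(1)] 4 by blast
    next
      case (5 x y y')
      then obtain a b r a' b' r' where *: "(a, b) \<in> G" "r \<in> carrier R" "(a', b') \<in> G" "r' \<in> carrier R"
        "x = a \<oplus>\<^bsub>N\<^esub> r \<odot>\<^bsub>N\<^esub> n" "y = b \<oplus>\<^bsub>E\<^esub> r \<odot>\<^bsub>E\<^esub> e"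
        "x = a' \<oplus>\<^bsub>N\<^esub> r' \<odot>\<^bsub>N\<^esub> n" "y' = b' \<oplus>\<^bsub>E\<^esub> r' \<odot>\<^bsub>E\<^esub> e"
        unfolding G'_def by blast
      note c = Gc[OF *(1)] Gc[OF *(3)] *(2,4) n e(1)
      have key: "P = Q"
        if "abelian_group A" "b \<in> carrier A" "b' \<in> carrier A" "u \<in> carrier A" "u' \<in> carrier A"
          "u \<ominus>\<^bsub>A\<^esub> u' = b' \<ominus>\<^bsub>A\<^esub> b" "P = b \<oplus>\<^bsub>A\<^esub> u" "Q = b' \<oplus>\<^bsub>A\<^esub> u'" for A :: "('z, 'y) ring_scheme" and P Q b b' u u'
      proof -
        interpret A: abelian_group A by fact
        have "u = (b' \<ominus>\<^bsub>A\<^esub> b) \<oplus>\<^bsub>A\<^esub> u'"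
          using that by (metis A.a_inv_closed A.add.inv_solve_right A.minus_closed A.minus_eq)
        moreover have "b \<oplus>\<^bsub>A\<^esub> (u' \<oplus>\<^bsub>A\<^esub> \<ominus>\<^bsub>A\<^esub> b) = u'"
          using A.a_lcomm[of b u' "\<ominus>\<^bsub>A\<^esub> b"] that by (simp add: A.r_neg)
        ultimately show ?thesis using that(2-5,7,8)
          by (simp add: A.minus_eq A.a_ac)
      qed
      have key': "u \<ominus>\<^bsub>A\<^esub> u' = b' \<ominus>\<^bsub>A\<^esub> b"
        if "abelian_group A" "b \<in> carrier A" "b' \<in> carrier A" "u \<in> carrier A" "u' \<in> carrier A"
          "b \<oplus>\<^bsub>A\<^esub> u = b' \<oplus>\<^bsub>A\<^esub> u'" for A :: "('z, 'y) ring_scheme" and b b' u u'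
      proof -
        interpret A: abelian_group A by fact
        have "u = \<ominus>\<^bsub>A\<^esub> b \<oplus>\<^bsub>A\<^esub> (b' \<oplus>\<^bsub>A\<^esub> u')" using that by (metis A.r_neg1)
        moreover have "u' \<oplus>\<^bsub>A\<^esub> (\<ominus>\<^bsub>A\<^esub> b \<oplus>\<^bsub>A\<^esub> \<ominus>\<^bsub>A\<^esub> u') = \<ominus>\<^bsub>A\<^esub> b"
          using A.a_lcomm[of u' "\<ominus>\<^bsub>A\<^esub> b" "\<ominus>\<^bsub>A\<^esub> u'"] that by (simp add: A.r_neg)
        ultimately show ?thesis using that(2-5)
          by (simp add: A.minus_eq A.a_ac)
      qed
      have "r \<odot>\<^bsub>N\<^esub> n \<ominus>\<^bsub>N\<^esub> r' \<odot>\<^bsub>N\<^esub> n = a' \<ominus>\<^bsub>N\<^esub> a"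
        using key'[OF N.M.abelian_group_axioms, of a a'] * c by simp
      then have "(r \<ominus>\<^bsub>R\<^esub> r') \<odot>\<^bsub>N\<^esub> n = a' \<ominus>\<^bsub>N\<^esub> a"
        using c by (simp add: a_minus_def N.smult_l_distr N.smult_l_minus)
      then have "((r \<ominus>\<^bsub>R\<^esub> r') \<odot>\<^bsub>N\<^esub> n, b' \<ominus>\<^bsub>E\<^esub> b) \<in> G" using Gmin[OF *(3) *(1)] by simp
      moreover from this have "r \<ominus>\<^bsub>R\<^esub> r' \<in> H" using c by (auto simp: H_def)
      ultimately have "(r \<ominus>\<^bsub>R\<^esub> r') \<odot>\<^bsub>E\<^esub> e = b' \<ominus>\<^bsub>E\<^esub> b" using hI e(2) by metis
      then have "r \<odot>\<^bsub>E\<^esub> e \<ominus>\<^bsub>E\<^esub> r' \<odot>\<^bsub>E\<^esub> e = b' \<ominus>\<^bsub>E\<^esub> b"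
        using c by (simp add: a_minus_def E.smult_l_distr E.smult_l_minus)
      then show ?case
        using key[OF E.M.abelian_group_axioms, of b b'] * c by simp
    qed
    then have "G' = G" using max sub by blast
    moreover have "(\<zero>\<^bsub>N\<^esub> \<oplus>\<^bsub>N\<^esub> \<one>\<^bsub>R\<^esub> \<odot>\<^bsub>N\<^esub> n, \<zero>\<^bsub>E\<^esub> \<oplus>\<^bsub>E\<^esub> \<one>\<^bsub>R\<^esub> \<odot>\<^bsub>E\<^esub> e) \<in> G'"
      unfolding G'_def using Gz by blast
    ultimately show ?thesis using n by auto
  qed
  define g where "g n = (THE y. (n, y) \<in> G)" for n
  have gI: "g n = y" if "(n, y) \<in> G" for n y
    unfolding g_def using that Gsv by blast
  have gG: "(n, g n) \<in> G" if "n \<in> carrier N" for n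
    using total[OF that] gI by auto
  have "g \<in> mod_hom R N E"
    using gG Gc Gadd Gsm gI by (auto simp: mod_hom_def)
  moreover have "\<forall>x \<in> carrier M. g (i x) = f x" using G0 gI by blast
  ultimately show ?thesis by blast
qed

definition essential_submodule ::
    "('a, 'r) ring_scheme \<Rightarrow> ('a, 'e, 'm) module_scheme \<Rightarrow> 'e set \<Rightarrow> bool" where
  "essential_submodule R E U \<longleftrightarrow> submodule U R E \<and>
     (\<forall>V. submodule V R E \<and> V \<noteq> {\<zero>\<^bsub>E\<^esub>} \<longrightarrow> U \<inter> V \<noteq> {\<zero>\<^bsub>E\<^esub>})"

definition injective_hull ::
    "('a, 'r) ring_scheme \<Rightarrow> ('a, 'b, 'm) module_scheme \<Rightarrow> ('a, 'e, 'n) module_scheme \<Rightarrow> bool" where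
  "injective_hull R M E \<longleftrightarrow> injective_module R E \<and>
     (\<exists>i \<in> mod_hom R M E. inj_on i (carrier M) \<and> essential_submodule R E (i ` carrier M))"


section \<open>Adic completion\<close>

abbreviation ideal_power :: "('a, 'r) ring_scheme \<Rightarrow> 'a set \<Rightarrow> nat \<Rightarrow> 'a set" where
  "ideal_power R I n \<equiv> I [^]\<^bsub>ideals_set R\<^esub> n"

text \<open>
  The inverse limit of the rings \<open>R / I\<^sup>n\<close>. The transition map \<open>R / I\<^bsup>n+1\<^esup> \<rightarrow> R / I\<^sup>n\<close> sends a coset
  to the unique coset containing it, so compatibility of a sequence of cosets is inclusion.
\<close>

definition completion :: "('a, 'r) ring_scheme \<Rightarrow> 'a set \<Rightarrow> (nat \<Rightarrow> 'a set) ring" where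
  "completion R I =
     \<lparr>carrier = {u. \<forall>n. u n \<in> carrier (R Quot ideal_power R I n) \<and> u (Suc n) \<subseteq> u n},
      mult = (\<lambda>u v n. u n \<otimes>\<^bsub>R Quot ideal_power R I n\<^esub> v n),
      one = (\<lambda>n. \<one>\<^bsub>R Quot ideal_power R I n\<^esub>),
      zero = (\<lambda>n. \<zero>\<^bsub>R Quot ideal_power R I n\<^esub>),
      add = (\<lambda>u v n. u n \<oplus>\<^bsub>R Quot ideal_power R I n\<^esub> v n)\<rparr>"

definition completion_map :: "('a, 'r) ring_scheme \<Rightarrow> 'a set \<Rightarrow> 'a \<Rightarrow> (nat \<Rightarrow> 'a set)" where
  "completion_map R I r = (\<lambda>n. ideal_power R I n +>\<^bsub>R\<^esub> r)"

text \<open>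
  The action of the completion on an \<open>R\<close>-module each of whose elements is annihilated by a power
  of \<open>I\<close>: if \<open>I\<^sup>n x = 0\<close> then \<open>u \<cdot> x = r \<cdot> x\<close> for any representative \<open>r\<close> of \<open>u n\<close>. The value does not
  depend on \<open>n\<close> or \<open>r\<close>; on modules with other elements the definite description is unspecified.
\<close>

definition completion_module ::
    "('a, 'r) ring_scheme \<Rightarrow> 'a set \<Rightarrow> ('a, 'e, 'm) module_scheme \<Rightarrow> (nat \<Rightarrow> 'a set, 'e) module" where
  "completion_module R I M =
     \<lparr>carrier = carrier M, mult = mult M, one = one M, zero = zero M, add = add M,
      smult = (\<lambda>u x. THE y. \<exists>n. \<exists>r \<in> u n.
                 (\<forall>s \<in> ideal_power R I n. s \<odot>\<^bsub>M\<^esub> x = \<zero>\<^bsub>M\<^esub>) \<and> y = r \<odot>\<^bsub>M\<^esub> x)\<rparr>"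


section \<open>Total quotient ring\<close>

definition frac_rel :: "('a, 'r) ring_scheme \<Rightarrow> (('a \<times> 'a) \<times> ('a \<times> 'a)) set" where
  "frac_rel R = {((a, s), (b, t)).
     a \<in> carrier R \<and> s \<in> non_zero_divisors R \<and> b \<in> carrier R \<and> t \<in> non_zero_divisors R \<and>
     a \<otimes>\<^bsub>R\<^esub> t = b \<otimes>\<^bsub>R\<^esub> s}"

definition total_quotient_ring :: "('a, 'r) ring_scheme \<Rightarrow> ('a \<times> 'a) set ring" where
  "total_quotient_ring R =
     \<lparr>carrier = (carrier R \<times> non_zero_divisors R) // frac_rel R,
      mult = (\<lambda>X Y. \<Union>(a, s) \<in> X. \<Union>(b, t) \<in> Y. frac_rel R `` {(a \<otimes>\<^bsub>R\<^esub> b, s \<otimes>\<^bsub>R\<^esub> t)}),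
      one = frac_rel R `` {(\<one>\<^bsub>R\<^esub>, \<one>\<^bsub>R\<^esub>)},
      zero = frac_rel R `` {(\<zero>\<^bsub>R\<^esub>, \<one>\<^bsub>R\<^esub>)},
      add = (\<lambda>X Y. \<Union>(a, s) \<in> X. \<Union>(b, t) \<in> Y.
               frac_rel R `` {(a \<otimes>\<^bsub>R\<^esub> t \<oplus>\<^bsub>R\<^esub> b \<otimes>\<^bsub>R\<^esub> s, s \<otimes>\<^bsub>R\<^esub> t)})\<rparr>"

definition total_quotient_map :: "('a, 'r) ring_scheme \<Rightarrow> 'a \<Rightarrow> ('a \<times> 'a) set" where
  "total_quotient_map R r = frac_rel R `` {(r, \<one>\<^bsub>R\<^esub>)}"


section \<open>Tensor product of algebras\<close>

text \<open>
  \<open>A \<otimes>\<^sub>R B\<close> is the free abelian group on \<open>A \<times> B\<close> modulo the subgroup generated by the bilinearity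
  relations. Its multiplication is induced by \<open>(a, b) (c, d) = (a c, b d)\<close> on the free abelian group;
  for \<open>R\<close>-algebras the subgroup is an ideal, and \<open>Quot\<close> is the quotient ring.
\<close>

definition free_product_ring ::
    "('b, 'm) ring_scheme \<Rightarrow> ('c, 'n) ring_scheme \<Rightarrow> (('b \<times> 'c) \<Rightarrow>\<^sub>0 int) ring" where
  "free_product_ring A B =
     \<lparr>carrier = {x. Poly_Mapping.keys x \<subseteq> carrier A \<times> carrier B},
      mult = (\<lambda>x y. frag_extend (\<lambda>(a, b). frag_extend (\<lambda>(c, d). frag_of (a \<otimes>\<^bsub>A\<^esub> c, b \<otimes>\<^bsub>B\<^esub> d)) y) x),
      one = frag_of (\<one>\<^bsub>A\<^esub>, \<one>\<^bsub>B\<^esub>),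
      zero = 0,
      add = (+)\<rparr>"

definition tensor_relations ::
    "('a, 'r) ring_scheme \<Rightarrow> ('a, 'b, 'm) module_scheme \<Rightarrow> ('a, 'c, 'n) module_scheme
      \<Rightarrow> (('b \<times> 'c) \<Rightarrow>\<^sub>0 int) set" where
  "tensor_relations R A B =
     {frag_of (a \<oplus>\<^bsub>A\<^esub> a', b) - frag_of (a, b) - frag_of (a', b) | a a' b.
        a \<in> carrier A \<and> a' \<in> carrier A \<and> b \<in> carrier B} \<union>
     {frag_of (a, b \<oplus>\<^bsub>B\<^esub> b') - frag_of (a, b) - frag_of (a, b') | a b b'.
        a \<in> carrier A \<and> b \<in> carrier B \<and> b' \<in> carrier B} \<union>
     {frag_of (r \<odot>\<^bsub>A\<^esub> a, b) - frag_of (a, r \<odot>\<^bsub>B\<^esub> b) | r a b.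
        r \<in> carrier R \<and> a \<in> carrier A \<and> b \<in> carrier B}"

definition tensor_subgroup ::
    "('a, 'r) ring_scheme \<Rightarrow> ('a, 'b, 'm) module_scheme \<Rightarrow> ('a, 'c, 'n) module_scheme
      \<Rightarrow> (('b \<times> 'c) \<Rightarrow>\<^sub>0 int) set" where
  "tensor_subgroup R A B =
     generate (add_monoid (free_product_ring A B)) (tensor_relations R A B)"

definition tensor_algebra ::
    "('a, 'r) ring_scheme \<Rightarrow> ('a, 'b, 'm) module_scheme \<Rightarrow> ('a, 'c, 'n) module_scheme
      \<Rightarrow> (('b \<times> 'c) \<Rightarrow>\<^sub>0 int) set ring" where
  "tensor_algebra R A B = free_product_ring A B Quot tensor_subgroup R A B"

definition pure_tensor ::
    "('a, 'r) ring_scheme \<Rightarrow> ('a, 'b, 'm) module_scheme \<Rightarrow> ('a, 'c, 'n) module_scheme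
      \<Rightarrow> 'b \<Rightarrow> 'c \<Rightarrow> (('b \<times> 'c) \<Rightarrow>\<^sub>0 int) set" where
  "pure_tensor R A B a b = tensor_subgroup R A B +>\<^bsub>free_product_ring A B\<^esub> frag_of (a, b)"

definition extended_ideal ::
    "('a, 'r) ring_scheme \<Rightarrow> ('a, 'b, 'm) module_scheme \<Rightarrow> ('a, 'c, 'n) module_scheme
      \<Rightarrow> 'b set \<Rightarrow> (('b \<times> 'c) \<Rightarrow>\<^sub>0 int) set set" where
  "extended_ideal R A B I =
     Idl\<^bsub>tensor_algebra R A B\<^esub> ((\<lambda>u. pure_tensor R A B u \<one>\<^bsub>B\<^esub>) ` I)"

abbreviation completion_algebra ::
    "('a, 'r) ring_scheme \<Rightarrow> 'a set \<Rightarrow> ('a, nat \<Rightarrow> 'a set) module" where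
  "completion_algebra R I \<equiv> algebra_via (completion_map R I) (completion R I)"

abbreviation total_quotient_algebra :: "('a, 'r) ring_scheme \<Rightarrow> ('a, ('a \<times> 'a) set) module" where
  "total_quotient_algebra R \<equiv> algebra_via (total_quotient_map R) (total_quotient_ring R)"

end

theory Submission
  imports Defs "HOL-Algebra.Free_Abelian_Groups"
begin

text \<open>
  Write \<open>A\<close> for the \<open>\<mm>\<close>-adic completion of \<open>R\<close> and \<open>S\<close> for the set of non-zero-divisors of \<open>R\<close>. The
  theorem combines two correspondences.

  Matlis duality. Taking annihilators in both directions is an order-reversing bijection between the
  \<open>R\<close>-submodules of \<open>E\<close> and the ideals of \<open>A\<close> (\<open>annE_hat_ann_hat\<close>, \<open>ann_hat_annE_hat\<close>). The equation
  \<open>s N = N\<close> says under this bijection that \<open>s\<close> is a non-zero-divisor on \<open>A / Ann N\<close>: the annihilator of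
  \<open>s N\<close> is \<open>(Ann N : s)\<close>, and submodules are determined by their annihilators (\<open>divisible_iff\<close>). So the
  divisible submodules correspond to the ideals of \<open>A\<close> that are saturated with respect to \<open>S\<close>, and the
  simple divisible ones to the maximal elements among the proper saturated ideals.

  Localization. \<open>A \<otimes> K\<close> is the localization of \<open>A\<close> at \<open>S\<close>, so extension and contraction are inverse
  bijections between saturated ideals of \<open>A\<close> and all ideals of \<open>A \<otimes> K\<close> (\<open>ext_contraction\<close>,
  \<open>contraction_ext\<close>), and maximal proper saturated ideals become maximal ideals.

  Duality rests on the fact that every \<open>R\<close>-endomorphism of \<open>E\<close> is the action of an element of \<open>A\<close>
  (\<open>End_is_act\<close>). On the part of \<open>E\<close> killed by an ideal \<open>J\<close> containing a power of \<open>\<mm>\<close>, an endomorphism is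
  multiplication by a ring element, by Noetherian induction that enlarges \<open>J\<close> by one element \<open>x\<close> with
  \<open>\<mm> x \<subseteq> J\<close> at a time and rests on the socle of \<open>E\<close> being one-dimensional (\<open>End_on_annE\<close>).
  Injectivity of \<open>E\<close> then shows that submodules are double annihilators, and also that finitely generated ideals of \<open>A\<close> are (\<open>fin_gen_double_annihilator\<close>).

  It remains to see that all ideals of \<open>A\<close> are finitely generated (\<open>completion_noetherian\<close>). If \<open>M\<close> is
  maximal among those that are not, and \<open>x \<in> \<mm>\<close> lies outside \<open>M\<close>, then Cohen's argument gives
  \<open>M = Q + x M\<close> with \<open>Q \<subseteq> M\<close> finitely generated. Hence \<open>M = Q + x\<^sup>n M\<close> for all \<open>n\<close>; every element
  of \<open>E\<close> is killed by some \<open>x\<^sup>n\<close>, so \<open>M\<close> annihilates whatever \<open>Q\<close> annihilates, and \<open>M = Q\<close> because \<open>Q\<close>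
  is a double annihilator. An ideal \<open>M\<close> that contains \<open>\<mm>\<close> is either the closure of \<open>\<mm>\<close> or the whole ring.
\<close>

section \<open>Algebras and their tensor product\<close>

lemma algebra_algebra_via:
  assumes "cring R" "cring B" "h \<in> ring_hom R B"
  shows "algebra R (algebra_via h B)"
proof -
  interpret R: cring R by fact
  interpret B: cring B by fact
  have h: "\<And>x. x \<in> carrier R \<Longrightarrow> h x \<in> carrier B"
    using ring_hom_closed[OF assms(3)] .
  have c: "cring (algebra_via h B)"
  proof (rule cringI)
    show "abelian_group (algebra_via h B)"
      by (rule abelian_groupI) (auto simp: algebra_via_def B.a_ac intro: B.add.l_inv_ex)
    show "Group.comm_monoid (algebra_via h B)"
      by (rule comm_monoidI) (auto simp: algebra_via_def B.m_ac)
  qed (auto simp: algebra_via_def B.l_distr)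
  show ?thesis
    by (rule algebraI[OF assms(1) c])
      (auto simp: algebra_via_def h ring_hom_add[OF assms(3)] ring_hom_mult[OF assms(3)]
          ring_hom_one[OF assms(3)] B.l_distr B.r_distr B.m_assoc)
qed

lemma frag_cmul_diff: "frag_cmul c (x - y) = frag_cmul c x - frag_cmul c y"
  by (rule poly_mapping_eqI) (simp add: lookup_minus right_diff_distrib)

lemma frag_extend_fun_diff:
  "frag_extend (\<lambda>p. f p - g p) x = frag_extend f x - frag_extend g x"
  by (simp add: frag_extend_def frag_cmul_diff sum_subtractf)

lemma frag_extend_fun_add:
  "frag_extend (\<lambda>p. f p + g p) x = frag_extend f x + frag_extend g x"
  by (simp add: frag_extend_def frag_cmul_distrib2 sum.distrib)

locale algebra_pair = A: algebra R A + B: algebra R B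
  for R :: "('a, 'r) ring_scheme" (structure)
    and A :: "('a, 'b, 'm) module_scheme" and B :: "('a, 'c, 'n) module_scheme"
begin

abbreviation "F \<equiv> free_product_ring A B"
abbreviation "U \<equiv> tensor_subgroup R A B"
abbreviation "T \<equiv> tensor_algebra R A B"
abbreviation "pure \<equiv> pure_tensor R A B"

lemma F_simps:
  "x \<oplus>\<^bsub>F\<^esub> y = x + y" "\<zero>\<^bsub>F\<^esub> = 0" "\<one>\<^bsub>F\<^esub> = frag_of (\<one>\<^bsub>A\<^esub>, \<one>\<^bsub>B\<^esub>)"
  "x \<in> carrier F \<longleftrightarrow> Poly_Mapping.keys x \<subseteq> carrier A \<times> carrier B"
  by (simp_all add: free_product_ring_def)

lemma F_mult: "x \<otimes>\<^bsub>F\<^esub> y =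
  frag_extend (\<lambda>p. frag_extend (\<lambda>q. frag_of (fst p \<otimes>\<^bsub>A\<^esub> fst q, snd p \<otimes>\<^bsub>B\<^esub> snd q)) y) x"
  by (simp add: free_product_ring_def case_prod_beta')

lemma F_closed:
  "0 \<in> carrier F" "x \<in> carrier F \<Longrightarrow> y \<in> carrier F \<Longrightarrow> x - y \<in> carrier F"
  "x \<in> carrier F \<Longrightarrow> - x \<in> carrier F"
  "x \<in> carrier F \<Longrightarrow> y \<in> carrier F \<Longrightarrow> x + y \<in> carrier F"
  "a \<in> carrier A \<Longrightarrow> b \<in> carrier B \<Longrightarrow> frag_of (a, b) \<in> carrier F"
  using keys_diff[of x y] keys_add[of x y] by (auto simp: F_simps)

lemma F_induct [consumes 1, case_names zero one diff]:
  assumes "x \<in> carrier F" "P 0"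
    "\<And>a b. a \<in> carrier A \<Longrightarrow> b \<in> carrier B \<Longrightarrow> P (frag_of (a, b))"
    "\<And>x y. x \<in> carrier F \<Longrightarrow> y \<in> carrier F \<Longrightarrow> P x \<Longrightarrow> P y \<Longrightarrow> P (x - y)"
  shows "P x"
proof -
  have "x \<in> carrier F \<and> P x"
    using assms(1)[unfolded F_simps]
  proof (induction rule: frag_induction)
    case (diff x y)
    then show ?case using assms(4)[of x y] F_closed(2) by blast
  next
    case (one p)
    then show ?case using assms(3) by (auto simp: F_closed)
  qed (use assms in \<open>auto simp: F_closed\<close>)
  then show ?thesis ..
qed

lemma F_mult_linear:
  "(x - y) \<otimes>\<^bsub>F\<^esub> z = x \<otimes>\<^bsub>F\<^esub> z - y \<otimes>\<^bsub>F\<^esub> z" "z \<otimes>\<^bsub>F\<^esub> (x - y) = z \<otimes>\<^bsub>F\<^esub> x - z \<otimes>\<^bsub>F\<^esub> y"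
  "(x + y) \<otimes>\<^bsub>F\<^esub> z = x \<otimes>\<^bsub>F\<^esub> z + y \<otimes>\<^bsub>F\<^esub> z" "z \<otimes>\<^bsub>F\<^esub> (x + y) = z \<otimes>\<^bsub>F\<^esub> x + z \<otimes>\<^bsub>F\<^esub> y"
  "0 \<otimes>\<^bsub>F\<^esub> z = 0" "z \<otimes>\<^bsub>F\<^esub> 0 = 0"
       apply (simp_all add: F_mult frag_extend_diff frag_extend_add frag_extend_fun_diff frag_extend_fun_add)
  by (simp add: frag_extend_def)

lemma F_mult_of: "frag_of (a, b) \<otimes>\<^bsub>F\<^esub> frag_of (c, d) = frag_of (a \<otimes>\<^bsub>A\<^esub> c, b \<otimes>\<^bsub>B\<^esub> d)"
  by (simp add: F_mult)

lemma F_mult_closed: "x \<in> carrier F \<Longrightarrow> y \<in> carrier F \<Longrightarrow> x \<otimes>\<^bsub>F\<^esub> y \<in> carrier F"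
proof (induction x rule: F_induct)
  case (one a b)
  show ?case
    using one(3,1,2) by (induction y rule: F_induct) (auto simp: F_mult_linear F_mult_of F_closed)
qed (auto simp: F_mult_linear F_closed)

lemma F_mult_comm: "x \<in> carrier F \<Longrightarrow> y \<in> carrier F \<Longrightarrow> x \<otimes>\<^bsub>F\<^esub> y = y \<otimes>\<^bsub>F\<^esub> x"
proof (induction x rule: F_induct)
  case (one a b)
  show ?case
    using one(3,1,2)
    by (induction y rule: F_induct) (auto simp: F_mult_linear F_mult_of A.m_comm B.m_comm)
qed (auto simp: F_mult_linear)

lemma F_mult_assoc:
  "x \<in> carrier F \<Longrightarrow> y \<in> carrier F \<Longrightarrow> z \<in> carrier F \<Longrightarrow> x \<otimes>\<^bsub>F\<^esub> y \<otimes>\<^bsub>F\<^esub> z = x \<otimes>\<^bsub>F\<^esub> (y \<otimes>\<^bsub>F\<^esub> z)"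
proof (induction x rule: F_induct)
  case (one a b)
  note ab = one(1,2)
  show ?case
    using one(3,4)
  proof (induction y rule: F_induct)
    case (one c d)
    show ?case
      using one(3,1,2) ab
      by (induction z rule: F_induct) (auto simp: F_mult_linear F_mult_of A.m_assoc B.m_assoc)
  qed (auto simp: F_mult_linear)
qed (auto simp: F_mult_linear)

lemma F_one_mult: "x \<in> carrier F \<Longrightarrow> \<one>\<^bsub>F\<^esub> \<otimes>\<^bsub>F\<^esub> x = x"
  by (induction x rule: F_induct) (auto simp: F_mult_linear F_mult_of F_simps(3))

lemma cring_F: "cring F"
proof (rule cringI)
  show "abelian_group F"
  proof (rule abelian_groupI)
    fix x assume "x \<in> carrier F"
    then show "\<exists>y \<in> carrier F. y \<oplus>\<^bsub>F\<^esub> x = \<zero>\<^bsub>F\<^esub>"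
      by (intro bexI[of _ "- x"]) (auto simp: F_simps(1,2) F_closed)
  qed (auto simp: F_simps(1,2) F_closed add_ac)
  show "Group.comm_monoid F"
  proof (rule comm_monoidI)
    show "\<one>\<^bsub>F\<^esub> \<in> carrier F" by (simp add: F_simps(3) F_closed)
  qed (fact F_mult_closed F_mult_assoc F_one_mult F_mult_comm)+
qed (auto simp: F_simps(1) F_mult_linear)

sublocale F: cring F by (rule cring_F)

lemma F_minus: "x \<in> carrier F \<Longrightarrow> \<ominus>\<^bsub>F\<^esub> x = - x"
  by (rule sym, rule F.sum_zero_eq_neg) (auto simp: F_simps(1,2) F_closed)

lemma tensor_relations_closed: "tensor_relations R A B \<subseteq> carrier F"
  by (auto simp: tensor_relations_def intro!: F_closed)

lemma U_subgroup: "subgroup U (add_monoid F)"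
  unfolding tensor_subgroup_def
  using F.a_group tensor_relations_closed by (intro group.generate_is_subgroup) auto

lemma U_induct [consumes 1, case_names zero rel minus add]:
  assumes "x \<in> U" "P 0" "\<And>x. x \<in> tensor_relations R A B \<Longrightarrow> P x"
    "\<And>x. x \<in> tensor_relations R A B \<Longrightarrow> P (- x)"
    "\<And>x y. x \<in> U \<Longrightarrow> y \<in> U \<Longrightarrow> P x \<Longrightarrow> P y \<Longrightarrow> P (x + y)"
  shows "P x"
  using assms(1) unfolding tensor_subgroup_def
proof (induction rule: generate.induct)
  case (inv h)
  moreover have "inv\<^bsub>add_monoid F\<^esub> h = - h"
    using inv tensor_relations_closed F_minus[of h] by (auto simp: a_inv_def)
  ultimately show ?case using assms(4) by simp
next
  case (eng h1 h2)
  then show ?case using assms(5)[of h1 h2] by (simp add: tensor_subgroup_def F_simps(1))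
qed (use assms in \<open>auto simp: F_simps(2)\<close>)

lemma U_closed:
  "U \<subseteq> carrier F" "0 \<in> U" "x \<in> U \<Longrightarrow> y \<in> U \<Longrightarrow> x + y \<in> U" "x \<in> U \<Longrightarrow> - x \<in> U"
  "x \<in> U \<Longrightarrow> y \<in> U \<Longrightarrow> x - y \<in> U"
  "x \<in> tensor_relations R A B \<Longrightarrow> x \<in> U"
proof -
  show sub: "U \<subseteq> carrier F" using subgroup.subset[OF U_subgroup] by simp
  show "0 \<in> U" using subgroup.one_closed[OF U_subgroup] by (simp add: F_simps(2))
  show add: "\<And>x y. x \<in> U \<Longrightarrow> y \<in> U \<Longrightarrow> x + y \<in> U"
    using subgroup.m_closed[OF U_subgroup] by (simp add: F_simps(1))
  show min: "- x \<in> U" if "x \<in> U" for x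
  proof -
    have "\<ominus>\<^bsub>F\<^esub> x \<in> U"
      unfolding a_inv_def by (rule subgroup.m_inv_closed[OF U_subgroup that])
    then show ?thesis using F_minus[of x] sub that by auto
  qed
  show "x \<in> U \<Longrightarrow> y \<in> U \<Longrightarrow> x - y \<in> U" using add[of x "- y"] min[of y] by simp
  show "x \<in> tensor_relations R A B \<Longrightarrow> x \<in> U"
    unfolding tensor_subgroup_def by (rule generate.incl)
qed

lemma relations_mult_of:
  assumes "x \<in> tensor_relations R A B" "c \<in> carrier A" "d \<in> carrier B"
  shows "x \<otimes>\<^bsub>F\<^esub> frag_of (c, d) \<in> tensor_relations R A B"
proof -
  consider (1) a a' b where "x = frag_of (a \<oplus>\<^bsub>A\<^esub> a', b) - frag_of (a, b) - frag_of (a', b)"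
      "a \<in> carrier A" "a' \<in> carrier A" "b \<in> carrier B"
    | (2) a b b' where "x = frag_of (a, b \<oplus>\<^bsub>B\<^esub> b') - frag_of (a, b) - frag_of (a, b')"
      "a \<in> carrier A" "b \<in> carrier B" "b' \<in> carrier B"
    | (3) r a b where "x = frag_of (r \<odot>\<^bsub>A\<^esub> a, b) - frag_of (a, r \<odot>\<^bsub>B\<^esub> b)"
      "r \<in> carrier R" "a \<in> carrier A" "b \<in> carrier B"
    using assms(1) unfolding tensor_relations_def by blast
  then show ?thesis
  proof cases
    case 1
    then show ?thesis unfolding tensor_relations_def
      by (intro UnI1 CollectI exI[of _ "a \<otimes>\<^bsub>A\<^esub> c"] exI[of _ "a' \<otimes>\<^bsub>A\<^esub> c"] exI[of _ "b \<otimes>\<^bsub>B\<^esub> d"])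
        (auto simp: F_mult_linear F_mult_of A.l_distr assms)
  next
    case 2
    then show ?thesis unfolding tensor_relations_def
      by (intro UnI1[OF UnI2] CollectI exI[of _ "a \<otimes>\<^bsub>A\<^esub> c"] exI[of _ "b \<otimes>\<^bsub>B\<^esub> d"] exI[of _ "b' \<otimes>\<^bsub>B\<^esub> d"])
        (auto simp: F_mult_linear F_mult_of B.l_distr assms)
  next
    case 3
    then show ?thesis unfolding tensor_relations_def
      by (intro UnI2 CollectI exI[of _ r] exI[of _ "a \<otimes>\<^bsub>A\<^esub> c"] exI[of _ "b \<otimes>\<^bsub>B\<^esub> d"])
        (auto simp: F_mult_linear F_mult_of A.smult_assoc2 B.smult_assoc2 assms)
  qed
qed

text \<open>
  Multiplying a bilinearity relation by a generator \<open>(c, d)\<close> gives a bilinearity relation again; the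
  general case follows by additivity in both factors.
\<close>

lemma U_mult: "x \<in> U \<Longrightarrow> y \<in> carrier F \<Longrightarrow> x \<otimes>\<^bsub>F\<^esub> y \<in> U"
proof -
  have rel: "x \<otimes>\<^bsub>F\<^esub> y \<in> U" if "y \<in> carrier F" "x \<in> tensor_relations R A B" for x y
    using that by (induction y rule: F_induct) (auto simp: F_mult_linear U_closed relations_mult_of)
  have neg: "(- x) \<otimes>\<^bsub>F\<^esub> y = - (x \<otimes>\<^bsub>F\<^esub> y)" for x y
    using F_mult_linear(1)[of 0 x y] by (simp add: F_mult_linear)
  show "x \<in> U \<Longrightarrow> y \<in> carrier F \<Longrightarrow> x \<otimes>\<^bsub>F\<^esub> y \<in> U"
    by (induction x rule: U_induct) (auto simp: F_mult_linear U_closed rel neg)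
qed

lemma U_ideal: "ideal U F"
proof (rule idealI[OF F.ring_axioms U_subgroup])
  fix a x assume "a \<in> U" "x \<in> carrier F"
  then show "a \<otimes>\<^bsub>F\<^esub> x \<in> U" "x \<otimes>\<^bsub>F\<^esub> a \<in> U"
    using U_mult[of a x] F_mult_comm[of x a] U_closed(1) by auto
qed

sublocale U: ideal U F by (rule U_ideal)

sublocale T: cring T
  unfolding tensor_algebra_def by (rule U.quotient_is_cring[OF cring_F])

lemma coset_hom: "(+>\<^bsub>F\<^esub>) U \<in> ring_hom F T"
  unfolding tensor_algebra_def by (rule U.rcos_ring_hom)

lemma T_carrier: "X \<in> carrier T \<longleftrightarrow> (\<exists>x \<in> carrier F. X = U +>\<^bsub>F\<^esub> x)"
  by (auto simp: tensor_algebra_def FactRing_def A_RCOSETS_def' a_r_coset_def r_coset_def)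

lemma coset_eq_iff:
  assumes "x \<in> carrier F" "y \<in> carrier F"
  shows "U +>\<^bsub>F\<^esub> x = U +>\<^bsub>F\<^esub> y \<longleftrightarrow> x - y \<in> U"
proof -
  have "U +>\<^bsub>F\<^esub> x = U +>\<^bsub>F\<^esub> y \<longleftrightarrow> x \<ominus>\<^bsub>F\<^esub> y \<in> U"
    using F.quotient_eq_iff_same_a_r_cos[OF U_ideal assms] by auto
  then show ?thesis using assms by (simp add: a_minus_def F_minus F_simps(1))
qed

lemma pure_closed: "a \<in> carrier A \<Longrightarrow> b \<in> carrier B \<Longrightarrow> pure a b \<in> carrier T"
  unfolding pure_tensor_def by (auto simp: T_carrier F_closed)

lemma pure_mult:
  "a \<in> carrier A \<Longrightarrow> b \<in> carrier B \<Longrightarrow> a' \<in> carrier A \<Longrightarrow> b' \<in> carrier B \<Longrightarrow>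
    pure a b \<otimes>\<^bsub>T\<^esub> pure a' b' = pure (a \<otimes>\<^bsub>A\<^esub> a') (b \<otimes>\<^bsub>B\<^esub> b')"
  unfolding pure_tensor_def
  by (simp add: ring_hom_mult[OF coset_hom, symmetric] F_closed F_mult_of)

lemma pure_one: "pure \<one>\<^bsub>A\<^esub> \<one>\<^bsub>B\<^esub> = \<one>\<^bsub>T\<^esub>"
  using ring_hom_one[OF coset_hom] by (simp add: pure_tensor_def F_simps)

lemma pure_add_left:
  assumes "a \<in> carrier A" "a' \<in> carrier A" "b \<in> carrier B"
  shows "pure (a \<oplus>\<^bsub>A\<^esub> a') b = pure a b \<oplus>\<^bsub>T\<^esub> pure a' b"
proof -
  have "frag_of (a \<oplus>\<^bsub>A\<^esub> a', b) - (frag_of (a, b) + frag_of (a', b)) \<in> U"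
    unfolding diff_diff_add[symmetric]
    using assms by (intro U_closed(6)) (auto simp: tensor_relations_def)
  then show ?thesis
    unfolding pure_tensor_def using assms
    by (subst ring_hom_add[OF coset_hom, symmetric]) (auto simp: F_closed coset_eq_iff F_simps(1))
qed

lemma pure_balanced:
  assumes "r \<in> carrier R" "a \<in> carrier A" "b \<in> carrier B"
  shows "pure (r \<odot>\<^bsub>A\<^esub> a) b = pure a (r \<odot>\<^bsub>B\<^esub> b)"
proof -
  have "frag_of (r \<odot>\<^bsub>A\<^esub> a, b) - frag_of (a, r \<odot>\<^bsub>B\<^esub> b) \<in> U"
    using assms by (intro U_closed(6)) (auto simp: tensor_relations_def)
  then show ?thesis
    unfolding pure_tensor_def using assms by (auto simp: F_closed coset_eq_iff)
qed

lemma T_induct [consumes 1, case_names of_pair diff]: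
  assumes "X \<in> carrier T" 
    "\<And>a b. a \<in> carrier A \<Longrightarrow> b \<in> carrier B \<Longrightarrow> P (pure a b)"
    "\<And>X Y. X \<in> carrier T \<Longrightarrow> Y \<in> carrier T \<Longrightarrow> P X \<Longrightarrow> P Y \<Longrightarrow> P (X \<ominus>\<^bsub>T\<^esub> Y)"
  shows "P X"
proof -
  have diff: "U +>\<^bsub>F\<^esub> (x - y) = (U +>\<^bsub>F\<^esub> x) \<ominus>\<^bsub>T\<^esub> (U +>\<^bsub>F\<^esub> y)"
    and cl: "U +>\<^bsub>F\<^esub> x \<in> carrier T" "U +>\<^bsub>F\<^esub> y \<in> carrier T"
    if "x \<in> carrier F" "y \<in> carrier F" for x y
  proof -
    interpret h: ring_hom_ring F T "(+>\<^bsub>F\<^esub>) U"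
      by (rule ring_hom_ringI2[OF F.ring_axioms T.ring_axioms coset_hom])
    show "U +>\<^bsub>F\<^esub> (x - y) = (U +>\<^bsub>F\<^esub> x) \<ominus>\<^bsub>T\<^esub> (U +>\<^bsub>F\<^esub> y)"
      using h.hom_add[of x "- y"] h.hom_a_inv[of y] that
      by (simp add: a_minus_def F_minus F_simps(1) F_closed)
    show "U +>\<^bsub>F\<^esub> x \<in> carrier T" "U +>\<^bsub>F\<^esub> y \<in> carrier T" using that by simp_all
  qed
  have one: "P (U +>\<^bsub>F\<^esub> frag_of (a, b))" if "a \<in> carrier A" "b \<in> carrier B" for a b
    using assms(2)[OF that] by (simp add: pure_tensor_def)
  have zero: "P (U +>\<^bsub>F\<^esub> 0)"
    using assms(3)[OF cl(1,1) one one] diff[of "frag_of (\<one>\<^bsub>A\<^esub>, \<one>\<^bsub>B\<^esub>)" "frag_of (\<one>\<^bsub>A\<^esub>, \<one>\<^bsub>B\<^esub>)"]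
      F_closed by simp
  obtain x where x: "x \<in> carrier F" "X = U +>\<^bsub>F\<^esub> x" using assms(1) by (auto simp: T_carrier)
  have "P (U +>\<^bsub>F\<^esub> x)"
    using x(1)
    by (induction x rule: F_induct) (auto simp: zero one diff intro!: assms(3) cl)
  then show ?thesis using x by simp
qed

end

section \<open>The total quotient ring\<close>

context cring
begin

abbreviation "nzd \<equiv> non_zero_divisors R"

definition frac :: "'a \<Rightarrow> 'a \<Rightarrow> ('a \<times> 'a) set" where
  "frac a s = frac_rel R `` {(a, s)}"

lemma nzd_closed: "s \<in> nzd \<Longrightarrow> s \<in> carrier R"
  by (simp add: non_zero_divisors_def)

lemma nzd_one [simp]: "\<one> \<in> nzd"
  unfolding non_zero_divisors_def mem_Collect_eq
proof (intro conjI ballI impI)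
  fix s assume "s \<in> carrier R" "\<one> \<otimes> s = \<zero>"
  then show "s = \<zero>" by (metis l_one)
qed (rule one_closed)

lemma nzd_mult [simp]: "s \<in> nzd \<Longrightarrow> t \<in> nzd \<Longrightarrow> s \<otimes> t \<in> nzd"
  unfolding non_zero_divisors_def mem_Collect_eq
proof (intro conjI ballI impI)
  fix a
  assume s: "s \<in> carrier R \<and> (\<forall>a\<in>carrier R. s \<otimes> a = \<zero> \<longrightarrow> a = \<zero>)"
    and t: "t \<in> carrier R \<and> (\<forall>a\<in>carrier R. t \<otimes> a = \<zero> \<longrightarrow> a = \<zero>)"
    and a: "a \<in> carrier R" "s \<otimes> t \<otimes> a = \<zero>"
  then have "s \<otimes> (t \<otimes> a) = \<zero>" by (metis m_assoc)
  then have "t \<otimes> a = \<zero>" using s t a(1) by blast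
  then show "a = \<zero>" using t a(1) by blast
qed simp

lemma nzd_cancel:
  assumes "s \<in> nzd" "a \<in> carrier R" "b \<in> carrier R" "s \<otimes> a = s \<otimes> b"
  shows "a = b"
proof -
  have "s \<otimes> (a \<ominus> b) = \<zero>"
    using assms nzd_closed[of s] by (simp add: a_minus_def r_distr r_minus r_neg)
  then have "a \<ominus> b = \<zero>" using assms by (simp add: non_zero_divisors_def)
  then show ?thesis using assms by simp
qed

lemma frac_rel_equiv: "equiv (carrier R \<times> nzd) (frac_rel R)"
proof (rule equivI)
  show "trans (frac_rel R)"
  proof (rule transI, clarify)
    fix a s b t c u
    assume *: "((a, s), (b, t)) \<in> frac_rel R" "((b, t), (c, u)) \<in> frac_rel R"
    then have "a \<otimes> t = b \<otimes> s" "b \<otimes> u = c \<otimes> t" and cl: "a \<in> carrier R" "s \<in> nzd"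
      "b \<in> carrier R" "t \<in> nzd" "c \<in> carrier R" "u \<in> nzd"
      by (auto simp: frac_rel_def)
    then have "t \<otimes> (a \<otimes> u) = t \<otimes> (c \<otimes> s)"
    proof -
      note cl = cl cl(2,4,6)[THEN nzd_closed]
      have "t \<otimes> (a \<otimes> u) = (a \<otimes> t) \<otimes> u" using cl by (simp add: m_ac)
      also have "\<dots> = s \<otimes> (b \<otimes> u)" using cl by (simp add: \<open>a \<otimes> t = b \<otimes> s\<close> m_ac)
      also have "\<dots> = t \<otimes> (c \<otimes> s)" using cl by (simp add: \<open>b \<otimes> u = c \<otimes> t\<close> m_ac)
      finally show ?thesis .
    qed
    then show "((a, s), (c, u)) \<in> frac_rel R"
      using cl nzd_cancel[of t "a \<otimes> u" "c \<otimes> s"] by (simp add: frac_rel_def nzd_closed)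
  qed
  show "refl_on (carrier R \<times> nzd) (frac_rel R)" by (rule refl_onI) (auto simp: frac_rel_def)
  show "sym (frac_rel R)" by (rule symI) (auto simp: frac_rel_def)
  show "frac_rel R \<subseteq> (carrier R \<times> nzd) \<times> (carrier R \<times> nzd)" by (auto simp: frac_rel_def)
qed

lemma frac_eq_iff:
  assumes "a \<in> carrier R" "s \<in> nzd" "b \<in> carrier R" "t \<in> nzd"
  shows "frac a s = frac b t \<longleftrightarrow> a \<otimes> t = b \<otimes> s"
proof -
  have "frac a s = frac b t \<longleftrightarrow> ((a, s), (b, t)) \<in> frac_rel R"
    unfolding frac_def using assms by (intro eq_equiv_class_iff[OF frac_rel_equiv]) auto
  then show ?thesis using assms by (simp add: frac_rel_def)
qed

lemma mem_frac: "(b, t) \<in> frac a s \<longleftrightarrow>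
    a \<in> carrier R \<and> s \<in> nzd \<and> b \<in> carrier R \<and> t \<in> nzd \<and> a \<otimes> t = b \<otimes> s"
  by (auto simp: frac_def frac_rel_def)

lemma UN_UN_constant:
  assumes "p \<in> X" "q \<in> Y"
    and "\<And>a s b t. (a, s) \<in> X \<Longrightarrow> (b, t) \<in> Y \<Longrightarrow> f a s b t = c"
  shows "(\<Union>(a, s) \<in> X. \<Union>(b, t) \<in> Y. f a s b t) = c"
proof -
  have "(case p of (a, s) \<Rightarrow> \<Union>(b, t) \<in> Y. f a s b t) = c" if "p \<in> X" for p
    using that assms(2,3) by (auto split: prod.splits)
  then show ?thesis using assms(1) by (intro UN_constant_eq) auto
qed

abbreviation "TQ \<equiv> total_quotient_ring R"

lemma Q_carrier: "X \<in> carrier TQ \<longleftrightarrow> (\<exists>a \<in> carrier R. \<exists>s \<in> nzd. X = frac a s)"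
  by (auto simp: total_quotient_ring_def quotient_def frac_def)

lemma Q_zero: "\<zero>\<^bsub>TQ\<^esub> = frac \<zero> \<one>" and Q_one: "\<one>\<^bsub>TQ\<^esub> = frac \<one> \<one>"
  by (simp_all add: total_quotient_ring_def frac_def)

lemma Q_mult_add_UN:
  "X \<otimes>\<^bsub>TQ\<^esub> Y = (\<Union>(a, s) \<in> X. \<Union>(b, t) \<in> Y. frac (a \<otimes> b) (s \<otimes> t))"
  "X \<oplus>\<^bsub>TQ\<^esub> Y = (\<Union>(a, s) \<in> X. \<Union>(b, t) \<in> Y. frac (a \<otimes> t \<oplus> b \<otimes> s) (s \<otimes> t))"
  by (simp_all add: total_quotient_ring_def frac_def)

lemma Q_mult:
  assumes "a \<in> carrier R" "s \<in> nzd" "b \<in> carrier R" "t \<in> nzd"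
  shows "frac a s \<otimes>\<^bsub>TQ\<^esub> frac b t = frac (a \<otimes> b) (s \<otimes> t)"
proof -
  have "frac (a' \<otimes> b') (s' \<otimes> t') = frac (a \<otimes> b) (s \<otimes> t)"
    if "(a', s') \<in> frac a s" "(b', t') \<in> frac b t" for a' s' b' t'
  proof -
    have 1: "a' \<in> carrier R" "s' \<in> nzd" "b' \<in> carrier R" "t' \<in> nzd"
      and 2: "a \<otimes> s' = a' \<otimes> s" "b \<otimes> t' = b' \<otimes> t"
      using that by (auto simp: mem_frac)
    note c = assms(1,3) 1(1,3) assms(2,4)[THEN nzd_closed] 1(2,4)[THEN nzd_closed]
    have "a' \<otimes> b' \<otimes> (s \<otimes> t) = (a' \<otimes> s) \<otimes> (b' \<otimes> t)" using c by (simp add: m_ac)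
    also have "\<dots> = (a \<otimes> s') \<otimes> (b \<otimes> t')" by (simp only: 2)
    also have "\<dots> = a \<otimes> b \<otimes> (s' \<otimes> t')" using c by (simp add: m_ac)
    finally show ?thesis using c 1 assms by (simp add: frac_eq_iff)
  qed
  moreover have "(a, s) \<in> frac a s" "(b, t) \<in> frac b t" using assms by (auto simp: mem_frac)
  ultimately show ?thesis
    unfolding Q_mult_add_UN by (intro UN_UN_constant)
qed

lemma Q_add:
  assumes "a \<in> carrier R" "s \<in> nzd" "b \<in> carrier R" "t \<in> nzd"
  shows "frac a s \<oplus>\<^bsub>TQ\<^esub> frac b t = frac (a \<otimes> t \<oplus> b \<otimes> s) (s \<otimes> t)"
proof -
  have "frac (a' \<otimes> t' \<oplus> b' \<otimes> s') (s' \<otimes> t') = frac (a \<otimes> t \<oplus> b \<otimes> s) (s \<otimes> t)"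
    if "(a', s') \<in> frac a s" "(b', t') \<in> frac b t" for a' s' b' t'
  proof -
    have 1: "a' \<in> carrier R" "s' \<in> nzd" "b' \<in> carrier R" "t' \<in> nzd"
      and 2: "a \<otimes> s' = a' \<otimes> s" "b \<otimes> t' = b' \<otimes> t"
      using that by (auto simp: mem_frac)
    note c = assms(1,3) 1(1,3) assms(2,4)[THEN nzd_closed] 1(2,4)[THEN nzd_closed]
    have "(a' \<otimes> t' \<oplus> b' \<otimes> s') \<otimes> (s \<otimes> t) = (a' \<otimes> s) \<otimes> (t \<otimes> t') \<oplus> (b' \<otimes> t) \<otimes> (s \<otimes> s')"
      using c by algebra
    also have "\<dots> = (a \<otimes> s') \<otimes> (t \<otimes> t') \<oplus> (b \<otimes> t') \<otimes> (s \<otimes> s')" by (simp only: 2)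
    also have "\<dots> = (a \<otimes> t \<oplus> b \<otimes> s) \<otimes> (s' \<otimes> t')" using c by algebra
    finally show ?thesis using c 1 assms by (simp add: frac_eq_iff)
  qed
  moreover have "(a, s) \<in> frac a s" "(b, t) \<in> frac b t" using assms by (auto simp: mem_frac)
  ultimately show ?thesis
    unfolding Q_mult_add_UN by (intro UN_UN_constant)
qed

lemma frac_closed [simp]: "a \<in> carrier R \<Longrightarrow> s \<in> nzd \<Longrightarrow> frac a s \<in> carrier TQ"
  by (auto simp: Q_carrier)

lemma frac_cancel:
  "a \<in> carrier R \<Longrightarrow> s \<in> nzd \<Longrightarrow> t \<in> nzd \<Longrightarrow> frac (t \<otimes> a) (t \<otimes> s) = frac a s"
  using nzd_closed[of s] nzd_closed[of t] by (simp add: frac_eq_iff m_ac)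

lemma Q_add_same:
  assumes "a \<in> carrier R" "s \<in> nzd" "b \<in> carrier R"
  shows "frac a s \<oplus>\<^bsub>TQ\<^esub> frac b s = frac (a \<oplus> b) s"
  using assms frac_cancel[of "a \<oplus> b" s s] nzd_closed[of s] by (simp add: Q_add r_distr m_comm)

text \<open>
  Over a common denominator the ring operations act on numerators only, so that the ring axioms of the
  total quotient ring become those of \<open>R\<close>.
\<close>

lemma common_denominator:
  assumes "x \<in> carrier TQ" "y \<in> carrier TQ" "z \<in> carrier TQ"
  obtains a b c s where "a \<in> carrier R" "b \<in> carrier R" "c \<in> carrier R" "s \<in> nzd" "s \<in> carrier R"
    "x = frac a s" "y = frac b s" "z = frac c s"
proof -
  obtain a s b t c u where *: "a \<in> carrier R" "s \<in> nzd" "x = frac a s"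
      "b \<in> carrier R" "t \<in> nzd" "y = frac b t" "c \<in> carrier R" "u \<in> nzd" "z = frac c u"
    using assms unfolding Q_carrier by blast
  note * = * *(2,5,8)[THEN nzd_closed]
  show thesis
  proof (rule that)
    show "x = frac (t \<otimes> u \<otimes> a) (t \<otimes> u \<otimes> s)" using * by (simp add: frac_cancel)
    have "y = frac (s \<otimes> u \<otimes> b) (s \<otimes> u \<otimes> t)" using * by (simp add: frac_cancel)
    moreover have "s \<otimes> u \<otimes> t = t \<otimes> u \<otimes> s" using * by (simp add: m_ac)
    ultimately show "y = frac (s \<otimes> u \<otimes> b) (t \<otimes> u \<otimes> s)" by simp
    have "z = frac (s \<otimes> t \<otimes> c) (s \<otimes> t \<otimes> u)" using * by (simp add: frac_cancel)
    moreover have "s \<otimes> t \<otimes> u = t \<otimes> u \<otimes> s" using * by (simp add: m_ac)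
    ultimately show "z = frac (s \<otimes> t \<otimes> c) (t \<otimes> u \<otimes> s)" by simp
  qed (use * in auto)
qed

lemma frac_zero: "s \<in> nzd \<Longrightarrow> frac \<zero> s = \<zero>\<^bsub>TQ\<^esub>"
  by (simp add: Q_zero frac_eq_iff nzd_closed)

lemma cring_Q: "cring TQ"
proof (rule cringI)
  show "abelian_group TQ"
  proof (rule abelian_groupI)
    fix x y assume xy: "x \<in> carrier TQ" "y \<in> carrier TQ"
    then obtain a b s where x: "a \<in> carrier R" "b \<in> carrier R" "s \<in> nzd" "s \<in> carrier R" "x = frac a s" "y = frac b s"
      using common_denominator[of x y x] by metis
    then show "x \<oplus>\<^bsub>TQ\<^esub> y \<in> carrier TQ" "x \<oplus>\<^bsub>TQ\<^esub> y = y \<oplus>\<^bsub>TQ\<^esub> x" by (auto simp: Q_add_same a_comm)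
    have "frac (\<ominus> a) s \<oplus>\<^bsub>TQ\<^esub> x = \<zero>\<^bsub>TQ\<^esub>"
      using x by (simp add: Q_add_same l_neg frac_zero)
    then show "\<exists>y\<in>carrier TQ. y \<oplus>\<^bsub>TQ\<^esub> x = \<zero>\<^bsub>TQ\<^esub>"
      using x by (intro bexI[of _ "frac (\<ominus> a) s"]) auto
    show "\<zero>\<^bsub>TQ\<^esub> \<oplus>\<^bsub>TQ\<^esub> x = x" using x by (simp add: Q_add_same flip: frac_zero[of s])
    fix z assume "z \<in> carrier TQ"
    with xy show "x \<oplus>\<^bsub>TQ\<^esub> y \<oplus>\<^bsub>TQ\<^esub> z = x \<oplus>\<^bsub>TQ\<^esub> (y \<oplus>\<^bsub>TQ\<^esub> z)"
      by (rule common_denominator) (simp add: Q_add_same a_assoc)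
  qed (simp add: Q_zero)
  show "Group.comm_monoid TQ"
  proof (rule comm_monoidI)
    fix x y z assume "x \<in> carrier TQ" "y \<in> carrier TQ" "z \<in> carrier TQ"
    then show "x \<otimes>\<^bsub>TQ\<^esub> y \<otimes>\<^bsub>TQ\<^esub> z = x \<otimes>\<^bsub>TQ\<^esub> (y \<otimes>\<^bsub>TQ\<^esub> z)"
      by (rule common_denominator) (simp add: Q_mult m_assoc)
  next
    fix x y assume xy: "x \<in> carrier TQ" "y \<in> carrier TQ"
    then obtain a b s where x: "a \<in> carrier R" "b \<in> carrier R" "s \<in> nzd" "s \<in> carrier R" "x = frac a s" "y = frac b s"
      using common_denominator[of x y x] by metis
    then show "x \<otimes>\<^bsub>TQ\<^esub> y \<in> carrier TQ" "x \<otimes>\<^bsub>TQ\<^esub> y = y \<otimes>\<^bsub>TQ\<^esub> x" "\<one>\<^bsub>TQ\<^esub> \<otimes>\<^bsub>TQ\<^esub> x = x"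
      by (auto simp: Q_mult m_comm Q_one)
  qed (simp add: Q_one)
  fix x y z assume "x \<in> carrier TQ" "y \<in> carrier TQ" "z \<in> carrier TQ"
  then show "(x \<oplus>\<^bsub>TQ\<^esub> y) \<otimes>\<^bsub>TQ\<^esub> z = x \<otimes>\<^bsub>TQ\<^esub> z \<oplus>\<^bsub>TQ\<^esub> y \<otimes>\<^bsub>TQ\<^esub> z"
    by (rule common_denominator) (simp add: Q_mult Q_add_same l_distr)
qed

lemma total_quotient_map_frac: "total_quotient_map R r = frac r \<one>"
  by (simp add: total_quotient_map_def frac_def)

lemma total_quotient_map_hom: "total_quotient_map R \<in> ring_hom R TQ"
  by (rule ring_hom_memI) (auto simp: total_quotient_map_frac Q_mult Q_add Q_one)

lemma algebra_Q: "algebra R (total_quotient_algebra R)"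
  by (rule algebra_algebra_via[OF is_cring cring_Q total_quotient_map_hom])

lemma Q_smult:
  "r \<in> carrier R \<Longrightarrow> a \<in> carrier R \<Longrightarrow> s \<in> nzd \<Longrightarrow>
    r \<odot>\<^bsub>total_quotient_algebra R\<^esub> frac a s = frac (r \<otimes> a) s"
  by (simp add: algebra_via_def total_quotient_map_frac Q_mult nzd_closed)

end

section \<open>Extension and contraction of ideals\<close>

locale total_quotient_tensor = algebra_pair R A "total_quotient_algebra R"
  for R :: "('a, 'r) ring_scheme" (structure) and A :: "('a, 'b, 'm) module_scheme"
begin

abbreviation "S \<equiv> non_zero_divisors R"
abbreviation "fr \<equiv> A.R.frac"

lemma Q_sel [simp]:
  "carrier (total_quotient_algebra R) = carrier (total_quotient_ring R)"
  "a \<oplus>\<^bsub>total_quotient_algebra R\<^esub> b = a \<oplus>\<^bsub>total_quotient_ring R\<^esub> b"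
  "a \<otimes>\<^bsub>total_quotient_algebra R\<^esub> b = a \<otimes>\<^bsub>total_quotient_ring R\<^esub> b"
  "\<one>\<^bsub>total_quotient_algebra R\<^esub> = \<one>\<^bsub>total_quotient_ring R\<^esub>"
  by (simp_all add: algebra_via_def)

lemmas S_closed = A.R.nzd_closed
lemmas S_one = A.R.nzd_one
lemmas S_mult = A.R.nzd_mult

definition numerators where "numerators s = {fr r s | r. r \<in> carrier R}"

text \<open>
  The definite description is the numerator over \<open>s\<close>, unique because \<open>s\<close> is a non-zero-divisor.
\<close>

definition clear where
  "clear s p = (THE r. r \<in> carrier R \<and> snd p = fr r s) \<odot>\<^bsub>A\<^esub> fst p"

lemma clear_frac:
  assumes "s \<in> S" "r \<in> carrier R"
  shows "clear s (a, fr r s) = r \<odot>\<^bsub>A\<^esub> a"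
proof -
  have "(THE r'. r' \<in> carrier R \<and> fr r s = fr r' s) = r"
  proof (rule the_equality)
    fix r' assume *: "r' \<in> carrier R \<and> fr r s = fr r' s"
    then have "s \<otimes> r = s \<otimes> r'"
      using assms S_closed[of s] A.R.frac_eq_iff[of r s r' s] by (simp add: A.R.m_comm)
    then show "r' = r" using * assms A.R.nzd_cancel[of s r r'] by simp
  qed (use assms in simp)
  then show ?thesis by (simp add: clear_def)
qed

lemma numerators_mult:
  assumes "s \<in> S" "t \<in> S" "k \<in> numerators s"
  shows "k \<in> numerators (t \<otimes> s)"
    and "a \<in> carrier A \<Longrightarrow> clear (t \<otimes> s) (a, k) = t \<odot>\<^bsub>A\<^esub> clear s (a, k)"
proof -
  obtain r where r: "r \<in> carrier R" "k = fr r s" using assms(3) by (auto simp: numerators_def)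
  have k: "k = fr (t \<otimes> r) (t \<otimes> s)" using r assms by (simp add: A.R.frac_cancel)
  show "k \<in> numerators (t \<otimes> s)"
    using k r S_closed[of t] assms unfolding numerators_def by auto
  show "clear (t \<otimes> s) (a, k) = t \<odot>\<^bsub>A\<^esub> clear s (a, k)" if "a \<in> carrier A"
  proof -
    have "clear (t \<otimes> s) (a, k) = (t \<otimes> r) \<odot>\<^bsub>A\<^esub> a"
      unfolding k using assms r S_closed[of t] by (intro clear_frac) auto
    also have "\<dots> = t \<odot>\<^bsub>A\<^esub> clear s (a, k)"
      unfolding r(2) using assms r S_closed[of t] that by (simp add: clear_frac A.smult_assoc1)
    finally show ?thesis .
  qed
qed

abbreviation "over s \<equiv> carrier A \<times> numerators s"

text \<open>
  For a common denominator \<open>s\<close>, these are the homomorphisms with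
  \<open>\<Sum> n\<^sub>i (a\<^sub>i, r\<^sub>i/s) \<mapsto> \<Sum> n\<^sub>i r\<^sub>i a\<^sub>i\<close>. Together, for all \<open>s\<close>, they do the work of a map from the free
  group to the localization of \<open>A\<close>.
\<close>

definition evals where
  "evals s h \<longleftrightarrow> h \<in> hom (free_Abelian_group (over s)) (add_monoid A) \<and>
     (\<forall>p \<in> over s. h (frag_of p) = clear s p)"

definition numerator where "numerator s = (SOME h. evals s h)"

lemma evals_numerator:
  assumes "s \<in> S" shows "evals s (numerator s)"
proof -
  have "clear s ` over s \<subseteq> carrier (add_monoid A)"
    using assms by (auto simp: numerators_def clear_frac)
  then obtain h where "h \<in> hom (free_Abelian_group (over s)) (add_monoid A)"
    "\<And>p. p \<in> over s \<Longrightarrow> h (frag_of p) = clear s p"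
    by (rule comm_group.free_Abelian_group_universal[OF A.a_comm_group, where S = "over s" and f = "clear s"]) blast
  then have "evals s h" unfolding evals_def by blast
  then show ?thesis unfolding numerator_def by (rule someI[of "evals s"])
qed

lemma numerator_of:
  "s \<in> S \<Longrightarrow> a \<in> carrier A \<Longrightarrow> r \<in> carrier R \<Longrightarrow> numerator s (frag_of (a, fr r s)) = r \<odot>\<^bsub>A\<^esub> a"
proof -
  assume s: "s \<in> S" and "a \<in> carrier A" "r \<in> carrier R"
  moreover from this have "(a, fr r s) \<in> over s" by (auto simp: numerators_def)
  ultimately show ?thesis using evals_numerator[OF s] clear_frac[of s r a] by (simp only: evals_def)
qed

lemma
  assumes "s \<in> S"
  shows numerator_zero: "numerator s 0 = \<zero>\<^bsub>A\<^esub>"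
    and numerator_closed: "Poly_Mapping.keys x \<subseteq> over s \<Longrightarrow> numerator s x \<in> carrier A"
    and numerator_add: "Poly_Mapping.keys x \<subseteq> over s \<Longrightarrow> Poly_Mapping.keys y \<subseteq> over s \<Longrightarrow>
      numerator s (x + y) = numerator s x \<oplus>\<^bsub>A\<^esub> numerator s y"
    and numerator_minus: "Poly_Mapping.keys x \<subseteq> over s \<Longrightarrow> numerator s (- x) = \<ominus>\<^bsub>A\<^esub> numerator s x"
    and numerator_diff: "Poly_Mapping.keys x \<subseteq> over s \<Longrightarrow> Poly_Mapping.keys y \<subseteq> over s \<Longrightarrow>
      numerator s (x - y) = numerator s x \<ominus>\<^bsub>A\<^esub> numerator s y"
proof -
  interpret h: group_hom "free_Abelian_group (over s)" "add_monoid A" "numerator s"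
    using evals_numerator[OF assms] A.a_group
    by (simp add: evals_def group_hom_def group_hom_axioms_def group_free_Abelian_group)
  show "numerator s 0 = \<zero>\<^bsub>A\<^esub>" using h.hom_one by simp
  show "Poly_Mapping.keys x \<subseteq> over s \<Longrightarrow> numerator s x \<in> carrier A" using h.hom_closed[of x] by simp
  show add: "\<And>x y. Poly_Mapping.keys x \<subseteq> over s \<Longrightarrow> Poly_Mapping.keys y \<subseteq> over s \<Longrightarrow>
      numerator s (x + y) = numerator s x \<oplus>\<^bsub>A\<^esub> numerator s y"
    using h.hom_mult by simp
  show minus: "\<And>x. Poly_Mapping.keys x \<subseteq> over s \<Longrightarrow> numerator s (- x) = \<ominus>\<^bsub>A\<^esub> numerator s x"
    using h.hom_inv by (simp add: a_inv_def)
  show "Poly_Mapping.keys x \<subseteq> over s \<Longrightarrow> Poly_Mapping.keys y \<subseteq> over s \<Longrightarrow>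
      numerator s (x - y) = numerator s x \<ominus>\<^bsub>A\<^esub> numerator s y"
    using add[of x "- y"] minus[of y] by (simp add: a_minus_def)
qed

lemma over_mult: "s \<in> S \<Longrightarrow> t \<in> S \<Longrightarrow> over s \<subseteq> over (t \<otimes> s)"
  using numerators_mult(1) by blast

lemma numerator_mult:
  assumes s: "s \<in> S" and t: "t \<in> S" and x: "Poly_Mapping.keys x \<subseteq> over s"
  shows "numerator (t \<otimes> s) x = t \<odot>\<^bsub>A\<^esub> numerator s x"
proof -
  have ts: "t \<otimes> s \<in> S" "t \<in> carrier R" using s t S_closed by (auto simp: S_mult)
  have "Poly_Mapping.keys x \<subseteq> over s \<and> numerator (t \<otimes> s) x = t \<odot>\<^bsub>A\<^esub> numerator s x"
    using x
  proof (induction rule: frag_induction)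
    case zero
    then show ?case using ts s t by (simp add: numerator_zero)
  next
    case (one p)
    obtain a k where p: "p = (a, k)" "a \<in> carrier A" "k \<in> numerators s" using one by auto
    have "numerator (t \<otimes> s) (frag_of p) = clear (t \<otimes> s) p" "numerator s (frag_of p) = clear s p"
      using evals_numerator[OF s] evals_numerator[OF ts(1)] one over_mult[OF s t] unfolding evals_def by blast+
    then show ?case using p s t one numerators_mult(2) by auto
  next
    case (diff x y)
    then have k: "Poly_Mapping.keys x \<subseteq> over s" "Poly_Mapping.keys y \<subseteq> over s" by auto
    with over_mult[OF s t] have
      k': "Poly_Mapping.keys x \<subseteq> over (t \<otimes> s)" "Poly_Mapping.keys y \<subseteq> over (t \<otimes> s)"
      by blast+
    have "numerator (t \<otimes> s) (x - y) = t \<odot>\<^bsub>A\<^esub> numerator s x \<ominus>\<^bsub>A\<^esub> t \<odot>\<^bsub>A\<^esub> numerator s y"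
      using diff numerator_diff[OF ts(1) k'] by simp
    also have "\<dots> = t \<odot>\<^bsub>A\<^esub> numerator s (x - y)"
      using ts(2) numerator_diff[OF s k] numerator_closed[OF s k(1)] numerator_closed[OF s k(2)]
      by (simp add: a_minus_def A.smult_r_distr A.smult_r_minus)
    finally show ?case using k keys_diff[of x y] by auto
  qed
  then show ?thesis ..
qed

text \<open>
  An element of the free group is null for some \<open>s\<close> exactly if its image in the localization of \<open>A\<close> is zero.
\<close>

definition null where
  "null s x \<longleftrightarrow> s \<in> S \<and> Poly_Mapping.keys x \<subseteq> over s \<and> numerator s x = \<zero>\<^bsub>A\<^esub>"

lemma null_mult: "null s x \<Longrightarrow> t \<in> S \<Longrightarrow> null (t \<otimes> s) x"
  using over_mult[of s t] numerator_mult[of s t x] S_closed[of t] unfolding null_def by (auto simp: S_mult)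

lemma null_two:
  assumes "s \<in> S" "p \<in> over s" "q \<in> over s" "clear s p = clear s q"
  shows "null s (frag_of p - frag_of q)"
proof -
  have k: "Poly_Mapping.keys (frag_of p) \<subseteq> over s" "Poly_Mapping.keys (frag_of q) \<subseteq> over s"
    using assms by auto
  have "numerator s (frag_of p) = clear s p" "numerator s (frag_of q) = clear s q"
    using evals_numerator[OF assms(1)] assms unfolding evals_def by blast+
  then have "numerator s (frag_of p - frag_of q) = \<zero>\<^bsub>A\<^esub>"
    using numerator_diff[OF assms(1) k] numerator_closed[OF assms(1) k(1)] numerator_closed[OF assms(1) k(2)] assms(4)
    by (simp add: A.r_neg a_minus_def)
  then show ?thesis
    unfolding null_def using assms(1) k keys_diff[of "frag_of p" "frag_of q"] by blast
qed

lemma null_three: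
  assumes "s \<in> S" "p \<in> over s" "q \<in> over s" "q' \<in> over s" "clear s p = clear s q \<oplus>\<^bsub>A\<^esub> clear s q'"
  shows "null s (frag_of p - frag_of q - frag_of q')"
proof -
  have k: "Poly_Mapping.keys (frag_of p) \<subseteq> over s" "Poly_Mapping.keys (frag_of q + frag_of q') \<subseteq> over s"
    "Poly_Mapping.keys (frag_of q) \<subseteq> over s" "Poly_Mapping.keys (frag_of q') \<subseteq> over s"
    using assms keys_add[of "frag_of q" "frag_of q'"] by auto
  have "numerator s (frag_of p) = clear s p" "numerator s (frag_of q) = clear s q" "numerator s (frag_of q') = clear s q'"
    using evals_numerator[OF assms(1)] assms unfolding evals_def by blast+
  then have "numerator s (frag_of p - (frag_of q + frag_of q')) = \<zero>\<^bsub>A\<^esub>"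
    using numerator_diff[OF assms(1) k(1,2)] numerator_add[OF assms(1) k(3,4)]
      numerator_closed[OF assms(1) k(3)] numerator_closed[OF assms(1) k(4)] assms(5)
    by (simp add: A.r_neg a_minus_def)
  then show ?thesis
    unfolding null_def diff_diff_add
    using assms(1) k keys_diff[of "frag_of p" "frag_of q + frag_of q'"] by blast
qed

lemma null_relation:
  assumes "x \<in> tensor_relations R A (total_quotient_algebra R)"
  shows "\<exists>s. null s x"
proof -
  consider (1) a a' b where "x = frag_of (a \<oplus>\<^bsub>A\<^esub> a', b) - frag_of (a, b) - frag_of (a', b)"
      "a \<in> carrier A" "a' \<in> carrier A" "b \<in> carrier (total_quotient_ring R)"
    | (2) a b b' where "x = frag_of (a, b \<oplus>\<^bsub>total_quotient_ring R\<^esub> b') - frag_of (a, b) - frag_of (a, b')"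
      "a \<in> carrier A" "b \<in> carrier (total_quotient_ring R)" "b' \<in> carrier (total_quotient_ring R)"
    | (3) r a b where "x = frag_of (r \<odot>\<^bsub>A\<^esub> a, b) - frag_of (a, r \<odot>\<^bsub>total_quotient_algebra R\<^esub> b)"
      "r \<in> carrier R" "a \<in> carrier A" "b \<in> carrier (total_quotient_ring R)"
    using assms unfolding tensor_relations_def Q_sel by blast
  then show ?thesis
  proof cases
    case 1
    obtain r s where r: "r \<in> carrier R" "s \<in> S" "b = fr r s" using 1(4) by (auto simp: A.R.Q_carrier)
    then have "null s x"
      unfolding 1(1) using 1(2,3)
      by (intro null_three) (auto simp: numerators_def clear_frac A.smult_r_distr)
    then show ?thesis by blast
  next
    case 2
    obtain r r' s where r: "r \<in> carrier R" "r' \<in> carrier R" "s \<in> S" "b = fr r s" "b' = fr r' s"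
      using A.R.common_denominator[OF 2(3,4,4)] by metis
    then have "b \<oplus>\<^bsub>total_quotient_ring R\<^esub> b' = fr (r \<oplus> r') s" by (simp add: A.R.Q_add_same)
    then have "null s x"
      unfolding 2(1) using 2(2) r
      by (intro null_three) (auto simp: numerators_def clear_frac A.smult_l_distr)
    then show ?thesis by blast
  next
    case 3
    obtain p s where r: "p \<in> carrier R" "s \<in> S" "b = fr p s" using 3(4) by (auto simp: A.R.Q_carrier)
    then have "r \<odot>\<^bsub>total_quotient_algebra R\<^esub> b = fr (p \<otimes> r) s"
      using 3(2) by (simp add: A.R.Q_smult A.R.m_comm)
    then have "null s x"
      unfolding 3(1) using 3(2,3) r
      by (intro null_two) (auto simp: numerators_def clear_frac A.smult_assoc1)
    then show ?thesis by blast
  qed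
qed

text \<open>
  Each bilinearity relation is null over a common denominator of the fractions in it, and two null elements
  are null over the product of their denominators.
\<close>

lemma null_U: "x \<in> U \<Longrightarrow> \<exists>s. null s x"
proof (induction x rule: U_induct)
  case zero
  show ?case by (intro exI[of _ \<one>]) (simp add: null_def numerator_zero S_one)
next
  case (rel x)
  then show ?case by (rule null_relation)
next
  case (minus x)
  then obtain s where "null s x" using null_relation by blast
  then have "null s (- x)" by (auto simp: null_def numerator_minus)
  then show ?case by blast
next
  case (add x y)
  then obtain s t where st: "null s x" "null t y" by blast
  then have S: "s \<in> S" "t \<in> S" by (auto simp: null_def)
  then have "t \<otimes> s = s \<otimes> t" using S_closed[of s] S_closed[of t] by (simp add: A.R.m_comm)
  then have n: "null (s \<otimes> t) x" "null (s \<otimes> t) y" using null_mult[OF st(1) S(2)] null_mult[OF st(2) S(1)] by auto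
  then have "null (s \<otimes> t) (x + y)"
    unfolding null_def using numerator_add[of "s \<otimes> t" x y] keys_add[of x y] by auto
  then show ?case by blast
qed

text \<open>
  The half of the description of \<open>A \<otimes> K\<close> as a localization that bounds the kernel: elements become equal
  only if an element of \<open>S\<close> forces it. The generating relations of the tensor product say nothing directly
  about inequality, hence the detour over \<open>null\<close>.
\<close>

lemma pure_frac_eqD:
  assumes "v \<in> carrier A" "u \<in> carrier A" "s \<in> S" "pure v \<one>\<^bsub>total_quotient_ring R\<^esub> = pure u (fr \<one> s)"
  shows "\<exists>t \<in> S. t \<odot>\<^bsub>A\<^esub> (s \<odot>\<^bsub>A\<^esub> v) = t \<odot>\<^bsub>A\<^esub> u"
proof -
  let ?p = "frag_of (v, fr \<one> \<one>)" and ?q = "frag_of (u, fr \<one> s)"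
  have "?p - ?q \<in> U"
    using assms coset_eq_iff[of ?p ?q] S_one by (simp add: pure_tensor_def A.R.Q_one F_closed)
  then obtain t where "null t (?p - ?q)" using null_U by blast
  then have n: "null (s \<otimes> t) (?p - ?q)" and t: "t \<in> S" "t \<in> carrier R" "s \<in> carrier R" "s \<otimes> t \<in> S"
    using null_mult assms(3) S_closed S_mult by (auto simp: null_def)
  have fr: "fr \<one> \<one> = fr (s \<otimes> t) (s \<otimes> t)" "fr \<one> s = fr t (s \<otimes> t)"
    using t assms(3) S_one by (simp_all add: A.R.frac_eq_iff A.R.m_comm)
  have k: "Poly_Mapping.keys ?p \<subseteq> over (s \<otimes> t)" "Poly_Mapping.keys ?q \<subseteq> over (s \<otimes> t)"
    unfolding fr using t assms by (auto simp: numerators_def)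
  have "numerator (s \<otimes> t) ?p = (s \<otimes> t) \<odot>\<^bsub>A\<^esub> v" "numerator (s \<otimes> t) ?q = t \<odot>\<^bsub>A\<^esub> u"
    unfolding fr using t assms(1,2) by (simp_all add: numerator_of)
  then have "(s \<otimes> t) \<odot>\<^bsub>A\<^esub> v \<ominus>\<^bsub>A\<^esub> t \<odot>\<^bsub>A\<^esub> u = \<zero>\<^bsub>A\<^esub>"
    using n numerator_diff[OF t(4) k] by (simp add: null_def)
  then have "(s \<otimes> t) \<odot>\<^bsub>A\<^esub> v = t \<odot>\<^bsub>A\<^esub> u"
    using t assms by (simp add: A.r_right_minus_eq)
  then have "t \<odot>\<^bsub>A\<^esub> (s \<odot>\<^bsub>A\<^esub> v) = t \<odot>\<^bsub>A\<^esub> u"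
    using t assms A.R.m_comm[of s t] A.smult_assoc1[of t s v] by simp
  then show ?thesis using t(1) by blast
qed

lemma pure_diff_left:
  assumes "a \<in> carrier A" "a' \<in> carrier A" "b \<in> carrier (total_quotient_ring R)"
  shows "pure (a \<ominus>\<^bsub>A\<^esub> a') b = pure a b \<ominus>\<^bsub>T\<^esub> pure a' b"
proof -
  have "pure (a \<ominus>\<^bsub>A\<^esub> a') b \<oplus>\<^bsub>T\<^esub> pure a' b = pure (a \<ominus>\<^bsub>A\<^esub> a' \<oplus>\<^bsub>A\<^esub> a') b"
    using assms by (intro pure_add_left[symmetric]) auto
  also have "a \<ominus>\<^bsub>A\<^esub> a' \<oplus>\<^bsub>A\<^esub> a' = a" using assms by (simp add: a_minus_def A.a_assoc A.l_neg)
  finally show ?thesis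
    using assms pure_closed[of "a \<ominus>\<^bsub>A\<^esub> a'" b] pure_closed[of a b] pure_closed[of a' b]
    by (simp add: a_minus_def T.add.inv_solve_right)
qed

lemma pure_common:
  assumes "s \<in> S" "t \<in> S" "u \<in> carrier A"
  shows "pure u (fr \<one> s) = pure (t \<odot>\<^bsub>A\<^esub> u) (fr \<one> (t \<otimes> s))"
proof -
  have t: "t \<in> carrier R" "s \<in> carrier R" using assms S_closed by auto
  have "fr \<one> s = fr t (t \<otimes> s)" using A.R.frac_cancel[of \<one> s t] t assms by simp
  also have "\<dots> = t \<odot>\<^bsub>total_quotient_algebra R\<^esub> fr \<one> (t \<otimes> s)"
    using assms t by (simp add: A.R.Q_smult S_mult)
  finally show ?thesis using assms t pure_balanced[of t u "fr \<one> (t \<otimes> s)"] by (simp add: S_mult)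
qed

lemma T_elements:
  assumes "X \<in> carrier T"
  obtains u s where "u \<in> carrier A" "s \<in> S" "X = pure u (fr \<one> s)"
proof -
  have "\<exists>u\<in>carrier A. \<exists>s\<in>S. X = pure u (fr \<one> s)"
    using assms
  proof (induction X rule: T_induct)
    case (of_pair a b)
    then obtain r s where r: "r \<in> carrier R" "s \<in> S" "b = fr r s" by (auto simp: A.R.Q_carrier)
    then have "b = r \<odot>\<^bsub>total_quotient_algebra R\<^esub> fr \<one> s" by (simp add: A.R.Q_smult)
    then have "pure a b = pure (r \<odot>\<^bsub>A\<^esub> a) (fr \<one> s)" using pure_balanced[of r a "fr \<one> s"] of_pair r by simp
    then show ?case using r of_pair by blast
  next
    case (diff X Y)
    then obtain u s v t where *: "u \<in> carrier A" "s \<in> S" "X = pure u (fr \<one> s)"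
      "v \<in> carrier A" "t \<in> S" "Y = pure v (fr \<one> t)" by blast
    have c: "t \<in> carrier R" "s \<in> carrier R" "t \<otimes> s \<in> S" using * S_closed S_mult by auto
    have "X = pure (t \<odot>\<^bsub>A\<^esub> u) (fr \<one> (t \<otimes> s))" "Y = pure (s \<odot>\<^bsub>A\<^esub> v) (fr \<one> (t \<otimes> s))"
      using pure_common[of s t u] pure_common[of t s v] * c A.R.m_comm[of s t] by simp_all
    then have "X \<ominus>\<^bsub>T\<^esub> Y = pure (t \<odot>\<^bsub>A\<^esub> u \<ominus>\<^bsub>A\<^esub> s \<odot>\<^bsub>A\<^esub> v) (fr \<one> (t \<otimes> s))"
      using * c by (simp add: pure_diff_left)
    then show ?case using * c by blast
  qed
  then show thesis using that by blast
qed

end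

context total_quotient_tensor
begin

abbreviation "K \<equiv> total_quotient_algebra R"
abbreviation "ext \<equiv> extended_ideal R A K"

text \<open>
  Saturation says that every \<open>s \<in> S\<close> is a non-zero-divisor on \<open>A / I\<close>.
\<close>

definition saturated where
  "saturated I \<longleftrightarrow> ideal I A \<and> (\<forall>s \<in> S. \<forall>a \<in> carrier A. s \<odot>\<^bsub>A\<^esub> a \<in> I \<longrightarrow> a \<in> I)"

definition contraction where
  "contraction J = {a \<in> carrier A. pure a \<one>\<^bsub>K\<^esub> \<in> J}"

lemma pure_unit:
  assumes "s \<in> S" "a \<in> carrier A"
  shows "pure (s \<odot>\<^bsub>A\<^esub> a) (fr \<one> s) = pure a \<one>\<^bsub>K\<^esub>"
proof -
  have s: "s \<in> carrier R" using assms S_closed by simp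
  have "s \<odot>\<^bsub>K\<^esub> fr \<one> s = \<one>\<^bsub>K\<^esub>"
    using assms s by (simp add: A.R.Q_smult A.R.Q_one A.R.frac_eq_iff S_one)
  then show ?thesis using pure_balanced[of s a "fr \<one> s"] assms s by simp
qed

lemma pure_split:
  assumes "u \<in> carrier A" "k \<in> carrier K" "v \<in> carrier A"
  shows "pure (v \<otimes>\<^bsub>A\<^esub> u) k = pure v k \<otimes>\<^bsub>T\<^esub> pure u \<one>\<^bsub>K\<^esub>"
  using assms B.one_closed by (simp only: pure_mult B.r_one)

text \<open>
  Saturation comes from \<open>s \<otimes> 1\<close> being invertible, with inverse \<open>1 \<otimes> 1/s\<close>.
\<close>

lemma saturated_contraction:
  assumes "ideal J T"
  shows "saturated (contraction J)"
proof -
  interpret J: ideal J T by fact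
  have one: "\<one>\<^bsub>K\<^esub> \<in> carrier (total_quotient_ring R)" using B.one_closed by simp
  have mult: "x \<otimes>\<^bsub>A\<^esub> a \<in> contraction J" if "a \<in> contraction J" "x \<in> carrier A" for a x
    using that pure_split[of a "\<one>\<^bsub>K\<^esub>" x] J.I_l_closed[of "pure a \<one>\<^bsub>K\<^esub>" "pure x \<one>\<^bsub>K\<^esub>"] pure_closed[of x "\<one>\<^bsub>K\<^esub>"]
      B.one_closed by (auto simp: contraction_def)
  have "ideal (contraction J) A"
  proof (rule idealI[OF A.ring_axioms A.add.subgroupI])
    have "pure \<zero>\<^bsub>A\<^esub> \<one>\<^bsub>K\<^esub> = pure \<one>\<^bsub>A\<^esub> \<one>\<^bsub>K\<^esub> \<ominus>\<^bsub>T\<^esub> pure \<one>\<^bsub>A\<^esub> \<one>\<^bsub>K\<^esub>"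
      using pure_diff_left[OF A.one_closed A.one_closed one] by (simp add: a_minus_def A.r_neg)
    also have "\<dots> = \<zero>\<^bsub>T\<^esub>" using pure_closed[of "\<one>\<^bsub>A\<^esub>" "\<one>\<^bsub>K\<^esub>"] B.one_closed
      by (simp add: a_minus_def T.r_neg)
    finally have z: "\<zero>\<^bsub>A\<^esub> \<in> contraction J" using J.zero_closed by (simp add: contraction_def)
    then show "contraction J \<noteq> {}" by blast
    show "contraction J \<subseteq> carrier A" by (auto simp: contraction_def)
    fix a b assume ab: "a \<in> contraction J" "b \<in> contraction J"
    then show "a \<oplus>\<^bsub>A\<^esub> b \<in> contraction J"
      using one J.a_closed by (auto simp: contraction_def pure_add_left)
    have "\<ominus>\<^bsub>A\<^esub> \<one>\<^bsub>A\<^esub> \<otimes>\<^bsub>A\<^esub> a \<in> contraction J" using mult ab by blast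
    then show "\<ominus>\<^bsub>A\<^esub> a \<in> contraction J" using ab by (auto simp: contraction_def A.l_minus)
  next
    fix a x assume "a \<in> contraction J" "x \<in> carrier A"
    then show "x \<otimes>\<^bsub>A\<^esub> a \<in> contraction J" "a \<otimes>\<^bsub>A\<^esub> x \<in> contraction J"
      using mult A.m_comm[of a x] by (auto simp: contraction_def)
  qed
  moreover have "a \<in> contraction J"
    if s: "s \<in> S" "a \<in> carrier A" and c: "s \<odot>\<^bsub>A\<^esub> a \<in> contraction J" for s a
  proof -
    have sa: "s \<odot>\<^bsub>A\<^esub> a \<in> carrier A" "s \<in> carrier R" using s S_closed by auto
    have "pure a \<one>\<^bsub>K\<^esub> = pure \<one>\<^bsub>A\<^esub> (fr \<one> s) \<otimes>\<^bsub>T\<^esub> pure (s \<odot>\<^bsub>A\<^esub> a) \<one>\<^bsub>K\<^esub>"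
      using pure_split[of "s \<odot>\<^bsub>A\<^esub> a" "fr \<one> s" "\<one>\<^bsub>A\<^esub>"] pure_unit[OF s] s sa by simp
    then show ?thesis
      using c s J.I_l_closed pure_closed[of "\<one>\<^bsub>A\<^esub>" "fr \<one> s"] by (simp add: contraction_def)
  qed
  ultimately show ?thesis by (simp add: saturated_def)
qed

lemma ext_ideal: "I \<subseteq> carrier A \<Longrightarrow> ideal (ext I) T"
  unfolding extended_ideal_def using pure_closed[of _ "\<one>\<^bsub>K\<^esub>"] B.one_closed
  by (intro T.genideal_ideal) auto

lemma ext_contains: "I \<subseteq> carrier A \<Longrightarrow> u \<in> I \<Longrightarrow> pure u \<one>\<^bsub>K\<^esub> \<in> ext I"
  unfolding extended_ideal_def using pure_closed[of _ "\<one>\<^bsub>K\<^esub>"] B.one_closed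
  by (intro subsetD[OF T.genideal_self]) auto

lemma ext_least: "ideal J T \<Longrightarrow> I \<subseteq> contraction J \<Longrightarrow> ext I \<subseteq> J"
  unfolding extended_ideal_def by (rule T.genideal_minimal) (auto simp: contraction_def)

lemma ext_contraction:
  assumes "ideal J T"
  shows "ext (contraction J) = J"
proof
  interpret J: ideal J T by fact
  have sub: "contraction J \<subseteq> carrier A" by (auto simp: contraction_def)
  show "ext (contraction J) \<subseteq> J" using assms by (intro ext_least) auto
  interpret E: ideal "ext (contraction J)" T by (rule ext_ideal[OF sub])
  show "J \<subseteq> ext (contraction J)"
  proof
    fix X assume X: "X \<in> J"
    then obtain u s where u: "u \<in> carrier A" "s \<in> S" "X = pure u (fr \<one> s)"
      using J.Icarr T_elements by metis
    have s: "s \<in> carrier R" using S_closed u by simp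
    have f: "fr s \<one> \<in> carrier K" "fr \<one> s \<in> carrier K" using u s S_one by auto
    have "fr \<one> s \<otimes>\<^bsub>K\<^esub> fr s \<one> = \<one>\<^bsub>K\<^esub>"
      using u s S_one by (simp add: A.R.Q_mult A.R.Q_one A.R.frac_eq_iff)
    then have "pure u \<one>\<^bsub>K\<^esub> = X \<otimes>\<^bsub>T\<^esub> pure \<one>\<^bsub>A\<^esub> (fr s \<one>)"
      unfolding u(3) using u(1) f by (simp only: pure_mult A.one_closed A.r_one)
    then have "u \<in> contraction J"
      using J.I_r_closed[OF X] pure_closed[OF A.one_closed f(1)] u(1) by (simp add: contraction_def)
    then have "pure u \<one>\<^bsub>K\<^esub> \<in> ext (contraction J)" by (rule ext_contains[OF sub])
    moreover have "X = pure \<one>\<^bsub>A\<^esub> (fr \<one> s) \<otimes>\<^bsub>T\<^esub> pure u \<one>\<^bsub>K\<^esub>"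
      using pure_split[OF u(1) f(2) A.one_closed] u by simp
    ultimately show "X \<in> ext (contraction J)"
      using E.I_l_closed pure_closed[OF A.one_closed f(2)] by simp
  qed
qed

text \<open>
  The tensors \<open>u \<otimes> 1/s\<close> with \<open>u \<in> I\<close> already form an ideal, which therefore contains the extension of
  \<open>I\<close>. If \<open>v \<otimes> 1 = u \<otimes> 1/s\<close> is one of them, then \<open>t s v = t u \<in> I\<close> for some \<open>t \<in> S\<close>, and saturation
  gives \<open>v \<in> I\<close>.
\<close>

lemma contraction_ext:
  assumes "saturated I"
  shows "contraction (ext I) = I"
proof
  interpret I: ideal I A using assms by (simp add: saturated_def)
  have sub: "I \<subseteq> carrier A" using I.Icarr by blast
  show "I \<subseteq> contraction (ext I)" using ext_contains[OF sub] sub by (auto simp: contraction_def)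
  \<comment> \<open>The candidate for the extended ideal, in explicit form.\<close>
  define J where "J = {pure u (fr \<one> s) | u s. u \<in> I \<and> s \<in> S}"
  have Ismult: "t \<odot>\<^bsub>A\<^esub> u \<in> I" if "t \<in> carrier R" "u \<in> I" for t u
    using that I.I_r_closed[of u "t \<odot>\<^bsub>A\<^esub> \<one>\<^bsub>A\<^esub>"] I.I_l_closed[of u "t \<odot>\<^bsub>A\<^esub> \<one>\<^bsub>A\<^esub>"] sub
      A.smult_assoc2[of t "\<one>\<^bsub>A\<^esub>" u] by auto
  have J: "ideal J T"
  proof (rule idealI[OF T.ring_axioms T.add.subgroupI])
    show "J \<subseteq> carrier T" using pure_closed sub by (auto simp: J_def)
    have "pure \<zero>\<^bsub>A\<^esub> (fr \<one> \<one>) \<in> J" unfolding J_def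
      by (intro CollectI exI conjI, rule refl, rule I.zero_closed, rule S_one)
    then show "J \<noteq> {}" by blast
  next
    fix X Y assume "X \<in> J" "Y \<in> J"
    then obtain u s v t where *: "u \<in> I" "s \<in> S" "X = pure u (fr \<one> s)"
      "v \<in> I" "t \<in> S" "Y = pure v (fr \<one> t)" unfolding J_def by blast
    have c: "t \<in> carrier R" "s \<in> carrier R" "t \<otimes> s \<in> S" "u \<in> carrier A" "v \<in> carrier A"
      using * S_closed S_mult sub by auto
    have X: "X = pure (t \<odot>\<^bsub>A\<^esub> u) (fr \<one> (t \<otimes> s))" "Y = pure (s \<odot>\<^bsub>A\<^esub> v) (fr \<one> (t \<otimes> s))"
      using pure_common[of s t u] pure_common[of t s v] * c A.R.m_comm[of s t] by simp_all
    have "X \<oplus>\<^bsub>T\<^esub> Y = pure (t \<odot>\<^bsub>A\<^esub> u \<oplus>\<^bsub>A\<^esub> s \<odot>\<^bsub>A\<^esub> v) (fr \<one> (t \<otimes> s))"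
      unfolding X using c by (simp add: pure_add_left)
    moreover have "t \<odot>\<^bsub>A\<^esub> u \<oplus>\<^bsub>A\<^esub> s \<odot>\<^bsub>A\<^esub> v \<in> I" using * c Ismult I.a_closed by simp
    ultimately show "X \<oplus>\<^bsub>T\<^esub> Y \<in> J" using c unfolding J_def by blast
  next
    fix X assume "X \<in> J"
    then obtain u s where *: "u \<in> I" "s \<in> S" "X = pure u (fr \<one> s)" unfolding J_def by blast
    then have c: "fr \<one> s \<in> carrier (total_quotient_ring R)" "u \<in> carrier A" using sub by auto
    have "pure (\<zero>\<^bsub>A\<^esub> \<ominus>\<^bsub>A\<^esub> u) (fr \<one> s) = pure (u \<ominus>\<^bsub>A\<^esub> u) (fr \<one> s) \<ominus>\<^bsub>T\<^esub> X"
      using pure_diff_left[OF A.zero_closed c(2,1)] c * by (simp add: a_minus_def A.r_neg)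
    also have "\<dots> = \<ominus>\<^bsub>T\<^esub> X"
      using pure_diff_left[OF c(2,2,1)] pure_closed[of u "fr \<one> s"] c * by (simp add: a_minus_def T.r_neg)
    finally have "\<ominus>\<^bsub>T\<^esub> X = pure (\<ominus>\<^bsub>A\<^esub> u) (fr \<one> s)" using c by (simp add: a_minus_def)
    then show "\<ominus>\<^bsub>T\<^esub> X \<in> J" using * I.a_inv_closed unfolding J_def by blast
  next
    fix X Y assume X: "X \<in> J" and Y: "Y \<in> carrier T"
    obtain u s where u: "u \<in> I" "s \<in> S" "X = pure u (fr \<one> s)" using X unfolding J_def by blast
    obtain v t where v: "v \<in> carrier A" "t \<in> S" "Y = pure v (fr \<one> t)" using T_elements[OF Y] .
    note * = u v
    have c: "u \<in> carrier A" "X \<in> carrier T" using * sub pure_closed by auto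
    have "Y \<otimes>\<^bsub>T\<^esub> X = pure (v \<otimes>\<^bsub>A\<^esub> u) (fr \<one> (t \<otimes> s))"
      using * c pure_mult[of v "fr \<one> t" u "fr \<one> s"] by (simp add: A.R.Q_mult)
    moreover have "v \<otimes>\<^bsub>A\<^esub> u \<in> I" "t \<otimes> s \<in> S" using * S_mult I.I_l_closed by auto
    ultimately show "Y \<otimes>\<^bsub>T\<^esub> X \<in> J" unfolding J_def by blast
    then show "X \<otimes>\<^bsub>T\<^esub> Y \<in> J" using T.m_comm[of X Y] c Y by simp
  qed
  have "I \<subseteq> contraction J"
  proof
    fix u assume u: "u \<in> I"
    have "pure u (fr \<one> \<one>) \<in> J"
      unfolding J_def by (intro CollectI exI conjI, rule refl, rule u, rule S_one)
    then show "u \<in> contraction J" using u sub by (auto simp: contraction_def A.R.Q_one)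
  qed
  then have "ext I \<subseteq> J" by (rule ext_least[OF J])
  show "contraction (ext I) \<subseteq> I"
  proof
    fix v assume "v \<in> contraction (ext I)"
    then have v: "v \<in> carrier A" "pure v \<one>\<^bsub>K\<^esub> \<in> J" using \<open>ext I \<subseteq> J\<close> by (auto simp: contraction_def)
    then obtain u s where u: "u \<in> I" "s \<in> S" "pure v \<one>\<^bsub>K\<^esub> = pure u (fr \<one> s)" unfolding J_def by blast
    then obtain t where t: "t \<in> S" "t \<odot>\<^bsub>A\<^esub> (s \<odot>\<^bsub>A\<^esub> v) = t \<odot>\<^bsub>A\<^esub> u"
      using pure_frac_eqD[of v u s] v sub by auto
    then have "t \<odot>\<^bsub>A\<^esub> (s \<odot>\<^bsub>A\<^esub> v) \<in> I" using Ismult u(1) S_closed by simp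
    then show "v \<in> I" using assms t(1) u(2) v(1) S_closed[of s] unfolding saturated_def by blast
  qed
qed

lemma saturated_proper_ext:
  assumes "saturated I"
  shows "ext I = carrier T \<longleftrightarrow> I = carrier A"
proof
  assume "ext I = carrier T"
  then show "I = carrier A"
    using contraction_ext[OF assms] pure_closed[of _ "\<one>\<^bsub>K\<^esub>"] B.one_closed by (auto simp: contraction_def)
next
  assume I: "I = carrier A"
  have "\<one>\<^bsub>T\<^esub> \<in> ext I" using ext_contains[of I "\<one>\<^bsub>A\<^esub>"] I by (simp add: pure_one[symmetric])
  then show "ext I = carrier T"
    using ext_ideal[of I] I by (simp add: ideal.one_imp_carrier)
qed

lemma ext_mono: "I \<subseteq> J \<Longrightarrow> J \<subseteq> carrier A \<Longrightarrow> ext I \<subseteq> ext J"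
  using ext_contains[of J] ext_ideal[of J] by (intro ext_least) (auto simp: contraction_def)

lemma ext_inj: "saturated I \<Longrightarrow> saturated J \<Longrightarrow> ext I = ext J \<Longrightarrow> I = J"
  using contraction_ext by metis

lemma maximal_ext:
  assumes I: "saturated I" "I \<noteq> carrier A"
    and max: "\<And>J. saturated J \<Longrightarrow> I \<subseteq> J \<Longrightarrow> J \<noteq> carrier A \<Longrightarrow> J = I"
  shows "maximalideal (ext I) T"
proof (rule maximalidealI)
  have sub: "I \<subseteq> carrier A"
    using I(1) ideal.Icarr[of I A] unfolding saturated_def by blast
  show "ideal (ext I) T" using sub by (rule ext_ideal)
  show "carrier T \<noteq> ext I" using saturated_proper_ext I by metis
  fix J assume J: "ideal J T" "ext I \<subseteq> J" "J \<subseteq> carrier T"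
  have "I \<subseteq> contraction J"
    using contraction_ext[OF I(1)] J(2) unfolding contraction_def by blast
  then show "J = ext I \<or> J = carrier T"
    using max[OF saturated_contraction[OF J(1)]] ext_contraction[OF J(1)]
      saturated_proper_ext[OF saturated_contraction[OF J(1)]] by metis
qed

lemma maximal_contraction:
  assumes P: "maximalideal P T"
  shows "saturated (contraction P)" "contraction P \<noteq> carrier A" "ext (contraction P) = P"
    and "\<And>J. saturated J \<Longrightarrow> contraction P \<subseteq> J \<Longrightarrow> J \<noteq> carrier A \<Longrightarrow> J = contraction P"
proof -
  interpret P: maximalideal P T by fact
  show sat: "saturated (contraction P)" by (rule saturated_contraction[OF P.ideal_axioms])
  show eq: "ext (contraction P) = P" by (rule ext_contraction[OF P.ideal_axioms])
  show "contraction P \<noteq> carrier A" using saturated_proper_ext[OF sat] eq P.I_notcarr by metis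
  fix J assume J: "saturated J" "contraction P \<subseteq> J" "J \<noteq> carrier A"
  have sub: "J \<subseteq> carrier A"
    using J(1) ideal.Icarr[of J A] unfolding saturated_def by blast
  have "P \<subseteq> ext J" using ext_mono[OF J(2) sub] eq by simp
  then have "ext J = P \<or> ext J = carrier T"
    using P.I_maximal[OF ext_ideal[OF sub]] ideal.Icarr[OF ext_ideal[OF sub]] by blast
  then have "ext J = P" using saturated_proper_ext[OF J(1)] J(3) by blast
  then show "J = contraction P" using contraction_ext[OF J(1)] by simp
qed

end

section \<open>The adic completion\<close>

locale adic = cring R + ideal I R for I and R (structure)
begin

abbreviation "P \<equiv> ideal_power R I"
abbreviation "C \<equiv> completion R I"

lemma ideals_set_sel [simp]:
  "\<one>\<^bsub>ideals_set R\<^esub> = carrier R" "J \<otimes>\<^bsub>ideals_set R\<^esub> J' = J \<cdot> J'"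
  by (simp_all add: ideals_set_def)

lemma P_0: "P 0 = carrier R" and P_Suc: "P (Suc n) = P n \<cdot> I"
  by (simp_all add: nat_pow_def)

lemma P_ideal: "ideal (P n) R"
  by (induction n) (auto simp: oneideal ideal_prod_is_ideal is_ideal)

lemma P_Suc_subset: "P (Suc n) \<subseteq> P n"
  using ideal_prod_inter[OF P_ideal is_ideal] by auto

lemma P_antimono: "m \<le> n \<Longrightarrow> P n \<subseteq> P m"
  using P_Suc_subset by (rule lift_Suc_antimono_le)

lemma P_1: "P (Suc 0) = I"
  using ideal_prod_one[OF is_ideal] by (simp add: ideal_prod_commute[OF oneideal is_ideal])

lemma mem_coset:
  assumes "r \<in> carrier R" "s \<in> carrier R"
  shows "s \<in> P n +> r \<longleftrightarrow> s \<ominus> r \<in> P n"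
proof
  assume "s \<in> P n +> r"
  then obtain h where h: "h \<in> P n" "s = h \<oplus> r" by (auto simp: a_r_coset_def')
  then have "s \<ominus> r = h" using assms ideal.Icarr[OF P_ideal] by (simp add: a_minus_def a_assoc r_neg)
  then show "s \<ominus> r \<in> P n" using h by simp
next
  assume "s \<ominus> r \<in> P n"
  moreover have "s = (s \<ominus> r) \<oplus> r" using assms by (simp add: a_minus_def a_assoc l_neg)
  ultimately show "s \<in> P n +> r" unfolding a_r_coset_def' by blast
qed

lemma coset_eq_iff:
  assumes "r \<in> carrier R" "s \<in> carrier R"
  shows "P n +> r = P n +> s \<longleftrightarrow> r \<ominus> s \<in> P n"
  using quotient_eq_iff_same_a_r_cos[OF P_ideal assms] by auto

lemma coset_self: "r \<in> carrier R \<Longrightarrow> r \<in> P n +> r"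
  using additive_subgroup.zero_closed[OF ideal.axioms(1)[OF P_ideal]]
  by (simp add: mem_coset a_minus_def r_neg)

lemma coset_subset: "P n +> r \<subseteq> carrier R" if "r \<in> carrier R"
  using a_r_coset_subset_G[OF additive_subgroup.a_subset[OF ideal.axioms(1)[OF P_ideal]] that] .

lemma coset_mono: "m \<le> n \<Longrightarrow> P n +> r \<subseteq> P m +> r"
  using P_antimono[of m n] by (auto simp: a_r_coset_def')

lemma C_iff: "u \<in> carrier C \<longleftrightarrow> (\<forall>n. (\<exists>r \<in> carrier R. u n = P n +> r) \<and> u (Suc n) \<subseteq> u n)"
  by (auto simp: completion_def FactRing_def A_RCOSETS_def' a_r_coset_def')

lemma rep:
  assumes "u \<in> carrier C" "r \<in> u n"
  shows "r \<in> carrier R" "u n = P n +> r"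
proof -
  obtain s where s: "s \<in> carrier R" "u n = P n +> s" using assms(1) unfolding C_iff by blast
  show r: "r \<in> carrier R" using s assms(2) coset_subset by blast
  have "r \<ominus> s \<in> P n" using s assms(2) mem_coset r by simp
  then show "u n = P n +> r" using coset_eq_iff[OF r s(1)] s(2) by metis
qed

lemma ex_rep:
  assumes "u \<in> carrier C" obtains r where "r \<in> u n" "r \<in> carrier R"
  using assms coset_self unfolding C_iff by metis

lemma rep_le: "u \<in> carrier C \<Longrightarrow> m \<le> n \<Longrightarrow> r \<in> u n \<Longrightarrow> r \<in> u m"
  using lift_Suc_antimono_le[of u m n] by (auto simp: C_iff)

lemma C_eqI:
  assumes "u \<in> carrier C" "v \<in> carrier C" "\<And>n. \<exists>r. r \<in> u n \<and> r \<in> v n"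
  shows "u = v"
proof
  fix n
  obtain r where "r \<in> u n" "r \<in> v n" using assms(3) by blast
  then show "u n = v n" using rep(2) assms(1,2) by metis
qed

lemma C_sequence:
  assumes "\<And>n. r n \<in> carrier R" "\<And>n. r (Suc n) \<ominus> r n \<in> P n"
  shows "(\<lambda>n. P n +> r n) \<in> carrier C"
  unfolding C_iff
proof (intro allI conjI)
  fix n
  show "\<exists>s\<in>carrier R. P n +> r n = P n +> s" using assms(1) by blast
  have "P n +> r (Suc n) = P n +> r n" using coset_eq_iff assms by simp
  then show "P (Suc n) +> r (Suc n) \<subseteq> P n +> r n" using coset_mono[of n "Suc n" "r (Suc n)"] by simp
qed

lemma C_sel:
  "(u \<oplus>\<^bsub>C\<^esub> v) n = u n <+> v n" "(u \<otimes>\<^bsub>C\<^esub> v) n = rcoset_mult R (P n) (u n) (v n)"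
  "\<one>\<^bsub>C\<^esub> n = P n +> \<one>" "\<zero>\<^bsub>C\<^esub> n = P n"
  by (simp_all add: completion_def FactRing_def)

lemma C_op_coset:
  assumes "u \<in> carrier C" "v \<in> carrier C" "r \<in> u n" "s \<in> v n"
  shows "(u \<oplus>\<^bsub>C\<^esub> v) n = P n +> (r \<oplus> s)" "(u \<otimes>\<^bsub>C\<^esub> v) n = P n +> (r \<otimes> s)"
  using rep[OF assms(1,3)] rep[OF assms(2,4)] abelian_subgroup.a_rcos_sum[of "P n" R r s]
    ideal.rcoset_mult_add[OF P_ideal, of r s n] ideal.axioms(1)[OF P_ideal]
    abelian_subgroupI3[OF _ abelian_group_axioms]
  by (auto simp: C_sel)

lemma C_op_rep:
  assumes "u \<in> carrier C" "v \<in> carrier C" "r \<in> u n" "s \<in> v n"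
  shows "r \<oplus> s \<in> (u \<oplus>\<^bsub>C\<^esub> v) n" "r \<otimes> s \<in> (u \<otimes>\<^bsub>C\<^esub> v) n"
  using C_op_coset[OF assms] coset_self rep(1)[OF assms(1,3)] rep(1)[OF assms(2,4)] by auto

lemma C_const_rep: "\<zero> \<in> \<zero>\<^bsub>C\<^esub> n" "\<one> \<in> \<one>\<^bsub>C\<^esub> n"
  using coset_self additive_subgroup.zero_closed[OF ideal.axioms(1)[OF P_ideal]] by (auto simp: C_sel)

lemma C_const_closed: "\<zero>\<^bsub>C\<^esub> \<in> carrier C" "\<one>\<^bsub>C\<^esub> \<in> carrier C"
proof -
  have "P n +> \<zero> = P n" for n
    using ideal.Icarr[OF P_ideal] by (auto simp: a_r_coset_def')
  then show "\<zero>\<^bsub>C\<^esub> \<in> carrier C" "\<one>\<^bsub>C\<^esub> \<in> carrier C"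
    unfolding C_iff C_sel using P_Suc_subset coset_mono[of _ "Suc _"]
    by (auto intro: bexI[of _ \<zero>] bexI[of _ \<one>] coset_mono[THEN subsetD])
qed

lemma C_op_closed:
  assumes "u \<in> carrier C" "v \<in> carrier C"
  shows "u \<oplus>\<^bsub>C\<^esub> v \<in> carrier C" "u \<otimes>\<^bsub>C\<^esub> v \<in> carrier C"
proof -
  have "(\<exists>r \<in> carrier R. (u \<oplus>\<^bsub>C\<^esub> v) n = P n +> r) \<and> (u \<oplus>\<^bsub>C\<^esub> v) (Suc n) \<subseteq> (u \<oplus>\<^bsub>C\<^esub> v) n"
    "(\<exists>r \<in> carrier R. (u \<otimes>\<^bsub>C\<^esub> v) n = P n +> r) \<and> (u \<otimes>\<^bsub>C\<^esub> v) (Suc n) \<subseteq> (u \<otimes>\<^bsub>C\<^esub> v) n" for n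
  proof -
    obtain r s where r: "r \<in> u (Suc n)" "r \<in> carrier R" "s \<in> v (Suc n)" "s \<in> carrier R"
      using ex_rep assms by metis
    moreover from this have "r \<in> u n" "s \<in> v n" using rep_le[of _ n "Suc n"] assms by auto
    ultimately show "(\<exists>r \<in> carrier R. (u \<oplus>\<^bsub>C\<^esub> v) n = P n +> r) \<and> (u \<oplus>\<^bsub>C\<^esub> v) (Suc n) \<subseteq> (u \<oplus>\<^bsub>C\<^esub> v) n"
      "(\<exists>r \<in> carrier R. (u \<otimes>\<^bsub>C\<^esub> v) n = P n +> r) \<and> (u \<otimes>\<^bsub>C\<^esub> v) (Suc n) \<subseteq> (u \<otimes>\<^bsub>C\<^esub> v) n"
      using C_op_coset[OF assms, of r n s] C_op_coset[OF assms, of r "Suc n" s]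
        coset_mono[of n "Suc n"] by auto
  qed
  then show "u \<oplus>\<^bsub>C\<^esub> v \<in> carrier C" "u \<otimes>\<^bsub>C\<^esub> v \<in> carrier C" by (simp_all add: C_iff)
qed

lemma C_minus_closed:
  assumes "u \<in> carrier C"
  shows "\<exists>v \<in> carrier C. v \<oplus>\<^bsub>C\<^esub> u = \<zero>\<^bsub>C\<^esub>"
proof -
  define r where "r n = (SOME r. r \<in> u n)" for n
  have r: "r n \<in> u n" for n unfolding r_def using ex_rep[OF assms] by (metis someI)
  have rc: "r n \<in> carrier R" for n using rep(1)[OF assms r] .
  define v where "v = (\<lambda>n. P n +> (\<ominus> r n))"
  have "v \<in> carrier C"
    unfolding v_def
  proof (rule C_sequence)
    fix n
    have "r (Suc n) \<in> u n" using r rep_le[OF assms, of n "Suc n"] by simp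
    then have "P n +> r n = P n +> r (Suc n)" using rep(2)[OF assms] r by metis
    then have "r n \<ominus> r (Suc n) \<in> P n" using coset_eq_iff rc by simp
    moreover have "\<ominus> r (Suc n) \<ominus> (\<ominus> r n) = r n \<ominus> r (Suc n)"
      using rc by (simp add: a_minus_def a_comm)
    ultimately show "\<ominus> r (Suc n) \<ominus> (\<ominus> r n) \<in> P n" by simp
  qed (use rc in simp)
  moreover have "v \<oplus>\<^bsub>C\<^esub> u = \<zero>\<^bsub>C\<^esub>"
  proof (rule C_eqI)
    fix n
    have "\<ominus> r n \<in> v n" using rc coset_self by (simp add: v_def)
    then have "\<ominus> r n \<oplus> r n \<in> (v \<oplus>\<^bsub>C\<^esub> u) n" using C_op_rep(1) \<open>v \<in> carrier C\<close> assms r by blast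
    then show "\<exists>r. r \<in> (v \<oplus>\<^bsub>C\<^esub> u) n \<and> r \<in> \<zero>\<^bsub>C\<^esub> n" using C_const_rep rc by (auto simp: l_neg)
  qed (use assms \<open>v \<in> carrier C\<close> C_op_closed C_const_closed in auto)
  ultimately show ?thesis by blast
qed

text \<open>
  Identities in the completion are checked level by level on representatives, where they become identities
  in \<open>R\<close>.
\<close>

lemma C_identity:
  assumes "u \<in> carrier C" "v \<in> carrier C" "w \<in> carrier C" "x \<in> carrier C" "y \<in> carrier C"
    and "\<And>n r s t. \<lbrakk>r \<in> carrier R; s \<in> carrier R; t \<in> carrier R; r \<in> u n; s \<in> v n; t \<in> w n\<rbrakk> \<Longrightarrow>
      f r s t \<in> x n \<and> g r s t \<in> y n \<and> f r s t = g r s t"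
  shows "x = y"
proof (rule C_eqI[OF assms(4,5)])
  fix n
  obtain r s t where "r \<in> u n" "r \<in> carrier R" "s \<in> v n" "s \<in> carrier R" "t \<in> w n" "t \<in> carrier R"
    using ex_rep[OF assms(1)] ex_rep[OF assms(2)] ex_rep[OF assms(3)] by metis
  then have "f r s t \<in> x n" "f r s t \<in> y n" using assms(6)[of r s t n] by auto
  then show "\<exists>r. r \<in> x n \<and> r \<in> y n" by blast
qed

lemma cring_C: "cring C"
proof (rule cringI)
  note closed = C_op_closed C_const_closed
  show "abelian_group C"
  proof (rule abelian_groupI)
    fix u v assume uv: "u \<in> carrier C" "v \<in> carrier C"
    show "u \<oplus>\<^bsub>C\<^esub> v \<in> carrier C" "\<exists>v\<in>carrier C. v \<oplus>\<^bsub>C\<^esub> u = \<zero>\<^bsub>C\<^esub>"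
      using closed uv C_minus_closed by auto
    show "u \<oplus>\<^bsub>C\<^esub> v = v \<oplus>\<^bsub>C\<^esub> u"
      by (rule C_identity[of u v v _ _ "\<lambda>r s t. r \<oplus> s" "\<lambda>r s t. s \<oplus> r"])
        (use uv closed in \<open>auto intro!: C_op_rep a_comm\<close>)
    show "\<zero>\<^bsub>C\<^esub> \<oplus>\<^bsub>C\<^esub> u = u"
      by (rule C_identity[of u u u _ _ "\<lambda>r s t. \<zero> \<oplus> r" "\<lambda>r s t. r"])
        (use uv closed in \<open>auto simp del: l_zero intro!: C_op_rep C_const_rep l_zero\<close>)
    fix w assume w: "w \<in> carrier C"
    show "u \<oplus>\<^bsub>C\<^esub> v \<oplus>\<^bsub>C\<^esub> w = u \<oplus>\<^bsub>C\<^esub> (v \<oplus>\<^bsub>C\<^esub> w)"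
      by (rule C_identity[of u v w _ _ "\<lambda>r s t. r \<oplus> s \<oplus> t" "\<lambda>r s t. r \<oplus> (s \<oplus> t)"])
        (use uv w closed in \<open>auto intro!: C_op_rep a_assoc\<close>)
  qed (rule closed)
  show "Group.comm_monoid C"
  proof (rule comm_monoidI)
    fix u v assume uv: "u \<in> carrier C" "v \<in> carrier C"
    show "u \<otimes>\<^bsub>C\<^esub> v \<in> carrier C" using closed uv by auto
    show "u \<otimes>\<^bsub>C\<^esub> v = v \<otimes>\<^bsub>C\<^esub> u"
      by (rule C_identity[of u v v _ _ "\<lambda>r s t. r \<otimes> s" "\<lambda>r s t. s \<otimes> r"])
        (use uv closed in \<open>auto intro!: C_op_rep m_comm\<close>)
    show "\<one>\<^bsub>C\<^esub> \<otimes>\<^bsub>C\<^esub> u = u"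
      by (rule C_identity[of u u u _ _ "\<lambda>r s t. \<one> \<otimes> r" "\<lambda>r s t. r"])
        (use uv closed in \<open>auto simp del: l_one intro!: C_op_rep C_const_rep l_one\<close>)
    fix w assume w: "w \<in> carrier C"
    show "u \<otimes>\<^bsub>C\<^esub> v \<otimes>\<^bsub>C\<^esub> w = u \<otimes>\<^bsub>C\<^esub> (v \<otimes>\<^bsub>C\<^esub> w)"
      by (rule C_identity[of u v w _ _ "\<lambda>r s t. r \<otimes> s \<otimes> t" "\<lambda>r s t. r \<otimes> (s \<otimes> t)"])
        (use uv w closed in \<open>auto intro!: C_op_rep m_assoc\<close>)
  qed (rule closed)
  fix u v w assume uvw: "u \<in> carrier C" "v \<in> carrier C" "w \<in> carrier C"
  show "(u \<oplus>\<^bsub>C\<^esub> v) \<otimes>\<^bsub>C\<^esub> w = u \<otimes>\<^bsub>C\<^esub> w \<oplus>\<^bsub>C\<^esub> v \<otimes>\<^bsub>C\<^esub> w"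
    by (rule C_identity[of u v w _ _ "\<lambda>r s t. (r \<oplus> s) \<otimes> t" "\<lambda>r s t. r \<otimes> t \<oplus> s \<otimes> t"])
      (use uvw closed in \<open>auto intro!: C_op_rep l_distr\<close>)
qed

sublocale C: cring C by (rule cring_C)

abbreviation "\<iota> \<equiv> completion_map R I"

lemma iota_rep: "r \<in> carrier R \<Longrightarrow> r \<in> \<iota> r n"
  using coset_self by (simp add: completion_map_def)

lemma iota_closed: "r \<in> carrier R \<Longrightarrow> \<iota> r \<in> carrier C"
  using C_sequence[of "\<lambda>_. r"] additive_subgroup.zero_closed[OF ideal.axioms(1)[OF P_ideal]]
  by (simp add: completion_map_def[abs_def] a_minus_def r_neg)

lemma iota_hom: "\<iota> \<in> ring_hom R C"
proof (rule ring_hom_memI)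
  fix r s assume rs: "r \<in> carrier R" "s \<in> carrier R"
  have "r \<otimes> s \<in> (\<iota> r \<otimes>\<^bsub>C\<^esub> \<iota> s) n" "r \<oplus> s \<in> (\<iota> r \<oplus>\<^bsub>C\<^esub> \<iota> s) n" for n
    using rs by (auto intro!: C_op_rep iota_rep iota_closed)
  then show "\<iota> (r \<otimes> s) = \<iota> r \<otimes>\<^bsub>C\<^esub> \<iota> s" "\<iota> (r \<oplus> s) = \<iota> r \<oplus>\<^bsub>C\<^esub> \<iota> s"
    using rs by (auto intro!: C_eqI iota_closed iota_rep)
next
  show "\<iota> \<one> = \<one>\<^bsub>C\<^esub>"
    by (rule C_eqI) (auto intro!: iota_closed C_const_closed exI[of _ \<one>] iota_rep C_const_rep)
qed (rule iota_closed)

end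

section \<open>Finitely generated ideals\<close>

context cring
begin

definition adjoin :: "'a set \<Rightarrow> 'a \<Rightarrow> 'a set" where
  "adjoin I a = {i \<oplus> c \<otimes> a | i c. i \<in> I \<and> c \<in> carrier R}"

lemma adjoin_memI: "i \<in> I \<Longrightarrow> c \<in> carrier R \<Longrightarrow> x = i \<oplus> c \<otimes> a \<Longrightarrow> x \<in> adjoin I a"
  unfolding adjoin_def by blast

lemma ideal_by_closure:
  assumes "I \<subseteq> carrier R" "\<zero> \<in> I" "\<And>a b. a \<in> I \<Longrightarrow> b \<in> I \<Longrightarrow> a \<oplus> b \<in> I"
    "\<And>a c. a \<in> I \<Longrightarrow> c \<in> carrier R \<Longrightarrow> c \<otimes> a \<in> I"
  shows "ideal I R"
proof (rule idealI[OF ring_axioms add.subgroupI])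
  fix a assume a: "a \<in> I"
  then have "\<ominus> \<one> \<otimes> a \<in> I" using assms(4) by simp
  then show "\<ominus> a \<in> I" using a assms(1) by (auto simp: l_minus)
next
  fix a x assume ax: "a \<in> I" "x \<in> carrier R"
  then show "x \<otimes> a \<in> I" by (rule assms(4))
  then show "a \<otimes> x \<in> I" using ax assms(1) m_comm[of a x] by auto
qed (use assms in auto)

lemma adjoin_ideal:
  assumes "ideal I R" "a \<in> carrier R"
  shows "ideal (adjoin I a) R" "I \<subseteq> adjoin I a" "a \<in> adjoin I a"
proof -
  interpret I: ideal I R by fact
  show "I \<subseteq> adjoin I a"
  proof
    fix i assume "i \<in> I"
    then show "i \<in> adjoin I a" using assms by (intro adjoin_memI[of i _ \<zero>]) auto
  qed
  show "a \<in> adjoin I a" using assms by (intro adjoin_memI[of \<zero> _ \<one>]) auto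
  show "ideal (adjoin I a) R"
  proof (rule ideal_by_closure)
    show "adjoin I a \<subseteq> carrier R" using assms(2) I.Icarr by (auto simp: adjoin_def)
    show "\<zero> \<in> adjoin I a" using \<open>I \<subseteq> adjoin I a\<close> by auto
    fix x assume "x \<in> adjoin I a"
    then obtain i c where x: "x = i \<oplus> c \<otimes> a" "i \<in> I" "c \<in> carrier R" by (auto simp: adjoin_def)
    show "d \<otimes> x \<in> adjoin I a" if d: "d \<in> carrier R" for d
    proof (rule adjoin_memI)
      show "d \<otimes> x = d \<otimes> i \<oplus> (d \<otimes> c) \<otimes> a" using x d assms(2) I.Icarr by (simp add: r_distr m_assoc)
    qed (use x d I.I_l_closed in auto)
    fix y assume "y \<in> adjoin I a"
    then obtain j d where y: "y = j \<oplus> d \<otimes> a" "j \<in> I" "d \<in> carrier R" by (auto simp: adjoin_def)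
    show "x \<oplus> y \<in> adjoin I a"
    proof (rule adjoin_memI)
      show "x \<oplus> y = (i \<oplus> j) \<oplus> (c \<oplus> d) \<otimes> a" using x y assms(2) I.Icarr by (simp add: l_distr a_ac)
    qed (use x y in auto)
  qed
qed

lemma adjoin_least:
  assumes "ideal J R" "I \<subseteq> J" "a \<in> J"
  shows "adjoin I a \<subseteq> J"
proof -
  interpret J: ideal J R by fact
  show ?thesis using assms J.I_l_closed J.a_closed by (auto simp: adjoin_def)
qed

text \<open>
  The inductive form gives an induction rule that adds one generator at a time; both the double
  annihilator property and Cohen's argument below are proved by it.
\<close>

inductive fin_gen :: "'a set \<Rightarrow> bool" where
  fin_gen_zero: "fin_gen {\<zero>}"
| fin_gen_adjoin: "fin_gen I \<Longrightarrow> a \<in> carrier R \<Longrightarrow> fin_gen (adjoin I a)"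

lemma fin_gen_ideal: "fin_gen I \<Longrightarrow> ideal I R"
  by (induction rule: fin_gen.induct) (auto intro: zeroideal adjoin_ideal)

lemma fin_gen_carrier: "fin_gen (carrier R)"
proof -
  have "adjoin {\<zero>} \<one> = carrier R"
    using adjoin_ideal(1,3)[OF zeroideal one_closed] by (rule ideal.one_imp_carrier)
  then show ?thesis using fin_gen_adjoin[OF fin_gen_zero one_closed] by simp
qed

text \<open>
  Writing each generator of \<open>J\<close> as an element of \<open>I\<close> plus a multiple of \<open>x\<close> and keeping the first summands
  gives the generators of \<open>Q\<close>.
\<close>

lemma fin_gen_modulo:
  assumes "fin_gen J" "ideal I R" "x \<in> carrier R" "J \<subseteq> adjoin I x"
  shows "\<exists>Q. fin_gen Q \<and> Q \<subseteq> I \<and> J \<subseteq> adjoin Q x"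
  using assms(1,4)
proof (induction rule: fin_gen.induct)
  case fin_gen_zero
  interpret I: ideal I R by fact
  show ?case
    using fin_gen.fin_gen_zero adjoin_ideal(2)[OF zeroideal assms(3)] by (intro exI[of _ "{\<zero>}"]) auto
next
  case (fin_gen_adjoin J a)
  interpret I: ideal I R by fact
  have J: "J \<subseteq> adjoin J a" "a \<in> adjoin J a" using fin_gen_ideal fin_gen_adjoin adjoin_ideal(2,3) by auto
  then obtain Q where Q: "fin_gen Q" "Q \<subseteq> I" "J \<subseteq> adjoin Q x" using fin_gen_adjoin by blast
  obtain i c where a: "a = i \<oplus> c \<otimes> x" "i \<in> I" "c \<in> carrier R"
    using J fin_gen_adjoin.prems unfolding adjoin_def[of I] by blast
  have i: "i \<in> carrier R" using a I.Icarr by simp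
  note q = adjoin_ideal[OF fin_gen_ideal[OF Q(1)] i]
  have id: "ideal (adjoin (adjoin Q i) x) R" by (rule adjoin_ideal(1)[OF q(1) assms(3)])
  have "adjoin Q x \<subseteq> adjoin (adjoin Q i) x" using q(2) by (auto simp: adjoin_def[of _ x])
  moreover have "a \<in> adjoin (adjoin Q i) x" using q(3) a(3,1) by (rule adjoin_memI)
  ultimately have "adjoin J a \<subseteq> adjoin (adjoin Q i) x" using Q(3) by (intro adjoin_least[OF id]) auto
  moreover have "adjoin Q i \<subseteq> I" using Q(2) a(2) by (rule adjoin_least[OF assms(2)])
  ultimately show ?case using fin_gen.fin_gen_adjoin[OF Q(1) i] by blast
qed

lemma fin_gen_add_mult:
  assumes "fin_gen J" "fin_gen Q" "x \<in> carrier R"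
  shows "fin_gen {q \<oplus> x \<otimes> j | q j. q \<in> Q \<and> j \<in> J}"
  using assms(1)
proof (induction rule: fin_gen.induct)
  case fin_gen_zero
  have "{q \<oplus> x \<otimes> j | q j. q \<in> Q \<and> j \<in> {\<zero>}} = Q"
    using ideal.Icarr[OF fin_gen_ideal[OF assms(2)]] assms(3) by force
  then show ?case using assms(2) by (simp only:)
next
  case (fin_gen_adjoin J a)
  note c = ideal.Icarr[OF fin_gen_ideal[OF assms(2)]] ideal.Icarr[OF fin_gen_ideal[OF fin_gen_adjoin(1)]]
  have eq: "q \<oplus> x \<otimes> (j \<oplus> d \<otimes> a) = (q \<oplus> x \<otimes> j) \<oplus> d \<otimes> (x \<otimes> a)"
    if "q \<in> Q" "j \<in> J" "d \<in> carrier R" for q j d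
    using that c assms(3) fin_gen_adjoin(2) by (simp add: r_distr a_assoc m_lcomm)
  have "{q \<oplus> x \<otimes> j | q j. q \<in> Q \<and> j \<in> adjoin J a} = adjoin {q \<oplus> x \<otimes> j | q j. q \<in> Q \<and> j \<in> J} (x \<otimes> a)"
  proof (intro equalityI subsetI)
    fix y assume "y \<in> {q \<oplus> x \<otimes> j | q j. q \<in> Q \<and> j \<in> adjoin J a}"
    then obtain q j d where "q \<in> Q" "j \<in> J" "d \<in> carrier R" "y = q \<oplus> x \<otimes> (j \<oplus> d \<otimes> a)"
      unfolding adjoin_def by blast
    then show "y \<in> adjoin {q \<oplus> x \<otimes> j | q j. q \<in> Q \<and> j \<in> J} (x \<otimes> a)"
      unfolding adjoin_def using eq by blast
  next
    fix y assume "y \<in> adjoin {q \<oplus> x \<otimes> j | q j. q \<in> Q \<and> j \<in> J} (x \<otimes> a)"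
    then obtain q j d where "q \<in> Q" "j \<in> J" "d \<in> carrier R" "y = (q \<oplus> x \<otimes> j) \<oplus> d \<otimes> (x \<otimes> a)"
      unfolding adjoin_def by blast
    then have "y = q \<oplus> x \<otimes> (j \<oplus> d \<otimes> a)" "j \<oplus> d \<otimes> a \<in> adjoin J a"
      using eq by (auto intro: adjoin_memI)
    then show "y \<in> {q \<oplus> x \<otimes> j | q j. q \<in> Q \<and> j \<in> adjoin J a}"
      using \<open>q \<in> Q\<close> by blast
  qed
  then show ?case using fin_gen.fin_gen_adjoin[OF fin_gen_adjoin.IH] assms(3) fin_gen_adjoin(2) by simp
qed

lemma fin_gen_chain:
  assumes "C \<noteq> {}" "subset.chain {I. ideal I R} C" "fin_gen J" "J \<subseteq> \<Union>C"
  shows "\<exists>I \<in> C. J \<subseteq> I"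
  using assms(3,4)
proof (induction rule: fin_gen.induct)
  case fin_gen_zero
  then show ?case by auto
next
  case (fin_gen_adjoin J a)
  have J: "J \<subseteq> adjoin J a" "a \<in> adjoin J a" using fin_gen_ideal fin_gen_adjoin adjoin_ideal(2,3) by auto
  then obtain I where I: "I \<in> C" "J \<subseteq> I" using fin_gen_adjoin by blast
  obtain I' where I': "I' \<in> C" "a \<in> I'" using fin_gen_adjoin.prems J by blast
  have "I \<subseteq> I' \<or> I' \<subseteq> I" using assms(2) I I' unfolding subset_chain_def by blast
  then obtain I0 where "I0 \<in> C" "J \<subseteq> I0" "a \<in> I0" using I I' by blast
  moreover from this have "ideal I0 R" using assms(2) by (auto simp: subset_chain_def)
  ultimately show ?case using adjoin_least by blast
qed

text \<open>
  Zorn's lemma applies because a finitely generated ideal inside the union of a chain of ideals lies in a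
  member of the chain.
\<close>

lemma maximal_non_fin_gen:
  assumes "ideal I R" "\<not> fin_gen I"
  obtains M where "ideal M R" "\<not> fin_gen M" "\<And>J. ideal J R \<Longrightarrow> M \<subseteq> J \<Longrightarrow> J \<noteq> M \<Longrightarrow> fin_gen J"
proof -
  let ?N = "{I. ideal I R \<and> \<not> fin_gen I}"
  have "\<exists>M\<in>?N. \<forall>X\<in>?N. M \<subseteq> X \<longrightarrow> X = M"
  proof (rule subset_Zorn_nonempty)
    show "?N \<noteq> {}" using assms by blast
    fix C assume C: "C \<noteq> {}" "subset.chain ?N C"
    then have chain: "subset.chain {I. ideal I R} C" and N: "C \<subseteq> ?N" by (auto simp: subset_chain_def)
    have "\<not> fin_gen (\<Union>C)"
    proof
      assume "fin_gen (\<Union>C)"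
      then obtain I where "I \<in> C" "\<Union>C \<subseteq> I" using fin_gen_chain[OF C(1) chain, of "\<Union>C"] by blast
      then have "\<Union>C = I" by blast
      then show False using \<open>fin_gen (\<Union>C)\<close> \<open>I \<in> C\<close> N by auto
    qed
    moreover have "ideal (\<Union>C) R" using chain_Union_is_ideal[OF chain] C(1) by simp
    ultimately show "\<Union>C \<in> ?N" by simp
  qed
  then show thesis using that by blast
qed

text \<open>
  Cohen's argument. \<open>M + (x)\<close> is finitely generated by maximality, so that \<open>M = Q + x (M : x)\<close>. If \<open>M : x\<close>
  were larger than \<open>M\<close>, it would be finitely generated and with it \<open>M\<close>; hence \<open>M : x = M\<close>.
\<close>

lemma maximal_non_fin_gen_step:
  assumes M: "ideal M R" "\<not> fin_gen M" "\<And>J. ideal J R \<Longrightarrow> M \<subseteq> J \<Longrightarrow> J \<noteq> M \<Longrightarrow> fin_gen J"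
    and x: "x \<in> carrier R" "x \<notin> M"
  obtains Q where "fin_gen Q" "Q \<subseteq> M" "\<And>p. p \<in> M \<Longrightarrow> \<exists>q \<in> Q. \<exists>p' \<in> M. p = q \<oplus> x \<otimes> p'"
proof -
  interpret M: ideal M R by fact
  note a = adjoin_ideal[OF M(1) x(1)]
  have "fin_gen (adjoin M x)" using M(3)[OF a(1,2)] a(3) x(2) by blast
  then obtain Q where Q: "fin_gen Q" "Q \<subseteq> M" "adjoin M x \<subseteq> adjoin Q x"
    using fin_gen_modulo[OF _ M(1) x(1)] by blast
  define D where "D = {c \<in> carrier R. x \<otimes> c \<in> M}"
  have D: "ideal D R"
    by (rule ideal_by_closure) (auto simp: D_def r_distr x(1) m_lcomm M.I_l_closed)
  have dec: "\<exists>q \<in> Q. \<exists>c \<in> D. p = q \<oplus> x \<otimes> c" if p: "p \<in> M" for p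
  proof -
    obtain q c where q: "q \<in> Q" "c \<in> carrier R" "p = q \<oplus> c \<otimes> x"
      using p a(2) Q(3) unfolding adjoin_def[of Q] by blast
    have "q \<in> M" using q Q(2) by blast
    have "x \<otimes> c = p \<ominus> q"
      using q x(1) M.Icarr[OF \<open>q \<in> M\<close>] by (simp add: a_minus_def a_ac r_neg1 r_neg2 m_comm)
    also have "\<dots> \<in> M" using p \<open>q \<in> M\<close> by (simp add: a_minus_def)
    finally have "c \<in> D" using q by (simp add: D_def)
    then show ?thesis using q x(1) m_comm[of c x] by auto
  qed
  have "D = M"
  proof (rule ccontr)
    assume "D \<noteq> M"
    moreover have "M \<subseteq> D" using M.Icarr M.I_l_closed x(1) by (auto simp: D_def)
    ultimately have "fin_gen {q \<oplus> x \<otimes> c | q c. q \<in> Q \<and> c \<in> D}"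
      using fin_gen_add_mult[OF M(3)[OF D] Q(1) x(1)] by blast
    moreover have "{q \<oplus> x \<otimes> c | q c. q \<in> Q \<and> c \<in> D} = M"
    proof
      show "M \<subseteq> {q \<oplus> x \<otimes> c | q c. q \<in> Q \<and> c \<in> D}" using dec by blast
      show "{q \<oplus> x \<otimes> c | q c. q \<in> Q \<and> c \<in> D} \<subseteq> M" using Q(2) by (auto simp: D_def)
    qed
    ultimately show False using M(2) by simp
  qed
  then show thesis using that[OF Q(1,2)] dec by blast
qed

end

lemma (in noetherian_ring) maximal_in_family:
  assumes "\<F> \<noteq> {}" "\<And>I. I \<in> \<F> \<Longrightarrow> ideal I R"
  obtains M where "M \<in> \<F>" "\<And>I. I \<in> \<F> \<Longrightarrow> M \<subseteq> I \<Longrightarrow> I = M"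
proof -
  have "\<exists>M\<in>\<F>. \<forall>X\<in>\<F>. M \<subseteq> X \<longrightarrow> X = M"
  proof (rule subset_Zorn_nonempty[OF assms(1)])
    fix C assume C: "C \<noteq> {}" "subset.chain \<F> C"
    then have "subset.chain {I. ideal I R} C" using assms(2) by (auto simp: subset_chain_def)
    then have "\<Union>C \<in> C" by (rule ideal_chain_is_trivial[OF C(1)])
    then show "\<Union>C \<in> \<F>" using C(2) by (auto simp: subset_chain_def)
  qed
  then show thesis using that by blast
qed

section \<open>The injective hull of the residue field\<close>

locale residue_hull =
  fixes R :: "('a, 'r) ring_scheme" (structure) and \<mm> :: "'a set" and E :: "('a, 'e, 'm) module_scheme"
  assumes local_ring: "noetherian_local_ring R \<mm>"
    and hull: "injective_hull R (residue_module R \<mm>) E"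
begin

lemma inj: "injective_module R E"
  using hull by (simp add: injective_hull_def)

lemma maximal: "maximalideal J R \<longleftrightarrow> J = \<mm>"
  using local_ring by (auto simp: noetherian_local_ring_def)

end

sublocale residue_hull \<subseteq> E: module R E
  using inj by (simp add: injective_module_def)

sublocale residue_hull \<subseteq> R: noetherian_ring R
  using local_ring by (simp add: noetherian_local_ring_def)

sublocale residue_hull \<subseteq> \<mm>: maximalideal \<mm> R
  using maximal by simp

sublocale residue_hull \<subseteq> adic \<mm> R
  by (intro adic.intro E.R.is_cring \<mm>.is_ideal)

context residue_hull
begin

lemma proper_ideal_le:
  assumes "ideal J R" "J \<noteq> carrier R"
  shows "J \<subseteq> \<mm>"
proof -
  let ?F = "{I. ideal I R \<and> J \<subseteq> I \<and> I \<noteq> carrier R}"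
  have "J \<in> ?F" using assms by simp
  then obtain M where M: "M \<in> ?F" and max: "\<And>I. I \<in> ?F \<Longrightarrow> M \<subseteq> I \<Longrightarrow> I = M"
    using R.maximal_in_family[of ?F] by (metis (no_types, lifting) empty_iff mem_Collect_eq)
  have "maximalideal M R"
  proof (rule maximalidealI)
    show "ideal M R" "carrier R \<noteq> M" using M by auto
    fix I assume I: "ideal I R" "M \<subseteq> I" "I \<subseteq> carrier R"
    then show "I = M \<or> I = carrier R" using max[of I] M by auto
  qed
  then show ?thesis using M maximal by blast
qed

lemma inverse_mod:
  assumes "r \<in> carrier R" "r \<notin> \<mm>"
  obtains s where "s \<in> carrier R" "s \<otimes> r = \<one>"
proof -
  have "ideal (PIdl r) R" using assms by (simp add: E.R.cgenideal_ideal)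
  moreover have "r \<in> PIdl r" using assms E.R.cgenideal_self by blast
  ultimately have "PIdl r = carrier R" using proper_ideal_le assms by blast
  then have "\<one> \<in> PIdl r" by simp
  then obtain x where "x \<in> carrier R" "\<one> = x \<otimes> r" unfolding cgenideal_def by blast
  then show thesis using that[of x] by simp
qed

definition residue_generator where
  "residue_generator \<epsilon> \<longleftrightarrow> \<epsilon> \<in> carrier E \<and> \<epsilon> \<noteq> \<zero>\<^bsub>E\<^esub> \<and> (\<forall>r \<in> \<mm>. r \<odot>\<^bsub>E\<^esub> \<epsilon> = \<zero>\<^bsub>E\<^esub>) \<and>
    (\<forall>V x. submodule V R E \<longrightarrow> x \<in> V \<longrightarrow> x \<noteq> \<zero>\<^bsub>E\<^esub> \<longrightarrow> \<epsilon> \<in> V)"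

text \<open>
  The image of the residue field in \<open>E\<close> is essential, so every nonzero submodule contains a nonzero multiple
  of the image of \<open>1\<close>, and a unit of \<open>R\<close> turns this multiple into the image of \<open>1\<close> itself.
\<close>

lemma ex_residue_generator: "\<exists>\<epsilon>. residue_generator \<epsilon>"
proof -
  let ?k = "residue_module R \<mm>"
  obtain i where i: "i \<in> mod_hom R ?k E" "inj_on i (carrier ?k)" "essential_submodule R E (i ` carrier ?k)"
    using hull by (auto simp: injective_hull_def)
  have k: "carrier ?k = {\<mm> +> r | r. r \<in> carrier R}"
    by (auto simp: algebra_via_def FactRing_def A_RCOSETS_def' a_r_coset_def')
  have m: "\<mm> \<in> carrier ?k"
    using \<mm>.a_rcos_const[OF \<mm>.zero_closed] unfolding k by (intro CollectI exI[of _ \<zero>]) simp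
  have m0: "\<mm> +> \<zero> = \<mm>" "\<mm> +> r = \<mm> \<longleftrightarrow> r \<in> \<mm>" if "r \<in> carrier R" for r
  proof -
    show "\<mm> +> \<zero> = \<mm>" using \<mm>.Icarr by (auto simp: a_r_coset_def')
    show "\<mm> +> r = \<mm> \<longleftrightarrow> r \<in> \<mm>"
      using \<mm>.a_rcos_const[of r] \<mm>.a_rcos_self[OF that] by auto
  qed
  define \<epsilon> where "\<epsilon> = i (\<mm> +> \<one>)"
  have smult: "r \<odot>\<^bsub>E\<^esub> \<epsilon> = i (\<mm> +> r)" if r: "r \<in> carrier R" for r
  proof -
    have "i (r \<odot>\<^bsub>?k\<^esub> (\<mm> +> \<one>)) = r \<odot>\<^bsub>E\<^esub> i (\<mm> +> \<one>)"
      using i(1) r k unfolding mod_hom_def by blast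
    moreover have "r \<odot>\<^bsub>?k\<^esub> (\<mm> +> \<one>) = \<mm> +> r"
      using r by (simp add: algebra_via_def FactRing_def \<mm>.rcoset_mult_add)
    ultimately show ?thesis by (simp add: \<epsilon>_def)
  qed
  have e: "\<epsilon> \<in> carrier E" using i(1) k by (auto simp: \<epsilon>_def mod_hom_def)
  have i0: "i \<mm> = \<zero>\<^bsub>E\<^esub>" using smult[of \<zero>] m0(1)[of \<zero>] e by simp
  have zero_iff: "r \<odot>\<^bsub>E\<^esub> \<epsilon> = \<zero>\<^bsub>E\<^esub> \<longleftrightarrow> r \<in> \<mm>" if "r \<in> carrier R" for r
  proof -
    have "r \<odot>\<^bsub>E\<^esub> \<epsilon> = \<zero>\<^bsub>E\<^esub> \<longleftrightarrow> i (\<mm> +> r) = i (\<mm> +> \<zero>)"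
      using smult that i0 m0(1)[OF that] by simp
    also have "\<dots> \<longleftrightarrow> \<mm> +> r = \<mm> +> \<zero>"
      using inj_on_eq_iff[OF i(2), of "\<mm> +> r" "\<mm> +> \<zero>"] that k by blast
    finally show ?thesis using m0[OF that] by simp
  qed
  have one: "\<one> \<notin> \<mm>" using \<mm>.one_imp_carrier \<mm>.I_notcarr by auto
  have "residue_generator \<epsilon>"
    unfolding residue_generator_def
  proof (intro conjI allI impI ballI)
    show "\<epsilon> \<in> carrier E" by (rule e)
    show "\<epsilon> \<noteq> \<zero>\<^bsub>E\<^esub>" using zero_iff[of \<one>] one e by auto
    show "r \<odot>\<^bsub>E\<^esub> \<epsilon> = \<zero>\<^bsub>E\<^esub>" if "r \<in> \<mm>" for r using zero_iff[of r] that by simp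
    fix V x assume V: "submodule V R E" "x \<in> V" "x \<noteq> \<zero>\<^bsub>E\<^esub>"
    then have "V \<noteq> {\<zero>\<^bsub>E\<^esub>}" by blast
    then have "i ` carrier ?k \<inter> V \<noteq> {\<zero>\<^bsub>E\<^esub>}" using i(3) V(1) by (auto simp: essential_submodule_def)
    moreover have "\<zero>\<^bsub>E\<^esub> \<in> i ` carrier ?k \<inter> V"
      using i0 m0(1)[of \<zero>] subgroup.one_closed[OF submodule.axioms(1)[OF V(1)]] m
      by (intro IntI image_eqI[of _ _ \<mm>]) simp_all
    ultimately obtain y where y: "y \<in> i ` carrier ?k" "y \<in> V" "y \<noteq> \<zero>\<^bsub>E\<^esub>" by blast
    then obtain r where "r \<in> carrier R" "y = i (\<mm> +> r)" unfolding k by blast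
    then have r: "r \<in> carrier R" "y = r \<odot>\<^bsub>E\<^esub> \<epsilon>" using smult by auto
    then have "r \<notin> \<mm>" using y zero_iff by blast
    from inverse_mod[OF r(1) this] obtain s where s: "s \<in> carrier R" "s \<otimes> r = \<one>" .
    have "s \<odot>\<^bsub>E\<^esub> y = \<epsilon>" using r s e by (simp add: E.smult_assoc1[symmetric])
    then show "\<epsilon> \<in> V" using E.submoduleE(4)[OF V(1) s(1) y(2)] by simp
  qed
  then show ?thesis ..
qed

definition eps where
  "eps = (SOME \<epsilon>. residue_generator \<epsilon>)"

lemma
  shows eps_closed: "eps \<in> carrier E" and eps_nonzero: "eps \<noteq> \<zero>\<^bsub>E\<^esub>"
    and eps_annihilated: "r \<in> \<mm> \<Longrightarrow> r \<odot>\<^bsub>E\<^esub> eps = \<zero>\<^bsub>E\<^esub>"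
    and eps_mem: "submodule V R E \<Longrightarrow> x \<in> V \<Longrightarrow> x \<noteq> \<zero>\<^bsub>E\<^esub> \<Longrightarrow> eps \<in> V"
proof -
  have "residue_generator eps"
    unfolding eps_def using ex_residue_generator by (rule someI_ex)
  note * = this[unfolded residue_generator_def]
  show "eps \<in> carrier E" "eps \<noteq> \<zero>\<^bsub>E\<^esub>" using * by auto
  show "r \<in> \<mm> \<Longrightarrow> r \<odot>\<^bsub>E\<^esub> eps = \<zero>\<^bsub>E\<^esub>" using * by blast
  show "submodule V R E \<Longrightarrow> x \<in> V \<Longrightarrow> x \<noteq> \<zero>\<^bsub>E\<^esub> \<Longrightarrow> eps \<in> V" using * by blast
qed

lemma smult_commute:
  assumes "r \<in> carrier R" "s \<in> carrier R" "y \<in> carrier E"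
  shows "r \<odot>\<^bsub>E\<^esub> (s \<odot>\<^bsub>E\<^esub> y) = s \<odot>\<^bsub>E\<^esub> (r \<odot>\<^bsub>E\<^esub> y)"
  using assms E.smult_assoc1[of r s y] E.smult_assoc1[of s r y] E.R.m_comm[of r s] by simp

lemma cyclic_submodule:
  assumes "x \<in> carrier E"
  shows "submodule {r \<odot>\<^bsub>E\<^esub> x | r. r \<in> carrier R} R E"
proof (rule E.submoduleI)
  show "\<zero>\<^bsub>E\<^esub> \<in> {r \<odot>\<^bsub>E\<^esub> x | r. r \<in> carrier R}" using assms by (intro CollectI exI[of _ \<zero>]) simp
  fix a assume "a \<in> {r \<odot>\<^bsub>E\<^esub> x | r. r \<in> carrier R}"
  then obtain r where r: "r \<in> carrier R" "a = r \<odot>\<^bsub>E\<^esub> x" by blast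
  show "\<ominus>\<^bsub>E\<^esub> a \<in> {r \<odot>\<^bsub>E\<^esub> x | r. r \<in> carrier R}"
    using r assms by (intro CollectI exI[of _ "\<ominus> r"]) (simp add: E.smult_l_minus)
  show "c \<odot>\<^bsub>E\<^esub> a \<in> {r \<odot>\<^bsub>E\<^esub> x | r. r \<in> carrier R}" if "c \<in> carrier R" for c
    using r assms that by (intro CollectI exI[of _ "c \<otimes> r"]) (simp add: E.smult_assoc1)
  fix b assume "b \<in> {r \<odot>\<^bsub>E\<^esub> x | r. r \<in> carrier R}"
  then obtain s where s: "s \<in> carrier R" "b = s \<odot>\<^bsub>E\<^esub> x" by blast
  show "a \<oplus>\<^bsub>E\<^esub> b \<in> {r \<odot>\<^bsub>E\<^esub> x | r. r \<in> carrier R}"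
    using r s assms by (intro CollectI exI[of _ "r \<oplus> s"]) (simp add: E.smult_l_distr)
qed (use assms in auto)

lemma multiple_eps:
  assumes "x \<in> carrier E" "x \<noteq> \<zero>\<^bsub>E\<^esub>"
  obtains r where "r \<in> carrier R" "r \<odot>\<^bsub>E\<^esub> x = eps"
proof -
  have "x \<in> {r \<odot>\<^bsub>E\<^esub> x | r. r \<in> carrier R}" using assms by (intro CollectI exI[of _ \<one>]) simp
  then have "eps \<in> {r \<odot>\<^bsub>E\<^esub> x | r. r \<in> carrier R}"
    using eps_mem[OF cyclic_submodule[OF assms(1)]] assms(2) by blast
  then obtain r where "r \<in> carrier R" "eps = r \<odot>\<^bsub>E\<^esub> x" by blast
  then show thesis using that[of r] by simp
qed

lemma socle:
  assumes "x \<in> carrier E" "\<And>r. r \<in> \<mm> \<Longrightarrow> r \<odot>\<^bsub>E\<^esub> x = \<zero>\<^bsub>E\<^esub>"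
  obtains r where "r \<in> carrier R" "x = r \<odot>\<^bsub>E\<^esub> eps"
proof (cases "x = \<zero>\<^bsub>E\<^esub>")
  case True
  then show ?thesis using that[of \<zero>] eps_closed by simp
next
  case False
  obtain r where r: "r \<in> carrier R" "r \<odot>\<^bsub>E\<^esub> x = eps" using multiple_eps[OF assms(1) False] .
  have "r \<notin> \<mm>" using assms(2) eps_nonzero r(2) by auto
  from inverse_mod[OF r(1) this] obtain s where s: "s \<in> carrier R" "s \<otimes> r = \<one>" .
  have "x = s \<odot>\<^bsub>E\<^esub> eps" using r s assms by (simp add: E.smult_assoc1[symmetric] flip: r(2))
  then show ?thesis by (rule that[OF s(1)])
qed

text \<open>
  Let \<open>Ann y\<close> be maximal among the annihilators that contain no power of \<open>\<mm>\<close>. A multiple \<open>r y\<close> lies in the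
  socle, so for \<open>t \<in> \<mm>\<close> the annihilator of \<open>t y\<close> contains \<open>r\<close> and is strictly larger than \<open>Ann y\<close>; hence it
  contains a power of \<open>\<mm>\<close>. Finitely many \<open>t\<close> generate \<open>\<mm>\<close>, which gives one power that works for all of
  them, and the next power kills \<open>y\<close>.
\<close>

lemma torsion:
  assumes "y \<in> carrier E"
  obtains n where "\<And>r. r \<in> P n \<Longrightarrow> r \<odot>\<^bsub>E\<^esub> y = \<zero>\<^bsub>E\<^esub>"
proof -
  define Ann where "Ann y = {r \<in> carrier R. r \<odot>\<^bsub>E\<^esub> y = \<zero>\<^bsub>E\<^esub>}" for y
  have Ann: "ideal (Ann y) R" if "y \<in> carrier E" for y
    by (rule E.R.ideal_by_closure) (auto simp: Ann_def E.smult_l_distr E.smult_assoc1 that)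
  define F where "F = {Ann y | y. y \<in> carrier E \<and> (\<forall>n. \<not> P n \<subseteq> Ann y)}"
  have "F = {}"
  proof (rule ccontr)
    assume "F \<noteq> {}"
    moreover have "ideal I R" if "I \<in> F" for I using that Ann unfolding F_def by blast
    ultimately obtain M where M: "M \<in> F" and max: "\<And>I. I \<in> F \<Longrightarrow> M \<subseteq> I \<Longrightarrow> I = M"
      using R.maximal_in_family[of F] by metis
    then obtain y where y: "y \<in> carrier E" "M = Ann y" "\<And>n. \<not> P n \<subseteq> Ann y" unfolding F_def by blast
    have "y \<noteq> \<zero>\<^bsub>E\<^esub>" using y(3)[of 0] by (auto simp: Ann_def P_0)
    then obtain r where r: "r \<in> carrier R" "r \<odot>\<^bsub>E\<^esub> y = eps" using multiple_eps[OF y(1)] by blast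
    have step: "\<exists>n. P n \<subseteq> Ann (t \<odot>\<^bsub>E\<^esub> y)" if t: "t \<in> \<mm>" for t
    proof (rule ccontr)
      assume "\<nexists>n. P n \<subseteq> Ann (t \<odot>\<^bsub>E\<^esub> y)"
      then have "Ann (t \<odot>\<^bsub>E\<^esub> y) \<in> F" using y t unfolding F_def by auto
      moreover have "M \<subseteq> Ann (t \<odot>\<^bsub>E\<^esub> y)"
      proof
        fix s assume "s \<in> M"
        then have s: "s \<in> carrier R" "s \<odot>\<^bsub>E\<^esub> y = \<zero>\<^bsub>E\<^esub>" using y by (auto simp: Ann_def)
        have "s \<odot>\<^bsub>E\<^esub> (t \<odot>\<^bsub>E\<^esub> y) = t \<odot>\<^bsub>E\<^esub> (s \<odot>\<^bsub>E\<^esub> y)"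
          using s t y by (intro smult_commute) auto
        then show "s \<in> Ann (t \<odot>\<^bsub>E\<^esub> y)" using s t by (simp add: Ann_def)
      qed
      ultimately have "Ann (t \<odot>\<^bsub>E\<^esub> y) = M" by (rule max)
      moreover have "r \<odot>\<^bsub>E\<^esub> (t \<odot>\<^bsub>E\<^esub> y) = t \<odot>\<^bsub>E\<^esub> (r \<odot>\<^bsub>E\<^esub> y)"
        using r t y by (intro smult_commute) auto
      then have "r \<in> Ann (t \<odot>\<^bsub>E\<^esub> y)" using r eps_annihilated[OF t] by (simp add: Ann_def)
      ultimately show False using y(2) r eps_nonzero by (simp add: Ann_def)
    qed
    obtain A where A: "A \<subseteq> carrier R" "finite A" "\<mm> = Idl A"
      using R.finetely_gen[OF \<mm>.is_ideal] by blast
    then have "A \<subseteq> \<mm>" using E.R.genideal_self by blast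
    have "\<exists>N. \<forall>t \<in> A'. P N \<subseteq> Ann (t \<odot>\<^bsub>E\<^esub> y)" if "finite A'" "A' \<subseteq> \<mm>" for A'
      using that
    proof (induction A' rule: finite_induct)
      case (insert a A')
      then have "A' \<subseteq> \<mm>" "a \<in> \<mm>" by auto
      then obtain N n where n: "\<forall>t \<in> A'. P N \<subseteq> Ann (t \<odot>\<^bsub>E\<^esub> y)" "P n \<subseteq> Ann (a \<odot>\<^bsub>E\<^esub> y)"
        using step[of a] insert.IH by auto
      have "P (max N n) \<subseteq> P N" "P (max N n) \<subseteq> P n" by (auto intro!: P_antimono)
      then have "\<forall>t \<in> insert a A'. P (max N n) \<subseteq> Ann (t \<odot>\<^bsub>E\<^esub> y)" using n by auto
      then show ?case by (rule exI)
    qed simp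
    from this[OF A(2) \<open>A \<subseteq> \<mm>\<close>] obtain N where "\<forall>t \<in> A. P N \<subseteq> Ann (t \<odot>\<^bsub>E\<^esub> y)" ..
    then have N: "\<And>t p. t \<in> A \<Longrightarrow> p \<in> P N \<Longrightarrow> p \<odot>\<^bsub>E\<^esub> (t \<odot>\<^bsub>E\<^esub> y) = \<zero>\<^bsub>E\<^esub>"
      unfolding Ann_def by auto
    define B where "B = {t \<in> carrier R. \<forall>p \<in> P N. p \<odot>\<^bsub>E\<^esub> (t \<odot>\<^bsub>E\<^esub> y) = \<zero>\<^bsub>E\<^esub>}"
    have pc: "p \<in> carrier R" if "p \<in> P N" for p using ideal.Icarr[OF P_ideal that] .
    have "ideal B R"
    proof (rule E.R.ideal_by_closure)
      fix a c assume ac: "a \<in> B" "c \<in> carrier R"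
      have "p \<odot>\<^bsub>E\<^esub> ((c \<otimes> a) \<odot>\<^bsub>E\<^esub> y) = c \<odot>\<^bsub>E\<^esub> (p \<odot>\<^bsub>E\<^esub> (a \<odot>\<^bsub>E\<^esub> y))" if "p \<in> P N" for p
        using ac pc[OF that] y(1) smult_commute[of p c] by (simp add: B_def E.smult_assoc1)
      then show "c \<otimes> a \<in> B" using ac by (simp add: B_def)
    qed (auto simp: B_def pc y(1) E.smult_l_distr E.smult_r_distr)
    moreover have "A \<subseteq> B" using A(1) N by (auto simp: B_def)
    ultimately have mB: "\<mm> \<subseteq> B" using E.R.genideal_minimal A(3) by simp
    have "P (Suc N) \<subseteq> Ann y"
    proof
      fix s assume "s \<in> P (Suc N)"
      then have "s \<in> P N \<cdot> \<mm>" by (simp only: P_Suc)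
      then show "s \<in> Ann y"
      proof (induction rule: ideal_prod.induct)
        case (prod p t)
        then have "p \<odot>\<^bsub>E\<^esub> (t \<odot>\<^bsub>E\<^esub> y) = \<zero>\<^bsub>E\<^esub>" using mB by (auto simp: B_def)
        then show ?case using prod pc y(1) by (simp add: Ann_def E.smult_assoc1)
      next
        case (sum s t)
        then show ?case using Ann[OF y(1)] by (simp add: additive_subgroup.a_closed ideal.axioms(1))
      qed
    qed
    then show False using y(3) by blast
  qed
  then obtain n where "P n \<subseteq> Ann y" using assms unfolding F_def by blast
  then show thesis using that[of n] unfolding Ann_def by blast
qed

end

section \<open>Endomorphisms of the hull\<close>

context residue_hull
begin

abbreviation "End \<equiv> mod_hom R E E"

lemma
  assumes "f \<in> End"
  shows End_closed: "x \<in> carrier E \<Longrightarrow> f x \<in> carrier E"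
    and End_add: "x \<in> carrier E \<Longrightarrow> y \<in> carrier E \<Longrightarrow> f (x \<oplus>\<^bsub>E\<^esub> y) = f x \<oplus>\<^bsub>E\<^esub> f y"
    and End_smult: "r \<in> carrier R \<Longrightarrow> x \<in> carrier E \<Longrightarrow> f (r \<odot>\<^bsub>E\<^esub> x) = r \<odot>\<^bsub>E\<^esub> f x"
    and End_zero: "f \<zero>\<^bsub>E\<^esub> = \<zero>\<^bsub>E\<^esub>"
    and End_minus: "x \<in> carrier E \<Longrightarrow> y \<in> carrier E \<Longrightarrow> f (x \<ominus>\<^bsub>E\<^esub> y) = f x \<ominus>\<^bsub>E\<^esub> f y"
proof -
  show c: "\<And>x. x \<in> carrier E \<Longrightarrow> f x \<in> carrier E"
    and a: "\<And>x y. x \<in> carrier E \<Longrightarrow> y \<in> carrier E \<Longrightarrow> f (x \<oplus>\<^bsub>E\<^esub> y) = f x \<oplus>\<^bsub>E\<^esub> f y"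
    and s: "\<And>r x. r \<in> carrier R \<Longrightarrow> x \<in> carrier E \<Longrightarrow> f (r \<odot>\<^bsub>E\<^esub> x) = r \<odot>\<^bsub>E\<^esub> f x"
    using assms by (auto simp: mod_hom_def)
  show "f \<zero>\<^bsub>E\<^esub> = \<zero>\<^bsub>E\<^esub>" using s[of \<zero> "\<zero>\<^bsub>E\<^esub>"] c[of "\<zero>\<^bsub>E\<^esub>"] by simp
  show "x \<in> carrier E \<Longrightarrow> y \<in> carrier E \<Longrightarrow> f (x \<ominus>\<^bsub>E\<^esub> y) = f x \<ominus>\<^bsub>E\<^esub> f y"
    using a[of x "\<ominus>\<^bsub>E\<^esub> y"] s[of "\<ominus> \<one>" y] c[of y] by (simp add: a_minus_def E.smult_l_minus)
qed

lemma End_I: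
  assumes "\<And>x. x \<in> carrier E \<Longrightarrow> f x \<in> carrier E"
    "\<And>x y. x \<in> carrier E \<Longrightarrow> y \<in> carrier E \<Longrightarrow> f (x \<oplus>\<^bsub>E\<^esub> y) = f x \<oplus>\<^bsub>E\<^esub> f y"
    "\<And>r x. r \<in> carrier R \<Longrightarrow> x \<in> carrier E \<Longrightarrow> f (r \<odot>\<^bsub>E\<^esub> x) = r \<odot>\<^bsub>E\<^esub> f x"
  shows "f \<in> End"
  using assms by (auto simp: mod_hom_def)

lemma End_homothety: "r \<in> carrier R \<Longrightarrow> (\<lambda>x. r \<odot>\<^bsub>E\<^esub> x) \<in> End"
  by (rule End_I) (auto simp: E.smult_r_distr intro: smult_commute)

lemma End_diff:
  assumes "f \<in> End" "g \<in> End"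
  shows "(\<lambda>x. f x \<ominus>\<^bsub>E\<^esub> g x) \<in> End"
proof (rule End_I)
  fix x y assume "x \<in> carrier E" "y \<in> carrier E"
  then show "f (x \<oplus>\<^bsub>E\<^esub> y) \<ominus>\<^bsub>E\<^esub> g (x \<oplus>\<^bsub>E\<^esub> y) = f x \<ominus>\<^bsub>E\<^esub> g x \<oplus>\<^bsub>E\<^esub> (f y \<ominus>\<^bsub>E\<^esub> g y)"
    using assms by (simp add: End_add End_closed a_minus_def E.M.minus_add E.M.a_ac)
next
  fix r x assume "r \<in> carrier R" "x \<in> carrier E"
  then show "f (r \<odot>\<^bsub>E\<^esub> x) \<ominus>\<^bsub>E\<^esub> g (r \<odot>\<^bsub>E\<^esub> x) = r \<odot>\<^bsub>E\<^esub> (f x \<ominus>\<^bsub>E\<^esub> g x)"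
    using assms by (simp add: End_smult End_closed a_minus_def E.smult_r_distr E.smult_r_minus)
qed (use assms in \<open>simp add: End_closed\<close>)

lemma extend_hom:
  assumes "module R M" "submodule H R M" "f \<in> mod_hom R (M\<lparr>carrier := H\<rparr>) E"
  obtains g where "g \<in> mod_hom R M E" "\<And>x. x \<in> H \<Longrightarrow> g x = f x"
proof -
  have "module R (M\<lparr>carrier := H\<rparr>)" by (rule submodule.submodule_is_module[OF assms(2,1)])
  moreover have "H \<subseteq> carrier M" by (rule module.submoduleE(1)[OF assms(1,2)])
  then have "(\<lambda>x. x) \<in> mod_hom R (M\<lparr>carrier := H\<rparr>) M" by (auto simp: mod_hom_def)
  ultimately have "\<exists>g \<in> mod_hom R M E. \<forall>x \<in> carrier (M\<lparr>carrier := H\<rparr>). g x = f x"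
    using injective_module_extends[OF inj _ assms(1) _ _ assms(3), of "\<lambda>x. x"] by simp
  then show thesis using that by auto
qed

text \<open>
  On \<open>N + R x\<close> the map \<open>n + r x \<mapsto> r eps\<close> is well defined: if \<open>r x \<in> N\<close> then \<open>r\<close> is not a unit, so
  \<open>r \<in> \<mm>\<close> and \<open>r eps = 0\<close>. Injectivity extends it to \<open>M\<close>.
\<close>

lemma cogenerator:
  assumes "module R M" "submodule N R M" "x \<in> carrier M" "x \<notin> N"
  obtains g where "g \<in> mod_hom R M E" "\<And>y. y \<in> N \<Longrightarrow> g y = \<zero>\<^bsub>E\<^esub>" "g x = eps"
proof -
  interpret M: module R M by fact
  note N = M.submoduleE[OF assms(2)]
  have Nc: "n \<in> carrier M" if "n \<in> N" for n using N(1) that by blast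
  have N0: "\<zero>\<^bsub>M\<^esub> \<in> N" using subgroup.one_closed[OF submodule.axioms(1)[OF assms(2)]] by simp
  define H where "H = {n \<oplus>\<^bsub>M\<^esub> r \<odot>\<^bsub>M\<^esub> x | n r. n \<in> N \<and> r \<in> carrier R}"
  define f where "f z = (SOME r. r \<in> carrier R \<and> (\<exists>n \<in> N. z = n \<oplus>\<^bsub>M\<^esub> r \<odot>\<^bsub>M\<^esub> x)) \<odot>\<^bsub>E\<^esub> eps" for z
  have unique: "r \<odot>\<^bsub>E\<^esub> eps = r' \<odot>\<^bsub>E\<^esub> eps"
    if r: "r \<in> carrier R" "r' \<in> carrier R" "n \<in> N" "n' \<in> N"
      and eq: "n \<oplus>\<^bsub>M\<^esub> r \<odot>\<^bsub>M\<^esub> x = n' \<oplus>\<^bsub>M\<^esub> r' \<odot>\<^bsub>M\<^esub> x" for r r' n n'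
  proof -
    define u u' where "u = r \<odot>\<^bsub>M\<^esub> x" and "u' = r' \<odot>\<^bsub>M\<^esub> x"
    have c: "u \<in> carrier M" "u' \<in> carrier M" "n \<in> carrier M" "n' \<in> carrier M"
      using r assms(3) Nc by (auto simp: u_def u'_def)
    have e: "n \<oplus>\<^bsub>M\<^esub> u = n' \<oplus>\<^bsub>M\<^esub> u'" using eq by (simp add: u_def u'_def)
    have "(r \<ominus> r') \<odot>\<^bsub>M\<^esub> x = u \<ominus>\<^bsub>M\<^esub> u'"
      using r assms(3) by (simp add: a_minus_def M.smult_l_distr M.smult_l_minus u_def u'_def)
    also have "u = \<ominus>\<^bsub>M\<^esub> n \<oplus>\<^bsub>M\<^esub> (n' \<oplus>\<^bsub>M\<^esub> u')" using c by (simp add: M.M.r_neg1 flip: e)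
    also have "\<ominus>\<^bsub>M\<^esub> n \<oplus>\<^bsub>M\<^esub> (n' \<oplus>\<^bsub>M\<^esub> u') \<ominus>\<^bsub>M\<^esub> u' = \<ominus>\<^bsub>M\<^esub> n \<oplus>\<^bsub>M\<^esub> n'"
      using c by (simp add: a_minus_def M.M.a_assoc M.M.r_neg)
    also have "\<dots> \<in> N" using r N by auto
    finally have d: "(r \<ominus> r') \<odot>\<^bsub>M\<^esub> x \<in> N" .
    have dm: "r \<ominus> r' \<in> \<mm>"
    proof (rule ccontr)
      assume "r \<ominus> r' \<notin> \<mm>"
      from inverse_mod[OF _ this] r obtain s where s: "s \<in> carrier R" "s \<otimes> (r \<ominus> r') = \<one>" by auto
      have "x = s \<odot>\<^bsub>M\<^esub> ((r \<ominus> r') \<odot>\<^bsub>M\<^esub> x)"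
        using s r assms(3) M.smult_assoc1[of s "r \<ominus> r'" x] by simp
      then show False using N(4)[OF s(1) d] assms(4) by simp
    qed
    have "r \<odot>\<^bsub>E\<^esub> eps = ((r \<ominus> r') \<oplus> r') \<odot>\<^bsub>E\<^esub> eps"
      using r by (simp add: a_minus_def E.R.a_assoc E.R.l_neg)
    also have "\<dots> = r' \<odot>\<^bsub>E\<^esub> eps"
      using r eps_annihilated[OF dm] eps_closed by (simp add: E.smult_l_distr)
    finally show ?thesis .
  qed
  have f: "f (n \<oplus>\<^bsub>M\<^esub> r \<odot>\<^bsub>M\<^esub> x) = r \<odot>\<^bsub>E\<^esub> eps" if nr: "n \<in> N" "r \<in> carrier R" for n r
  proof -
    let ?Q = "\<lambda>r'. r' \<in> carrier R \<and> (\<exists>n' \<in> N. n \<oplus>\<^bsub>M\<^esub> r \<odot>\<^bsub>M\<^esub> x = n' \<oplus>\<^bsub>M\<^esub> r' \<odot>\<^bsub>M\<^esub> x)"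
    have "?Q r" using nr by blast
    then have "?Q (SOME r'. ?Q r')" by (rule someI[of ?Q])
    then obtain n' where "n' \<in> N" "(SOME r'. ?Q r') \<in> carrier R"
      "n \<oplus>\<^bsub>M\<^esub> r \<odot>\<^bsub>M\<^esub> x = n' \<oplus>\<^bsub>M\<^esub> (SOME r'. ?Q r') \<odot>\<^bsub>M\<^esub> x" by auto
    then show ?thesis unfolding f_def using unique[of "SOME r'. ?Q r'" r n' n] nr by auto
  qed
  have HI: "n \<oplus>\<^bsub>M\<^esub> r \<odot>\<^bsub>M\<^esub> x \<in> H" if "n \<in> N" "r \<in> carrier R" for n r
    using that unfolding H_def by blast
  have HE: "\<exists>n r. n \<in> N \<and> r \<in> carrier R \<and> z = n \<oplus>\<^bsub>M\<^esub> r \<odot>\<^bsub>M\<^esub> x" if "z \<in> H" for z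
    using that unfolding H_def by blast
  have add: "(n \<oplus>\<^bsub>M\<^esub> r \<odot>\<^bsub>M\<^esub> x) \<oplus>\<^bsub>M\<^esub> (n' \<oplus>\<^bsub>M\<^esub> r' \<odot>\<^bsub>M\<^esub> x) = (n \<oplus>\<^bsub>M\<^esub> n') \<oplus>\<^bsub>M\<^esub> (r \<oplus> r') \<odot>\<^bsub>M\<^esub> x"
    if "n \<in> N" "r \<in> carrier R" "n' \<in> N" "r' \<in> carrier R" for n r n' r'
    using that Nc assms(3) by (simp add: M.smult_l_distr M.M.a_ac)
  have smult: "c \<odot>\<^bsub>M\<^esub> (n \<oplus>\<^bsub>M\<^esub> r \<odot>\<^bsub>M\<^esub> x) = c \<odot>\<^bsub>M\<^esub> n \<oplus>\<^bsub>M\<^esub> (c \<otimes> r) \<odot>\<^bsub>M\<^esub> x"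
    if "n \<in> N" "r \<in> carrier R" "c \<in> carrier R" for n r c
    using that Nc assms(3) by (simp add: M.smult_r_distr M.smult_assoc1)
  have Hsmult: "c \<odot>\<^bsub>M\<^esub> z \<in> H" if "c \<in> carrier R" "z \<in> H" for c z
    using HE[OF that(2)] that(1) smult HI N(4) by fastforce
  have Hc: "H \<subseteq> carrier M" unfolding H_def using Nc assms(3) by auto
  have H: "submodule H R M"
  proof (rule M.submoduleI)
    show "\<zero>\<^bsub>M\<^esub> \<in> H" using HI[OF N0, of \<zero>] assms(3) by simp
    fix a assume a: "a \<in> H"
    then have ac: "a \<in> carrier M" using Hc by blast
    have "(\<ominus> \<one>) \<odot>\<^bsub>M\<^esub> a \<in> H" using Hsmult[of "\<ominus> \<one>"] a by simp
    then show "\<ominus>\<^bsub>M\<^esub> a \<in> H" using ac by (simp add: M.smult_l_minus)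
    fix b assume b: "b \<in> H"
    obtain n r where nr: "n \<in> N" "r \<in> carrier R" "a = n \<oplus>\<^bsub>M\<^esub> r \<odot>\<^bsub>M\<^esub> x" using HE[OF a] by auto
    obtain n' r' where nr': "n' \<in> N" "r' \<in> carrier R" "b = n' \<oplus>\<^bsub>M\<^esub> r' \<odot>\<^bsub>M\<^esub> x" using HE[OF b] by auto
    show "a \<oplus>\<^bsub>M\<^esub> b \<in> H" using nr nr' add N(5) HI by simp
  qed (use Hc Hsmult in auto)
  have fhom: "f \<in> mod_hom R (M\<lparr>carrier := H\<rparr>) E"
    unfolding mod_hom_def
  proof (intro CollectI conjI ballI)
    show "f \<in> carrier (M\<lparr>carrier := H\<rparr>) \<rightarrow> carrier E"
      using HE f eps_closed by fastforce
  next
    fix a b assume "a \<in> carrier (M\<lparr>carrier := H\<rparr>)" "b \<in> carrier (M\<lparr>carrier := H\<rparr>)"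
    then have a: "a \<in> H" and b: "b \<in> H" by auto
    obtain n r where nr: "n \<in> N" "r \<in> carrier R" "a = n \<oplus>\<^bsub>M\<^esub> r \<odot>\<^bsub>M\<^esub> x" using HE[OF a] by auto
    obtain n' r' where nr': "n' \<in> N" "r' \<in> carrier R" "b = n' \<oplus>\<^bsub>M\<^esub> r' \<odot>\<^bsub>M\<^esub> x" using HE[OF b] by auto
    show "f (a \<oplus>\<^bsub>M\<lparr>carrier := H\<rparr>\<^esub> b) = f a \<oplus>\<^bsub>E\<^esub> f b"
      using nr nr' by (simp add: add f N(5) E.smult_l_distr eps_closed)
  next
    fix c a assume c: "c \<in> carrier R" and "a \<in> carrier (M\<lparr>carrier := H\<rparr>)"
    then have a: "a \<in> H" by simp
    obtain n r where nr: "n \<in> N" "r \<in> carrier R" "a = n \<oplus>\<^bsub>M\<^esub> r \<odot>\<^bsub>M\<^esub> x" using HE[OF a] by auto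
    show "f (c \<odot>\<^bsub>M\<lparr>carrier := H\<rparr>\<^esub> a) = c \<odot>\<^bsub>E\<^esub> f a"
      using nr c by (simp add: smult f N(4) E.smult_assoc1 eps_closed)
  qed
  obtain g where g: "g \<in> mod_hom R M E" "\<And>z. z \<in> H \<Longrightarrow> g z = f z"
    using extend_hom[OF assms(1) H fhom] by blast
  show thesis
  proof (rule that[OF g(1)])
    show "g y = \<zero>\<^bsub>E\<^esub>" if "y \<in> N" for y
      using HI[OF that, of \<zero>] f[OF that, of \<zero>] g(2)[of y] Nc[OF that] assms(3) eps_closed by simp
    show "g x = eps"
      using HI[OF N0, of \<one>] f[OF N0, of \<one>] g(2)[of x] assms(3) eps_closed by simp
  qed
qed

lemma image_submodule:
  assumes "submodule V R E" "\<alpha> \<in> End"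
  shows "submodule (\<alpha> ` V) R E"
proof (rule E.submoduleI)
  note V = E.submoduleE[OF assms(1)]
  have Vc: "x \<in> carrier E" if "x \<in> V" for x using V(1) that by blast
  show "\<alpha> ` V \<subseteq> carrier E" using Vc End_closed[OF assms(2)] by auto
  have "\<zero>\<^bsub>E\<^esub> \<in> V" using subgroup.one_closed[OF submodule.axioms(1)[OF assms(1)]] by simp
  then show "\<zero>\<^bsub>E\<^esub> \<in> \<alpha> ` V" using End_zero[OF assms(2)] by (metis imageI)
  fix a assume "a \<in> \<alpha> ` V"
  then obtain x where x: "x \<in> V" "a = \<alpha> x" by auto
  show "\<ominus>\<^bsub>E\<^esub> a \<in> \<alpha> ` V"
    using End_minus[OF assms(2), of "\<zero>\<^bsub>E\<^esub>" x] End_zero[OF assms(2)] End_closed[OF assms(2)] x V Vc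
    by (intro image_eqI[of _ _ "\<ominus>\<^bsub>E\<^esub> x"]) (simp_all add: a_minus_def)
  show "c \<odot>\<^bsub>E\<^esub> a \<in> \<alpha> ` V" if "c \<in> carrier R" for c
    using End_smult[OF assms(2) that] x V Vc that by (intro image_eqI[of _ _ "c \<odot>\<^bsub>E\<^esub> x"]) simp_all
  fix b assume "b \<in> \<alpha> ` V"
  then obtain y where y: "y \<in> V" "b = \<alpha> y" by auto
  show "a \<oplus>\<^bsub>E\<^esub> b \<in> \<alpha> ` V"
    using End_add[OF assms(2)] x y V Vc by (intro image_eqI[of _ _ "x \<oplus>\<^bsub>E\<^esub> y"]) simp_all
qed

text \<open>
  \<open>\<beta>\<close> induces a map on \<open>\<alpha> V\<close>, which extends to all of \<open>E\<close> by injectivity.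
\<close>

lemma factor_End:
  assumes "submodule V R E" "\<alpha> \<in> End" "\<beta> \<in> End"
    and ker: "\<And>x. x \<in> V \<Longrightarrow> \<alpha> x = \<zero>\<^bsub>E\<^esub> \<Longrightarrow> \<beta> x = \<zero>\<^bsub>E\<^esub>"
  obtains g where "g \<in> End" "\<And>x. x \<in> V \<Longrightarrow> \<beta> x = g (\<alpha> x)"
proof -
  note V = E.submoduleE[OF assms(1)]
  have Vc: "x \<in> carrier E" if "x \<in> V" for x using V(1) that by blast
  define f where "f y = \<beta> (SOME x. x \<in> V \<and> y = \<alpha> x)" for y
  have f: "f (\<alpha> x) = \<beta> x" if x: "x \<in> V" for x
  proof -
    define x' where "x' = (SOME x'. x' \<in> V \<and> \<alpha> x = \<alpha> x')"
    have x': "x' \<in> V \<and> \<alpha> x = \<alpha> x'" unfolding x'_def by (rule someI[of _ x]) (use x in simp)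
    have "x' \<ominus>\<^bsub>E\<^esub> x \<in> V" using x' x V by (simp add: a_minus_def)
    moreover have "\<alpha> (x' \<ominus>\<^bsub>E\<^esub> x) = \<zero>\<^bsub>E\<^esub>"
      using x x' Vc End_minus[OF assms(2)] End_closed[OF assms(2)] by (simp add: a_minus_def E.M.r_neg)
    ultimately have "\<beta> (x' \<ominus>\<^bsub>E\<^esub> x) = \<zero>\<^bsub>E\<^esub>" by (rule ker)
    moreover have c: "x \<in> carrier E" "x' \<in> carrier E" using x x' Vc by auto
    ultimately have "\<beta> x' \<ominus>\<^bsub>E\<^esub> \<beta> x = \<zero>\<^bsub>E\<^esub>"
      using End_minus[OF assms(3), of x' x] by simp
    then have "\<beta> x' = \<beta> x"
      using E.M.add.inv_solve_right'[of "\<zero>\<^bsub>E\<^esub>" "\<beta> x'" "\<beta> x"] End_closed[OF assms(3)] c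
      by (simp add: a_minus_def)
    then show ?thesis by (simp add: f_def x'_def)
  qed
  have H: "submodule (\<alpha> ` V) R E" by (rule image_submodule[OF assms(1,2)])
  have "f \<in> mod_hom R (E\<lparr>carrier := \<alpha> ` V\<rparr>) E"
    unfolding mod_hom_def
  proof (intro CollectI conjI ballI)
    show "f \<in> carrier (E\<lparr>carrier := \<alpha> ` V\<rparr>) \<rightarrow> carrier E" using f Vc End_closed[OF assms(3)] by auto
  next
    fix a b assume "a \<in> carrier (E\<lparr>carrier := \<alpha> ` V\<rparr>)" "b \<in> carrier (E\<lparr>carrier := \<alpha> ` V\<rparr>)"
    then obtain x y where x: "x \<in> V" "a = \<alpha> x" "y \<in> V" "b = \<alpha> y" by auto
    have "f (\<alpha> (x \<oplus>\<^bsub>E\<^esub> y)) = f (\<alpha> x) \<oplus>\<^bsub>E\<^esub> f (\<alpha> y)"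
      using x f V(5) End_add[OF assms(3)] Vc by simp
    then show "f (a \<oplus>\<^bsub>E\<lparr>carrier := \<alpha> ` V\<rparr>\<^esub> b) = f a \<oplus>\<^bsub>E\<^esub> f b"
      using x Vc End_add[OF assms(2)] by simp
  next
    fix c a assume c: "c \<in> carrier R" and "a \<in> carrier (E\<lparr>carrier := \<alpha> ` V\<rparr>)"
    then obtain x where x: "x \<in> V" "a = \<alpha> x" by auto
    have "f (\<alpha> (c \<odot>\<^bsub>E\<^esub> x)) = c \<odot>\<^bsub>E\<^esub> f (\<alpha> x)"
      using x c f V(4) End_smult[OF assms(3)] Vc by simp
    then show "f (c \<odot>\<^bsub>E\<lparr>carrier := \<alpha> ` V\<rparr>\<^esub> a) = c \<odot>\<^bsub>E\<^esub> f a"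
      using x c Vc End_smult[OF assms(2)] by simp
  qed
  from extend_hom[OF E.module_axioms H this] obtain g
    where "g \<in> End" "\<And>x. x \<in> \<alpha> ` V \<Longrightarrow> g x = f x" by blast
  then show thesis using f by (intro that[of g]) auto
qed

definition annE where "annE J = {x \<in> carrier E. \<forall>r \<in> J. r \<odot>\<^bsub>E\<^esub> x = \<zero>\<^bsub>E\<^esub>}"

lemma annE_submodule:
  assumes "J \<subseteq> carrier R"
  shows "submodule (annE J) R E"
proof -
  have c: "r \<in> carrier R" if "r \<in> J" for r using assms that by blast
  show ?thesis
    by (rule E.submoduleI) (auto simp: annE_def c E.smult_r_distr E.smult_r_minus smult_commute)
qed

text \<open>
  The case of \<open>R\<close> as a module over itself of the cogenerator property, since a homomorphism from \<open>R\<close> to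
  \<open>E\<close> is the evaluation at an element of \<open>E\<close>.
\<close>

lemma annE_separates:
  assumes "ideal J R" "x \<in> carrier R" "x \<notin> J"
  obtains e where "e \<in> annE J" "x \<odot>\<^bsub>E\<^esub> e = eps"
proof -
  interpret J: ideal J R by fact
  let ?R = "algebra_via (\<lambda>r. r) R"
  have "(\<lambda>r. r) \<in> ring_hom R R" by (rule ring_hom_memI) auto
  then interpret R': algebra R ?R by (rule algebra_algebra_via[OF E.R.is_cring E.R.is_cring])
  have neg: "\<ominus>\<^bsub>?R\<^esub> r = \<ominus> r" if "r \<in> carrier R" for r
    using R'.sum_zero_eq_neg[of "\<ominus> r" r] that by (simp add: algebra_via_def E.R.l_neg)
  have sub: "submodule J R ?R"
    by (rule R'.submoduleI) (auto simp: algebra_via_def J.Icarr J.I_l_closed neg[unfolded algebra_via_def])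
  have "x \<in> carrier ?R" using assms(2) by (simp add: algebra_via_def)
  from cogenerator[OF R'.module sub this assms(3)]
  obtain g where g: "g \<in> mod_hom R ?R E" "\<And>y. y \<in> J \<Longrightarrow> g y = \<zero>\<^bsub>E\<^esub>" "g x = eps" by blast
  have r: "r \<odot>\<^bsub>E\<^esub> g \<one> = g r" if "r \<in> carrier R" for r
  proof -
    have "g (r \<odot>\<^bsub>?R\<^esub> \<one>) = r \<odot>\<^bsub>E\<^esub> g \<one>"
      using g(1) that unfolding mod_hom_def by (auto simp: algebra_via_def simp del: E.R.r_one)
    then show ?thesis using that by (simp add: algebra_via_def)
  qed
  have e: "g \<one> \<in> carrier E" using g(1) by (auto simp: mod_hom_def algebra_via_def)
  show thesis
    using r g J.Icarr e assms(2) by (intro that[of "g \<one>"]) (auto simp: annE_def)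
qed

lemma double_annihilator:
  assumes "ideal J R" "x \<in> carrier R" "\<And>y. y \<in> annE J \<Longrightarrow> x \<odot>\<^bsub>E\<^esub> y = \<zero>\<^bsub>E\<^esub>"
  shows "x \<in> J"
proof (rule ccontr)
  assume "x \<notin> J"
  from annE_separates[OF assms(1,2) this] obtain e where "e \<in> annE J" "x \<odot>\<^bsub>E\<^esub> e = eps" .
  then show False using assms(3) eps_nonzero by simp
qed

text \<open>
  Noetherian induction on \<open>J\<close>. Choose \<open>x \<notin> J\<close> with \<open>\<mm> x \<subseteq> J\<close>. By induction \<open>f\<close> agrees with some \<open>r\<close> on the
  elements killed by \<open>J + (x)\<close>, so on those killed by \<open>J\<close> the difference \<open>f - r\<close> factors through
  multiplication by \<open>x\<close>. The image of that multiplication is killed by \<open>\<mm>\<close>, hence lies in the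
  one-dimensional socle, on which every endomorphism is multiplication by some \<open>c\<close>. So \<open>f\<close> is
  multiplication by \<open>r + c x\<close>.
\<close>

lemma End_on_annE:
  assumes "ideal J R" "P n \<subseteq> J" "f \<in> End"
  shows "\<exists>r \<in> carrier R. \<forall>y \<in> annE J. f y = r \<odot>\<^bsub>E\<^esub> y"
proof (rule ccontr)
  assume contra: "\<not> ?thesis"
  define F where "F = {J. ideal J R \<and> P n \<subseteq> J \<and>
    (\<exists>f \<in> End. \<not> (\<exists>r \<in> carrier R. \<forall>y \<in> annE J. f y = r \<odot>\<^bsub>E\<^esub> y))}"
  have "J \<in> F" unfolding F_def using assms contra by blast
  then have "F \<noteq> {}" by blast
  moreover have "\<And>I. I \<in> F \<Longrightarrow> ideal I R" by (simp add: F_def)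
  ultimately obtain M where M: "M \<in> F" and max: "\<And>I. I \<in> F \<Longrightarrow> M \<subseteq> I \<Longrightarrow> I = M"
    using R.maximal_in_family[of F] by metis
  have Mi: "ideal M R" and Mn: "P n \<subseteq> M" using M by (auto simp: F_def)
  interpret M: ideal M R by (rule Mi)
  obtain f where f: "f \<in> End" and no: "\<not> (\<exists>r \<in> carrier R. \<forall>y \<in> annE M. f y = r \<odot>\<^bsub>E\<^esub> y)"
    using M unfolding F_def by auto
  have "M \<noteq> carrier R"
  proof
    assume "M = carrier R"
    then have "y = \<zero>\<^bsub>E\<^esub>" if "y \<in> annE M" for y
      using that E.smult_one[of y] by (auto simp: annE_def simp del: E.smult_one)
    then have "f y = \<zero> \<odot>\<^bsub>E\<^esub> y" if "y \<in> annE M" for y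
      using that End_zero[OF f] E.smult_l_null[OF E.M.zero_closed] by metis
    then show False using no by blast
  qed
  \<comment> \<open>Any element outside \<open>M\<close> of the last power of \<open>\<mm>\<close> not contained in \<open>M\<close> will serve as \<open>x\<close>.\<close>
  define k where "k = (LEAST k. P k \<subseteq> M)"
  have k: "P k \<subseteq> M" unfolding k_def using Mn by (rule LeastI)
  have "k \<noteq> 0" using k \<open>M \<noteq> carrier R\<close> M.Icarr by (auto simp: P_0)
  then obtain j where j: "k = Suc j" by (cases k) auto
  then have "\<not> P j \<subseteq> M" using not_less_Least[of j "\<lambda>k. P k \<subseteq> M"] by (simp add: k_def)
  then obtain x where x: "x \<in> P j" "x \<notin> M" by blast
  have xc: "x \<in> carrier R" using ideal.Icarr[OF P_ideal x(1)] .
  have mx: "x \<otimes> t \<in> M" if "t \<in> \<mm>" for t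
    using k[unfolded j P_Suc] ideal_prod.prod[OF x(1) that, of R] by blast
  define M' where "M' = E.R.adjoin M x"
  note a = E.R.adjoin_ideal[OF Mi xc, folded M'_def]
  have "M' \<notin> F" using max[of M'] a x by blast
  then obtain r where r: "r \<in> carrier R" "\<forall>y \<in> annE M'. f y = r \<odot>\<^bsub>E\<^esub> y"
    using a(1,2) Mn f unfolding F_def by blast
  define f' where "f' y = f y \<ominus>\<^bsub>E\<^esub> r \<odot>\<^bsub>E\<^esub> y" for y
  have f': "f' \<in> End" unfolding f'_def by (rule End_diff[OF f End_homothety[OF r(1)]])
  have sub: "submodule (annE M) R E" using M.Icarr by (intro annE_submodule) auto
  have yc: "y \<in> carrier E" if "y \<in> annE M" for y using that by (simp add: annE_def)
  have ker: "f' y = \<zero>\<^bsub>E\<^esub>" if y: "y \<in> annE M" "x \<odot>\<^bsub>E\<^esub> y = \<zero>\<^bsub>E\<^esub>" for y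
  proof -
    have "y \<in> annE M'"
      using y xc M.Icarr by (auto simp: annE_def M'_def E.R.adjoin_def E.smult_l_distr E.smult_assoc1)
    then have "f y = r \<odot>\<^bsub>E\<^esub> y" using r(2) by blast
    then show ?thesis using r(1) yc[OF y(1)] by (simp add: f'_def a_minus_def E.M.r_neg)
  qed
  from factor_End[OF sub End_homothety[OF xc] f' ker]
  obtain g where g: "g \<in> End" "\<And>y. y \<in> annE M \<Longrightarrow> f' y = g (x \<odot>\<^bsub>E\<^esub> y)" by auto
  have "t \<odot>\<^bsub>E\<^esub> g eps = \<zero>\<^bsub>E\<^esub>" if "t \<in> \<mm>" for t
    using End_smult[OF g(1), of t eps] that eps_annihilated[OF that] End_zero[OF g(1)] eps_closed by simp
  from socle[OF End_closed[OF g(1) eps_closed] this]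
  obtain c where c: "c \<in> carrier R" "g eps = c \<odot>\<^bsub>E\<^esub> eps" .
  have "f y = (r \<oplus> c \<otimes> x) \<odot>\<^bsub>E\<^esub> y" if y: "y \<in> annE M" for y
  proof -
    have "t \<odot>\<^bsub>E\<^esub> (x \<odot>\<^bsub>E\<^esub> y) = \<zero>\<^bsub>E\<^esub>" if t: "t \<in> \<mm>" for t
    proof -
      have "t \<odot>\<^bsub>E\<^esub> (x \<odot>\<^bsub>E\<^esub> y) = (x \<otimes> t) \<odot>\<^bsub>E\<^esub> y"
        using t xc yc[OF y] by (simp add: E.R.m_comm E.smult_assoc1[symmetric])
      then show ?thesis using mx[OF t] y by (simp add: annE_def)
    qed
    from socle[OF E.smult_closed[OF xc yc[OF y]] this]
    obtain d where d: "d \<in> carrier R" "x \<odot>\<^bsub>E\<^esub> y = d \<odot>\<^bsub>E\<^esub> eps" .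
    have "f' y = d \<odot>\<^bsub>E\<^esub> g eps" using g(2)[OF y] d End_smult[OF g(1)] eps_closed by simp
    also have "\<dots> = c \<odot>\<^bsub>E\<^esub> (x \<odot>\<^bsub>E\<^esub> y)" using c d smult_commute[of d c eps] eps_closed by simp
    also have "\<dots> = (c \<otimes> x) \<odot>\<^bsub>E\<^esub> y" using c xc yc[OF y] by (simp add: E.smult_assoc1)
    finally have *: "f y \<ominus>\<^bsub>E\<^esub> r \<odot>\<^bsub>E\<^esub> y = (c \<otimes> x) \<odot>\<^bsub>E\<^esub> y" by (simp add: f'_def)
    have fy: "f y \<in> carrier E" "r \<odot>\<^bsub>E\<^esub> y \<in> carrier E" using End_closed[OF f] yc[OF y] r(1) by auto
    then have "f y = r \<odot>\<^bsub>E\<^esub> y \<oplus>\<^bsub>E\<^esub> (f y \<ominus>\<^bsub>E\<^esub> r \<odot>\<^bsub>E\<^esub> y)"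
      by (simp add: a_minus_def E.M.a_lcomm[of _ "f y"] E.M.r_neg)
    also have "\<dots> = (r \<oplus> c \<otimes> x) \<odot>\<^bsub>E\<^esub> y"
      unfolding * using r(1) c(1) xc yc[OF y] by (simp add: E.smult_l_distr)
    finally show ?thesis .
  qed
  then show False using no r(1) c(1) xc by blast
qed

end

section \<open>Duality between submodules and ideals of the completion\<close>

context residue_hull
begin

definition act (infixr "\<star>" 70) where
  "u \<star> y = u \<odot>\<^bsub>completion_module R \<mm> E\<^esub> y"

lemma annE_P_antimono: "y \<in> annE (P m) \<Longrightarrow> m \<le> n \<Longrightarrow> y \<in> annE (P n)"
  using P_antimono[of m n] by (auto simp: annE_def)

lemma annE_P:
  assumes "y \<in> carrier E" obtains n where "y \<in> annE (P n)"
proof (rule torsion[OF assms])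
  fix n assume "\<And>r. r \<in> P n \<Longrightarrow> r \<odot>\<^bsub>E\<^esub> y = \<zero>\<^bsub>E\<^esub>"
  then have "y \<in> annE (P n)" using assms by (simp add: annE_def)
  then show thesis by (rule that)
qed

lemma rep_independent:
  assumes u: "u \<in> carrier C" and "r \<in> u n" "r' \<in> u n'" "y \<in> annE (P n)" "n \<le> n'"
  shows "r' \<odot>\<^bsub>E\<^esub> y = r \<odot>\<^bsub>E\<^esub> y"
proof -
  have r: "r \<in> carrier R" "r' \<in> carrier R" using assms rep(1) by auto
  have y: "y \<in> carrier E" using assms(4) by (simp add: annE_def)
  have "r' \<in> u n" using rep_le[OF u assms(5,3)] .
  then have "r' \<ominus> r \<in> P n" using mem_coset[OF r] rep(2)[OF u assms(2)] by simp
  then have z: "(r' \<ominus> r) \<odot>\<^bsub>E\<^esub> y = \<zero>\<^bsub>E\<^esub>" using assms(4) by (simp add: annE_def)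
  have "r' = (r' \<ominus> r) \<oplus> r" using r by (simp add: a_minus_def E.R.a_assoc E.R.l_neg)
  then have "r' \<odot>\<^bsub>E\<^esub> y = ((r' \<ominus> r) \<oplus> r) \<odot>\<^bsub>E\<^esub> y" by simp
  also have "\<dots> = r \<odot>\<^bsub>E\<^esub> y" using r y z by (simp add: E.smult_l_distr)
  finally show ?thesis .
qed

lemma act_rep:
  assumes u: "u \<in> carrier C" "r \<in> u n" and y: "y \<in> annE (P n)"
  shows "u \<star> y = r \<odot>\<^bsub>E\<^esub> y"
proof -
  have yc: "y \<in> carrier E" using y by (simp add: annE_def)
  have "(THE z. \<exists>n. \<exists>r \<in> u n. (\<forall>s \<in> P n. s \<odot>\<^bsub>E\<^esub> y = \<zero>\<^bsub>E\<^esub>) \<and> z = r \<odot>\<^bsub>E\<^esub> y) = r \<odot>\<^bsub>E\<^esub> y"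
  proof (rule the_equality)
    show "\<exists>n. \<exists>r'\<in>u n. (\<forall>s\<in>P n. s \<odot>\<^bsub>E\<^esub> y = \<zero>\<^bsub>E\<^esub>) \<and> r \<odot>\<^bsub>E\<^esub> y = r' \<odot>\<^bsub>E\<^esub> y"
      using u(2) y unfolding annE_def by blast
    fix z assume "\<exists>n. \<exists>r\<in>u n. (\<forall>s\<in>P n. s \<odot>\<^bsub>E\<^esub> y = \<zero>\<^bsub>E\<^esub>) \<and> z = r \<odot>\<^bsub>E\<^esub> y"
    then obtain n' r' where n': "r' \<in> u n'" "y \<in> annE (P n')" "z = r' \<odot>\<^bsub>E\<^esub> y"
      using yc unfolding annE_def by blast
    show "z = r \<odot>\<^bsub>E\<^esub> y"
    proof (cases "n \<le> n'")
      case True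
      then show ?thesis using rep_independent[OF u n'(1) y] n'(3) by simp
    next
      case False
      then show ?thesis using rep_independent[OF u(1) n'(1) u(2) n'(2)] n'(3) by simp
    qed
  qed
  then show ?thesis by (simp add: act_def completion_module_def)
qed

lemma act_homothety:
  assumes "u \<in> carrier C" "v \<in> carrier C" "y \<in> carrier E" "z \<in> carrier E"
  shows "\<exists>n r s. r \<in> carrier R \<and> s \<in> carrier R \<and> r \<in> u n \<and> s \<in> v n \<and>
    y \<in> annE (P n) \<and> z \<in> annE (P n)"
proof -
  obtain k where k: "y \<in> annE (P k)" using annE_P[OF assms(3)] .
  obtain l where l: "z \<in> annE (P l)" using annE_P[OF assms(4)] .
  define n where "n = max k l"
  obtain r where r: "r \<in> u n" "r \<in> carrier R" using ex_rep[OF assms(1)] .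
  obtain s where s: "s \<in> v n" "s \<in> carrier R" using ex_rep[OF assms(2)] .
  have "y \<in> annE (P n)" "z \<in> annE (P n)"
    using annE_P_antimono[OF k, of n] annE_P_antimono[OF l, of n] by (simp_all add: n_def)
  then show ?thesis using r s by blast
qed

lemma act_End:
  assumes "u \<in> carrier C" shows "(\<lambda>y. u \<star> y) \<in> End"
proof (rule End_I)
  fix y z assume yz: "y \<in> carrier E" "z \<in> carrier E"
  obtain n r where n: "r \<in> carrier R" "r \<in> u n" "y \<in> annE (P n)" "z \<in> annE (P n)"
    using act_homothety[OF assms assms yz] by blast
  then show "u \<star> y \<in> carrier E" using assms yz by (simp add: act_rep)
  have "y \<oplus>\<^bsub>E\<^esub> z \<in> annE (P n)"
    using annE_submodule[of "P n"] E.submoduleE(5) n ideal.Icarr[OF P_ideal] by blast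
  then show "u \<star> (y \<oplus>\<^bsub>E\<^esub> z) = u \<star> y \<oplus>\<^bsub>E\<^esub> u \<star> z"
    using n assms yz by (simp add: act_rep E.smult_r_distr)
next
  fix c y assume cy: "c \<in> carrier R" "y \<in> carrier E"
  obtain n r where n: "r \<in> carrier R" "r \<in> u n" "y \<in> annE (P n)"
    using act_homothety[OF assms assms cy(2) cy(2)] by blast
  have "c \<odot>\<^bsub>E\<^esub> y \<in> annE (P n)"
    using annE_submodule[of "P n"] E.submoduleE(4) n cy ideal.Icarr[OF P_ideal] by blast
  then show "u \<star> (c \<odot>\<^bsub>E\<^esub> y) = c \<odot>\<^bsub>E\<^esub> (u \<star> y)"
    using n assms cy by (simp add: act_rep smult_commute)
qed

lemma act_closed:
  assumes "u \<in> carrier C" "y \<in> carrier E" shows "u \<star> y \<in> carrier E"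
  using act_End[OF assms(1)] assms(2) by (rule End_closed)

lemma act_submodule:
  assumes "submodule N R E" "u \<in> carrier C" "y \<in> N" shows "u \<star> y \<in> N"
proof -
  have "y \<in> carrier E" using E.submoduleE(1)[OF assms(1)] assms(3) by blast
  then obtain n r where "r \<in> carrier R" "r \<in> u n" "y \<in> annE (P n)"
    using act_homothety[OF assms(2,2)] by blast
  then show ?thesis using act_rep[OF assms(2)] E.submoduleE(4)[OF assms(1) _ assms(3)] by simp
qed

lemma act_add_left:
  assumes "u \<in> carrier C" "v \<in> carrier C" "y \<in> carrier E"
  shows "(u \<oplus>\<^bsub>C\<^esub> v) \<star> y = u \<star> y \<oplus>\<^bsub>E\<^esub> v \<star> y"
proof -
  obtain n r s where n: "r \<in> carrier R" "s \<in> carrier R" "r \<in> u n" "s \<in> v n" "y \<in> annE (P n)"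
    using act_homothety[OF assms assms(3)] by blast
  then have "(u \<oplus>\<^bsub>C\<^esub> v) \<star> y = (r \<oplus> s) \<odot>\<^bsub>E\<^esub> y"
    using assms by (intro act_rep[of _ _ n] C_op_closed C_op_rep)
  then show ?thesis using n assms act_rep[of u r n y] act_rep[of v s n y] by (simp add: E.smult_l_distr)
qed

lemma act_mult:
  assumes "u \<in> carrier C" "v \<in> carrier C" "y \<in> carrier E"
  shows "(u \<otimes>\<^bsub>C\<^esub> v) \<star> y = u \<star> (v \<star> y)"
proof -
  obtain n r s where n: "r \<in> carrier R" "s \<in> carrier R" "r \<in> u n" "s \<in> v n" "y \<in> annE (P n)"
    using act_homothety[OF assms assms(3)] by blast
  then have "(u \<otimes>\<^bsub>C\<^esub> v) \<star> y = (r \<otimes> s) \<odot>\<^bsub>E\<^esub> y"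
    using assms by (intro act_rep[of _ _ n] C_op_closed C_op_rep)
  moreover have "s \<odot>\<^bsub>E\<^esub> y \<in> annE (P n)"
    using annE_submodule[of "P n"] E.submoduleE(4) n ideal.Icarr[OF P_ideal] by blast
  ultimately show ?thesis
    using n assms act_rep[of u r n "s \<odot>\<^bsub>E\<^esub> y"] act_rep[of v s n y] by (simp add: E.smult_assoc1)
qed

lemma act_iota:
  assumes "r \<in> carrier R" "y \<in> carrier E" shows "\<iota> r \<star> y = r \<odot>\<^bsub>E\<^esub> y"
proof -
  obtain n where "y \<in> annE (P n)" using annE_P[OF assms(2)] .
  then show ?thesis using act_rep[OF iota_closed iota_rep] assms(1) by blast
qed

lemma act_zero_left: "y \<in> carrier E \<Longrightarrow> \<zero>\<^bsub>C\<^esub> \<star> y = \<zero>\<^bsub>E\<^esub>"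
  using act_add_left[of "\<zero>\<^bsub>C\<^esub>" "\<zero>\<^bsub>C\<^esub>" y] act_closed[of "\<zero>\<^bsub>C\<^esub>" y] by simp

lemma act_minus_left:
  assumes "u \<in> carrier C" "v \<in> carrier C" "y \<in> carrier E"
  shows "(u \<ominus>\<^bsub>C\<^esub> v) \<star> y = u \<star> y \<ominus>\<^bsub>E\<^esub> v \<star> y"
proof -
  have "(u \<ominus>\<^bsub>C\<^esub> v) \<star> y \<oplus>\<^bsub>E\<^esub> v \<star> y = (u \<ominus>\<^bsub>C\<^esub> v \<oplus>\<^bsub>C\<^esub> v) \<star> y"
    using assms by (simp add: act_add_left)
  also have "u \<ominus>\<^bsub>C\<^esub> v \<oplus>\<^bsub>C\<^esub> v = u" using assms by (simp add: a_minus_def C.a_assoc C.l_neg)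
  finally show ?thesis
    using assms act_closed by (simp add: a_minus_def E.M.add.inv_solve_right)
qed

text \<open>
  The ring elements by which \<open>f\<close> acts on the parts of \<open>E\<close> killed by the powers of \<open>\<mm>\<close> form a coherent
  sequence, because the annihilator of the part killed by \<open>\<mm>\<^sup>n\<close> is \<open>\<mm>\<^sup>n\<close>.
\<close>

lemma End_is_act:
  assumes f: "f \<in> End"
  obtains u where "u \<in> carrier C" "\<And>y. y \<in> carrier E \<Longrightarrow> f y = u \<star> y"
proof -
  have "\<forall>n. \<exists>r. r \<in> carrier R \<and> (\<forall>y \<in> annE (P n). f y = r \<odot>\<^bsub>E\<^esub> y)"
    using End_on_annE[OF P_ideal subset_refl f] by blast
  then obtain r where r: "\<And>n. r n \<in> carrier R"
    and fr: "\<And>n y. y \<in> annE (P n) \<Longrightarrow> f y = r n \<odot>\<^bsub>E\<^esub> y"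
    by metis
  define u where "u = (\<lambda>n. P n +> r n)"
  have u: "u \<in> carrier C"
    unfolding u_def
  proof (rule C_sequence[OF r])
    fix n
    have "(r (Suc n) \<ominus> r n) \<odot>\<^bsub>E\<^esub> y = \<zero>\<^bsub>E\<^esub>" if y: "y \<in> annE (P n)" for y
    proof -
      have yc: "y \<in> carrier E" using y by (simp add: annE_def)
      have "r (Suc n) \<odot>\<^bsub>E\<^esub> y = r n \<odot>\<^bsub>E\<^esub> y"
        using fr[OF y] fr[OF annE_P_antimono[OF y, of "Suc n"]] by simp
      then show ?thesis
        using r yc by (simp add: a_minus_def E.smult_l_distr E.smult_l_minus E.M.r_neg)
    qed
    then show "r (Suc n) \<ominus> r n \<in> P n" using r by (intro double_annihilator[OF P_ideal]) auto
  qed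
  show thesis
  proof (rule that[OF u])
    fix y assume "y \<in> carrier E"
    then obtain n where n: "y \<in> annE (P n)" by (rule annE_P)
    have "r n \<in> u n" using r coset_self by (simp add: u_def)
    then show "f y = u \<star> y" using act_rep[OF u _ n] fr[OF n] by simp
  qed
qed

lemma act_faithful:
  assumes u: "u \<in> carrier C" and "\<And>y. y \<in> carrier E \<Longrightarrow> u \<star> y = \<zero>\<^bsub>E\<^esub>"
  shows "u = \<zero>\<^bsub>C\<^esub>"
proof (rule C_eqI[OF u])
  fix n
  obtain r where r: "r \<in> u n" "r \<in> carrier R" using ex_rep[OF u] .
  have "r \<odot>\<^bsub>E\<^esub> y = \<zero>\<^bsub>E\<^esub>" if "y \<in> annE (P n)" for y
    using assms(2)[of y] act_rep[OF u r(1) that] that by (simp add: annE_def)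
  then have "r \<in> P n" using r(2) by (intro double_annihilator[OF P_ideal]) auto
  then show "\<exists>r. r \<in> u n \<and> r \<in> \<zero>\<^bsub>C\<^esub> n" using r(1) by (auto simp: C_sel)
qed simp

abbreviation "ann_hat \<equiv> annihilator C (completion_module R \<mm> E)"

definition "annE_hat I = {x \<in> carrier E. \<forall>u \<in> I. u \<star> x = \<zero>\<^bsub>E\<^esub>}"

lemma mem_ann_hat: "u \<in> ann_hat N \<longleftrightarrow> u \<in> carrier C \<and> (\<forall>x \<in> N. u \<star> x = \<zero>\<^bsub>E\<^esub>)"
  by (simp add: annihilator_def act_def completion_module_def)

lemma ann_hat_ideal: "N \<subseteq> carrier E \<Longrightarrow> ideal (ann_hat N) C"
  by (rule C.ideal_by_closure)
    (auto simp: mem_ann_hat act_add_left act_mult act_zero_left subset_iff End_zero[OF act_End])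

lemma annE_hat_submodule: "I \<subseteq> carrier C \<Longrightarrow> submodule (annE_hat I) R E"
proof (rule E.submoduleI)
  assume I: "I \<subseteq> carrier C"
  note e = End_add[OF act_End] End_smult[OF act_End] End_zero[OF act_End] End_minus[OF act_End]
  show "\<zero>\<^bsub>E\<^esub> \<in> annE_hat I" using I by (auto simp: annE_hat_def e)
  fix a assume a: "a \<in> annE_hat I"
  have "u \<star> (\<zero>\<^bsub>E\<^esub> \<ominus>\<^bsub>E\<^esub> a) = \<zero>\<^bsub>E\<^esub>" if "u \<in> I" for u
    using a I that e(4)[of u "\<zero>\<^bsub>E\<^esub>" a] e(3)[of u] by (auto simp: annE_hat_def a_minus_def)
  then show "\<ominus>\<^bsub>E\<^esub> a \<in> annE_hat I" using a by (auto simp: annE_hat_def a_minus_def)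
  show "c \<odot>\<^bsub>E\<^esub> a \<in> annE_hat I" if "c \<in> carrier R" for c using a I that by (auto simp: annE_hat_def e)
  fix b assume "b \<in> annE_hat I"
  then show "a \<oplus>\<^bsub>E\<^esub> b \<in> annE_hat I" using a I by (auto simp: annE_hat_def e)
qed (auto simp: annE_hat_def)

text \<open>
  A point outside \<open>N\<close> is separated from \<open>N\<close> by an endomorphism of \<open>E\<close>, that is, by an element of the
  completion that annihilates \<open>N\<close>.
\<close>

lemma annE_hat_ann_hat:
  assumes N: "submodule N R E"
  shows "annE_hat (ann_hat N) = N"
proof
  have Nc: "N \<subseteq> carrier E" by (rule E.submoduleE(1)[OF N])
  then show "N \<subseteq> annE_hat (ann_hat N)" by (auto simp: annE_hat_def mem_ann_hat)
  show "annE_hat (ann_hat N) \<subseteq> N"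
  proof (rule subsetI, rule ccontr)
    fix x assume x: "x \<in> annE_hat (ann_hat N)" "x \<notin> N"
    then have xc: "x \<in> carrier E" by (simp add: annE_hat_def)
    obtain g where g: "g \<in> End" "\<And>y. y \<in> N \<Longrightarrow> g y = \<zero>\<^bsub>E\<^esub>" "g x = eps"
      using cogenerator[OF E.module_axioms N xc x(2)] by blast
    obtain u where u: "u \<in> carrier C" "\<And>y. y \<in> carrier E \<Longrightarrow> g y = u \<star> y"
      using End_is_act[OF g(1)] by blast
    have "u \<star> y = \<zero>\<^bsub>E\<^esub>" if "y \<in> N" for y
      using u(2)[of y] g(2)[OF that] Nc that by auto
    then have "u \<in> ann_hat N" using u(1) by (simp add: mem_ann_hat)
    then have "u \<star> x = \<zero>\<^bsub>E\<^esub>" using x(1) by (simp add: annE_hat_def)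
    then show False using u(2)[OF xc] g(3) eps_nonzero by simp
  qed
qed

text \<open>
  Induction on the number of generators. If \<open>v\<close> kills everything killed by \<open>I + (a)\<close>, then on the elements
  killed by \<open>I\<close> the action of \<open>v\<close> factors through that of \<open>a\<close>. The factor extends to an endomorphism of
  \<open>E\<close>, which is the action of some \<open>c\<close>. So \<open>v - c a\<close> kills everything killed by \<open>I\<close> and lies in \<open>I\<close>.
\<close>

lemma fin_gen_double_annihilator: "C.fin_gen I \<Longrightarrow> ann_hat (annE_hat I) \<subseteq> I"
proof (induction rule: C.fin_gen.induct)
  case fin_gen_zero
  have "annE_hat {\<zero>\<^bsub>C\<^esub>} = carrier E" by (auto simp: annE_hat_def act_zero_left)
  then show ?case using act_faithful by (auto simp: mem_ann_hat)
next
  case (fin_gen_adjoin I a)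
  have I: "ideal I C" using fin_gen_adjoin(1) by (rule C.fin_gen_ideal)
  then have sub: "submodule (annE_hat I) R E" using ideal.Icarr by (intro annE_hat_submodule) auto
  show ?case
  proof
    fix v assume v: "v \<in> ann_hat (annE_hat (C.adjoin I a))"
    then have vc: "v \<in> carrier C" by (simp add: mem_ann_hat)
    have ker: "v \<star> x = \<zero>\<^bsub>E\<^esub>" if x: "x \<in> annE_hat I" "a \<star> x = \<zero>\<^bsub>E\<^esub>" for x
    proof -
      have "u \<star> x = \<zero>\<^bsub>E\<^esub>" if mem: "u \<in> C.adjoin I a" for u
      proof -
        obtain i c where "u = i \<oplus>\<^bsub>C\<^esub> c \<otimes>\<^bsub>C\<^esub> a" "i \<in> I" "c \<in> carrier C"
          using mem unfolding C.adjoin_def by blast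
        then show ?thesis
          using x fin_gen_adjoin(2) ideal.Icarr[OF I]
          by (simp add: annE_hat_def act_add_left act_mult End_zero[OF act_End])
      qed
      then have "x \<in> annE_hat (C.adjoin I a)" using x by (simp add: annE_hat_def)
      then show ?thesis using v by (simp add: mem_ann_hat)
    qed
    obtain g where g: "g \<in> End" "\<And>x. x \<in> annE_hat I \<Longrightarrow> v \<star> x = g (a \<star> x)"
      using factor_End[OF sub act_End[OF fin_gen_adjoin(2)] act_End[OF vc] ker] by blast
    obtain c where c: "c \<in> carrier C" "\<And>y. y \<in> carrier E \<Longrightarrow> g y = c \<star> y"
      using End_is_act[OF g(1)] by blast
    have ca: "c \<otimes>\<^bsub>C\<^esub> a \<in> carrier C" using c fin_gen_adjoin(2) by simp
    have "(v \<ominus>\<^bsub>C\<^esub> c \<otimes>\<^bsub>C\<^esub> a) \<star> x = \<zero>\<^bsub>E\<^esub>" if x: "x \<in> annE_hat I" for x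
    proof -
      have xc: "x \<in> carrier E" using x by (simp add: annE_hat_def)
      have "v \<star> x = (c \<otimes>\<^bsub>C\<^esub> a) \<star> x"
        using g(2)[OF x] c xc fin_gen_adjoin(2) by (simp add: act_mult act_closed)
      then show ?thesis
        using act_minus_left[OF vc ca xc] act_closed[OF ca xc] by (simp add: a_minus_def E.M.r_neg)
    qed
    then have "v \<ominus>\<^bsub>C\<^esub> c \<otimes>\<^bsub>C\<^esub> a \<in> ann_hat (annE_hat I)" using vc ca by (simp add: mem_ann_hat)
    then have "v \<ominus>\<^bsub>C\<^esub> c \<otimes>\<^bsub>C\<^esub> a \<in> I" using fin_gen_adjoin.IH by blast
    moreover have "v = (v \<ominus>\<^bsub>C\<^esub> c \<otimes>\<^bsub>C\<^esub> a) \<oplus>\<^bsub>C\<^esub> c \<otimes>\<^bsub>C\<^esub> a"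
      using vc ca by (simp add: a_minus_def C.a_assoc C.l_neg)
    ultimately show "v \<in> C.adjoin I a" using c(1) by (intro C.adjoin_memI)
  qed
qed

end

section \<open>Ideals of the completion\<close>

context residue_hull
begin

lemma fin_gen_over_maximal:
  "\<exists>Q. C.fin_gen Q \<and> \<iota> ` \<mm> \<subseteq> Q \<and> (\<forall>J. ideal J C \<longrightarrow> \<iota> ` \<mm> \<subseteq> J \<longrightarrow> Q \<subseteq> J)"
proof -
  obtain A where A: "A \<subseteq> carrier R" "finite A" "\<mm> = Idl A"
    using R.finetely_gen[OF \<mm>.is_ideal] by blast
  have "\<exists>Q. C.fin_gen Q \<and> \<iota> ` A' \<subseteq> Q \<and> (\<forall>J. ideal J C \<longrightarrow> \<iota> ` A' \<subseteq> J \<longrightarrow> Q \<subseteq> J)"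
    if "finite A'" "A' \<subseteq> carrier R" for A'
    using that
  proof (induction A' rule: finite_induct)
    case empty
    have "{\<zero>\<^bsub>C\<^esub>} \<subseteq> J" if "ideal J C" for J
      using additive_subgroup.zero_closed[OF ideal.axioms(1)[OF that]] by simp
    then show ?case using C.fin_gen_zero by (intro exI[of _ "{\<zero>\<^bsub>C\<^esub>}"]) auto
  next
    case (insert a A')
    then obtain Q where Q: "C.fin_gen Q" "\<iota> ` A' \<subseteq> Q" "\<And>J. ideal J C \<Longrightarrow> \<iota> ` A' \<subseteq> J \<Longrightarrow> Q \<subseteq> J"
      by auto
    have a: "\<iota> a \<in> carrier C" using insert.prems iota_closed by simp
    note adj = C.adjoin_ideal[OF C.fin_gen_ideal[OF Q(1)] a]
    show ?case
    proof (intro exI conjI allI impI)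
      show "C.fin_gen (C.adjoin Q (\<iota> a))" using Q(1) a by (rule C.fin_gen_adjoin)
      show "\<iota> ` insert a A' \<subseteq> C.adjoin Q (\<iota> a)" using Q(2) adj by auto
      fix J assume "ideal J C" "\<iota> ` insert a A' \<subseteq> J"
      then show "C.adjoin Q (\<iota> a) \<subseteq> J" using Q(3)[of J] by (intro C.adjoin_least) auto
    qed
  qed
  from this[OF A(2,1)] obtain Q where Q: "C.fin_gen Q" "\<iota> ` A \<subseteq> Q"
    and least: "\<And>J. ideal J C \<Longrightarrow> \<iota> ` A \<subseteq> J \<Longrightarrow> Q \<subseteq> J"
    by auto
  interpret Q: ideal Q C using Q(1) by (rule C.fin_gen_ideal)
  have "ideal {r \<in> carrier R. \<iota> r \<in> Q} R"
  proof (rule E.R.ideal_by_closure)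
    have "\<iota> \<zero> = \<zero>\<^bsub>C\<^esub>"
      by (rule C_eqI) (auto intro!: iota_closed exI[of _ \<zero>] iota_rep C_const_rep)
    then show "\<zero> \<in> {r \<in> carrier R. \<iota> r \<in> Q}" by simp
  qed (auto simp: ring_hom_add[OF iota_hom] ring_hom_mult[OF iota_hom] iota_closed Q.I_l_closed)
  moreover have "A \<subseteq> {r \<in> carrier R. \<iota> r \<in> Q}" using A(1) Q(2) by auto
  ultimately have "Idl A \<subseteq> {r \<in> carrier R. \<iota> r \<in> Q}" by (rule E.R.genideal_minimal)
  then have "\<mm> \<subseteq> {r \<in> carrier R. \<iota> r \<in> Q}" by (simp only: A(3)[symmetric])
  moreover have "A \<subseteq> \<mm>" using E.R.genideal_self[OF A(1)] by (simp only: A(3)[symmetric])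
  ultimately show ?thesis
  proof (intro exI[of _ Q] conjI allI impI)
    fix J assume "\<mm> \<subseteq> {r \<in> carrier R. \<iota> r \<in> Q}" "A \<subseteq> \<mm>" and J: "ideal J C" "\<iota> ` \<mm> \<subseteq> J"
    then have "\<iota> ` A \<subseteq> J" by auto
    with J(1) show "Q \<subseteq> J" by (rule least)
  qed (use Q(1) in auto)
qed

lemma rep_mod:
  assumes "u \<in> carrier C" "r \<in> u (Suc 0)" "r \<in> carrier R" "s \<in> carrier R"
  shows "s \<in> u (Suc 0) \<longleftrightarrow> s \<ominus> r \<in> \<mm>"
  using mem_coset[OF assms(3,4), of "Suc 0"] rep(2)[OF assms(1,2)] unfolding P_1 by metis

lemma power_mem_P: "t \<in> \<mm> \<Longrightarrow> t [^] n \<in> P n"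
proof (induction n)
  case (Suc n)
  then have "t [^] n \<otimes> t \<in> P n \<cdot> \<mm>" by (intro ideal_prod.prod) auto
  then show ?case by (simp add: P_Suc)
qed (simp add: P_0)

text \<open>
  Let \<open>M\<close> be maximal among the ideals that are not finitely generated. If \<open>M\<close> misses some \<open>t \<in> \<mm>\<close>, Cohen's
  argument writes \<open>M\<close> as \<open>Q + t\<^sup>n M\<close> for every \<open>n\<close>, and elements of \<open>E\<close> do not see \<open>t\<^sup>n M\<close> for large \<open>n\<close>.
  If \<open>M\<close> contains \<open>\<mm>\<close>, it contains the finitely generated ideal \<open>Q\<close> generated by \<open>\<mm>\<close>. As a double
  annihilator \<open>Q\<close> contains all elements that vanish modulo \<open>\<mm>\<close>, so \<open>M\<close> is \<open>Q\<close> or the whole ring.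
\<close>

lemma completion_noetherian:
  assumes "ideal I C" shows "C.fin_gen I"
proof (rule ccontr)
  assume "\<not> C.fin_gen I"
  from C.maximal_non_fin_gen[OF assms this] obtain M where M: "ideal M C" "\<not> C.fin_gen M"
    and max: "\<And>J. ideal J C \<Longrightarrow> M \<subseteq> J \<Longrightarrow> J \<noteq> M \<Longrightarrow> C.fin_gen J" by metis
  interpret M: ideal M C by (rule M(1))
  show False
  proof (cases "\<iota> ` \<mm> \<subseteq> M")
    case True
    from fin_gen_over_maximal obtain Q where "C.fin_gen Q" "\<iota> ` \<mm> \<subseteq> Q"
      and "\<forall>J. ideal J C \<longrightarrow> \<iota> ` \<mm> \<subseteq> J \<longrightarrow> Q \<subseteq> J" by (elim exE conjE)
    then have Q: "C.fin_gen Q" "\<iota> ` \<mm> \<subseteq> Q" "Q \<subseteq> M" using True M(1) by simp_all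
    have inQ: "w \<in> Q" if w: "w \<in> carrier C" "\<zero> \<in> w (Suc 0)" for w
    proof -
      have "w \<star> y = \<zero>\<^bsub>E\<^esub>" if y: "y \<in> annE_hat Q" for y
      proof -
        have yc: "y \<in> carrier E" using y by (simp add: annE_hat_def)
        have "r \<odot>\<^bsub>E\<^esub> y = \<zero>\<^bsub>E\<^esub>" if "r \<in> \<mm>" for r
          using y Q(2) that act_iota[of r y] yc by (auto simp: annE_hat_def)
        then have "y \<in> annE (P (Suc 0))" unfolding P_1 using yc by (simp add: annE_def)
        then show ?thesis using act_rep[OF w] yc by simp
      qed
      then show ?thesis using fin_gen_double_annihilator[OF Q(1)] w(1) by (auto simp: mem_ann_hat)
    qed
    have "M \<subseteq> Q"
    proof
      fix v assume v: "v \<in> M"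
      then have vc: "v \<in> carrier C" by (rule M.Icarr)
      obtain r where r: "r \<in> v (Suc 0)" "r \<in> carrier R" using ex_rep[OF vc] .
      have "v \<ominus>\<^bsub>C\<^esub> \<iota> r \<in> Q"
      proof (rule inQ)
        show "v \<ominus>\<^bsub>C\<^esub> \<iota> r \<in> carrier C" using vc r iota_closed by simp
        obtain s where s: "s \<in> (v \<ominus>\<^bsub>C\<^esub> \<iota> r) (Suc 0)" "s \<in> carrier R"
          using ex_rep[OF \<open>v \<ominus>\<^bsub>C\<^esub> \<iota> r \<in> carrier C\<close>] .
        have "s \<oplus> r \<in> ((v \<ominus>\<^bsub>C\<^esub> \<iota> r) \<oplus>\<^bsub>C\<^esub> \<iota> r) (Suc 0)"
          using s r vc iota_closed iota_rep by (intro C_op_rep) auto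
        also have "(v \<ominus>\<^bsub>C\<^esub> \<iota> r) \<oplus>\<^bsub>C\<^esub> \<iota> r = v"
          using vc iota_closed[OF r(2)] by (simp add: a_minus_def C.a_assoc C.l_neg)
        finally have "s \<oplus> r \<ominus> r \<in> \<mm>" using rep_mod[OF vc r, of "s \<oplus> r"] s(2) r(2) by simp
        then have "s \<in> \<mm>" using s(2) r(2) by (simp add: a_minus_def E.R.a_assoc E.R.r_neg)
        then have "\<zero> \<ominus> s \<in> \<mm>" by (simp add: a_minus_def)
        then show "\<zero> \<in> (v \<ominus>\<^bsub>C\<^esub> \<iota> r) (Suc 0)"
          using rep_mod[OF \<open>v \<ominus>\<^bsub>C\<^esub> \<iota> r \<in> carrier C\<close> s E.R.zero_closed] by simp
      qed
      then have "v \<ominus>\<^bsub>C\<^esub> \<iota> r \<in> M" using Q(3) by blast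
      then have "v \<ominus>\<^bsub>C\<^esub> (v \<ominus>\<^bsub>C\<^esub> \<iota> r) \<in> M" using v by (simp add: a_minus_def)
      moreover have "v \<ominus>\<^bsub>C\<^esub> (v \<ominus>\<^bsub>C\<^esub> \<iota> r) = \<iota> r"
        using vc iota_closed[OF r(2)] by (simp add: a_minus_def C.minus_add C.r_neg1 C.r_neg2)
      ultimately have ir: "\<iota> r \<in> M" by simp
      have "r \<in> \<mm>"
      proof (rule ccontr)
        assume "r \<notin> \<mm>"
        from inverse_mod[OF r(2) this] obtain s where s: "s \<in> carrier R" "s \<otimes> r = \<one>" .
        have "\<iota> s \<otimes>\<^bsub>C\<^esub> \<iota> r = \<one>\<^bsub>C\<^esub>"
          using ring_hom_mult[OF iota_hom s(1) r(2)] ring_hom_one[OF iota_hom] s(2) by simp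
        then have "\<one>\<^bsub>C\<^esub> \<in> M" using M.I_l_closed[OF ir iota_closed[OF s(1)]] by simp
        then have "M = carrier C" by (rule M.one_imp_carrier)
        then show False using M(2) C.fin_gen_carrier by simp
      qed
      then have "\<zero> \<ominus> r \<in> \<mm>" by (simp add: a_minus_def)
      then have "\<zero> \<in> v (Suc 0)" using rep_mod[OF vc r E.R.zero_closed] by simp
      then show "v \<in> Q" by (rule inQ[OF vc])
    qed
    then show False using Q M(2) by auto
  next
    case False
    then obtain t where t: "t \<in> \<mm>" "\<iota> t \<notin> M" by blast
    have tc: "t \<in> carrier R" using t(1) by simp
    have "\<exists>Q. C.fin_gen Q \<and> Q \<subseteq> M \<and> (\<forall>p \<in> M. \<exists>q \<in> Q. \<exists>p' \<in> M. p = q \<oplus>\<^bsub>C\<^esub> \<iota> t \<otimes>\<^bsub>C\<^esub> p')"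
    proof (rule C.maximal_non_fin_gen_step[OF M _ iota_closed[OF tc] t(2)])
      show "\<And>J. ideal J C \<Longrightarrow> M \<subseteq> J \<Longrightarrow> J \<noteq> M \<Longrightarrow> C.fin_gen J" by (rule max)
    qed blast
    then obtain Q where Q: "C.fin_gen Q" "Q \<subseteq> M"
      and step: "\<And>p. p \<in> M \<Longrightarrow> \<exists>q \<in> Q. \<exists>p' \<in> M. p = q \<oplus>\<^bsub>C\<^esub> \<iota> t \<otimes>\<^bsub>C\<^esub> p'" by blast
    have iter: "\<exists>p' \<in> M. \<forall>y \<in> annE_hat Q. p \<star> y = t [^] n \<odot>\<^bsub>E\<^esub> (p' \<star> y)" if "p \<in> M" for p and n :: nat
    proof (induction n)
      case 0
      have "p \<star> y = t [^] (0::nat) \<odot>\<^bsub>E\<^esub> (p \<star> y)" if "y \<in> annE_hat Q" for y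
        using that \<open>p \<in> M\<close> M.Icarr act_closed by (simp add: annE_hat_def)
      then show ?case using that by blast
    next
      case (Suc n)
      then obtain p' where p': "p' \<in> M" "\<And>y. y \<in> annE_hat Q \<Longrightarrow> p \<star> y = t [^] n \<odot>\<^bsub>E\<^esub> (p' \<star> y)" by blast
      obtain q p'' where q: "q \<in> Q" "p'' \<in> M" "p' = q \<oplus>\<^bsub>C\<^esub> \<iota> t \<otimes>\<^bsub>C\<^esub> p''" using step[OF p'(1)] by blast
      have "p \<star> y = t [^] Suc n \<odot>\<^bsub>E\<^esub> (p'' \<star> y)" if y: "y \<in> annE_hat Q" for y
      proof -
        have c: "q \<in> carrier C" "p'' \<in> carrier C" "\<iota> t \<in> carrier C" "y \<in> carrier E"
          using q Q(2) M.Icarr iota_closed[OF tc] y by (auto simp: annE_hat_def)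
        have "q \<star> y = \<zero>\<^bsub>E\<^esub>" using y q(1) by (simp add: annE_hat_def)
        then have "p' \<star> y = t \<odot>\<^bsub>E\<^esub> (p'' \<star> y)"
          unfolding q(3) using c tc by (simp add: act_add_left act_mult act_closed act_iota)
        then show ?thesis using p'(2)[OF y] c tc by (simp add: act_closed E.smult_assoc1)
      qed
      then show ?case using q(2) by blast
    qed
    have "p \<star> y = \<zero>\<^bsub>E\<^esub>" if p: "p \<in> M" and y: "y \<in> annE_hat Q" for p y
    proof -
      have yc: "y \<in> carrier E" using y by (simp add: annE_hat_def)
      obtain n where n: "y \<in> annE (P n)" using annE_P[OF yc] .
      obtain p' where p': "p' \<in> M" "p \<star> y = t [^] n \<odot>\<^bsub>E\<^esub> (p' \<star> y)" using iter[OF p, of n] y by blast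
      have "p' \<star> y \<in> annE (P n)"
        using act_submodule[OF annE_submodule _ n] M.Icarr[OF p'(1)] ideal.Icarr[OF P_ideal] by blast
      then show ?thesis using p'(2) power_mem_P[OF t(1)] by (simp add: annE_def)
    qed
    then have "M \<subseteq> ann_hat (annE_hat Q)" using M.Icarr by (auto simp: mem_ann_hat)
    then have "M = Q" using fin_gen_double_annihilator[OF Q(1)] Q(2) by blast
    then show False using Q(1) M(2) by simp
  qed
qed

lemma ann_hat_annE_hat:
  assumes "ideal I C" shows "ann_hat (annE_hat I) = I"
proof
  show "ann_hat (annE_hat I) \<subseteq> I" using completion_noetherian[OF assms] by (rule fin_gen_double_annihilator)
  show "I \<subseteq> ann_hat (annE_hat I)" using ideal.Icarr[OF assms] by (auto simp: mem_ann_hat annE_hat_def)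
qed

text \<open>
  Both directions compare \<open>N\<close> with \<open>s N\<close>, whose annihilator is \<open>(Ann N : s)\<close>. For the converse equal
  annihilators suffice, since submodules are double annihilators.
\<close>

lemma divisible_iff:
  assumes N: "submodule N R E"
  shows "divisible_module R (E\<lparr>carrier := N\<rparr>) \<longleftrightarrow>
    (\<forall>s \<in> non_zero_divisors R. \<forall>u \<in> carrier C. \<iota> s \<otimes>\<^bsub>C\<^esub> u \<in> ann_hat N \<longrightarrow> u \<in> ann_hat N)"
proof -
  have Nc: "x \<in> carrier E" if "x \<in> N" for x using E.submoduleE(1)[OF N] that by blast
  \<comment> \<open>An element of the completion commutes with the scalar \<open>s\<close>, which itself acts through the completion.\<close>
  have swap: "(\<iota> s \<otimes>\<^bsub>C\<^esub> u) \<star> z = u \<star> (s \<odot>\<^bsub>E\<^esub> z)"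
    if "s \<in> carrier R" "u \<in> carrier C" "z \<in> N" for s u z
    using that Nc[OF that(3)] iota_closed[OF that(1)] C.m_comm[of "\<iota> s" u] act_mult[of u "\<iota> s" z]
    by (simp add: act_iota)
  have "(\<lambda>x. s \<odot>\<^bsub>E\<^esub> x) ` N = N \<longleftrightarrow> (\<forall>u \<in> carrier C. \<iota> s \<otimes>\<^bsub>C\<^esub> u \<in> ann_hat N \<longrightarrow> u \<in> ann_hat N)"
    if s: "s \<in> carrier R" for s
  proof
    assume eq: "(\<lambda>x. s \<odot>\<^bsub>E\<^esub> x) ` N = N"
    show "\<forall>u \<in> carrier C. \<iota> s \<otimes>\<^bsub>C\<^esub> u \<in> ann_hat N \<longrightarrow> u \<in> ann_hat N"
    proof (intro ballI impI)
      fix u assume u: "u \<in> carrier C" "\<iota> s \<otimes>\<^bsub>C\<^esub> u \<in> ann_hat N"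
      have "u \<star> x = \<zero>\<^bsub>E\<^esub>" if mem: "x \<in> N" for x
      proof -
        obtain z where z: "z \<in> N" "x = s \<odot>\<^bsub>E\<^esub> z" using mem eq by blast
        then show ?thesis using u swap[OF s u(1) z(1)] by (simp add: mem_ann_hat)
      qed
      then show "u \<in> ann_hat N" using u(1) by (simp add: mem_ann_hat)
    qed
  next
    assume sat: "\<forall>u \<in> carrier C. \<iota> s \<otimes>\<^bsub>C\<^esub> u \<in> ann_hat N \<longrightarrow> u \<in> ann_hat N"
    let ?sN = "(\<lambda>x. s \<odot>\<^bsub>E\<^esub> x) ` N"
    have sN: "submodule ?sN R E" by (rule image_submodule[OF N End_homothety[OF s]])
    have "ann_hat ?sN \<subseteq> ann_hat N"
    proof
      fix u assume u: "u \<in> ann_hat ?sN"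
      then have uc: "u \<in> carrier C" by (simp add: mem_ann_hat)
      have "\<iota> s \<otimes>\<^bsub>C\<^esub> u \<in> ann_hat N"
        using u swap[OF s uc] iota_closed[OF s] uc by (simp add: mem_ann_hat)
      then show "u \<in> ann_hat N" using sat uc by blast
    qed
    then have "annE_hat (ann_hat N) \<subseteq> annE_hat (ann_hat ?sN)" by (auto simp: annE_hat_def)
    then have "N \<subseteq> ?sN" using annE_hat_ann_hat[OF N] annE_hat_ann_hat[OF sN] by simp
    moreover have "?sN \<subseteq> N" using E.submoduleE(4)[OF N s] by blast
    ultimately show "?sN = N" by blast
  qed
  then show ?thesis by (auto simp: divisible_module_def non_zero_divisors_def)
qed

lemma ann_hat_carrier_iff:
  assumes N: "submodule N R E"
  shows "ann_hat N = carrier C \<longleftrightarrow> N = {\<zero>\<^bsub>E\<^esub>}"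
proof
  assume "ann_hat N = carrier C"
  then have "\<one>\<^bsub>C\<^esub> \<in> ann_hat N" by simp
  then have "x = \<zero>\<^bsub>E\<^esub>" if "x \<in> N" for x
    using that E.submoduleE(1)[OF N] act_iota[of \<one> x] ring_hom_one[OF iota_hom] by (auto simp: mem_ann_hat)
  moreover have "\<zero>\<^bsub>E\<^esub> \<in> N" using subgroup.one_closed[OF submodule.axioms(1)[OF N]] by simp
  ultimately show "N = {\<zero>\<^bsub>E\<^esub>}" by blast
next
  assume "N = {\<zero>\<^bsub>E\<^esub>}"
  then show "ann_hat N = carrier C" using End_zero[OF act_End] by (auto simp: mem_ann_hat)
qed

end

section \<open>Simple divisible submodules and maximal ideals\<close>

lemma (in module) submodule_restrict_iff:
  assumes "submodule N R M"
  shows "submodule V R (M\<lparr>carrier := N\<rparr>) \<longleftrightarrow> submodule V R M \<and> V \<subseteq> N"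
proof -
  have N: "module R (M\<lparr>carrier := N\<rparr>)" by (rule submodule.submodule_is_module[OF assms module_axioms])
  show ?thesis
  proof (intro iffI conjI; (elim conjE)?)
    assume V: "submodule V R (M\<lparr>carrier := N\<rparr>)"
    then show "V \<subseteq> N" using module.submoduleE(1)[OF N V] by simp
    have "module R (M\<lparr>carrier := V\<rparr>)" using submodule.submodule_is_module[OF V N] by simp
    then show "submodule V R M"
      using \<open>V \<subseteq> N\<close> submoduleE(1)[OF assms] by (intro module_incl_imp_submodule) auto
  next
    assume V: "submodule V R M" "V \<subseteq> N"
    have "module R (M\<lparr>carrier := V\<rparr>)" by (rule submodule.submodule_is_module[OF V(1) module_axioms])
    then show "submodule V R (M\<lparr>carrier := N\<rparr>)"
      using V(2) by (intro module.module_incl_imp_submodule[OF N]) auto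
  qed
qed

text \<open>
  The carrier and the ring operations coincide, but the two rings are records of different types.
\<close>

lemma ideal_algebra_via:
  assumes "cring B" "cring (algebra_via h B)"
  shows "ideal I (algebra_via h B) \<longleftrightarrow> ideal I B"
proof
  interpret B: cring B by fact
  interpret A: cring "algebra_via h B" by fact
  show "ideal I B" if "ideal I (algebra_via h B)"
  proof -
    interpret I: ideal I "algebra_via h B" by fact
    show ?thesis
      by (rule B.ideal_by_closure)
        (use I.Icarr I.zero_closed I.a_closed I.I_l_closed in \<open>auto simp: algebra_via_def\<close>)
  qed
  show "ideal I (algebra_via h B)" if "ideal I B"
  proof -
    interpret I: ideal I B by fact
    show ?thesis
      by (rule A.ideal_by_closure)
        (use I.Icarr I.zero_closed I.a_closed I.I_l_closed in \<open>auto simp: algebra_via_def\<close>)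
  qed
qed

theorem mainTheorem3:
  fixes R :: "('a, 'r) ring_scheme" and \<mm> :: "'a set" and E :: "('a, 'e, 'm) module_scheme"
  assumes "noetherian_local_ring R \<mm>"
    and "injective_hull R (residue_module R \<mm>) E"
  shows "bij_betw
    (\<lambda>N. extended_ideal R (completion_algebra R \<mm>) (total_quotient_algebra R)
            (annihilator (completion R \<mm>) (completion_module R \<mm> E) N))
    {N. submodule N R E \<and> simple_divisible_module R (E\<lparr>carrier := N\<rparr>)}
    {P. maximalideal P (tensor_algebra R (completion_algebra R \<mm>) (total_quotient_algebra R))}"
proof -
  interpret residue_hull R \<mm> E using assms by (rule residue_hull.intro)
  let ?A = "completion_algebra R \<mm>"
  have A: "algebra R ?A" by (rule algebra_algebra_via[OF E.R.is_cring cring_C iota_hom])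
  interpret T: total_quotient_tensor R ?A
    by (intro total_quotient_tensor.intro algebra_pair.intro A E.R.algebra_Q)
  have A_sel: "carrier ?A = carrier C" "\<And>s a. s \<odot>\<^bsub>?A\<^esub> a = \<iota> s \<otimes>\<^bsub>C\<^esub> a"
    by (simp_all add: algebra_via_def)
  have ideal_A: "ideal I ?A \<longleftrightarrow> ideal I C" for I
    by (rule ideal_algebra_via[OF cring_C algebra.M_cring[OF A]])
  have sat_ann_hat: "T.saturated (ann_hat N) \<longleftrightarrow> divisible_module R (E\<lparr>carrier := N\<rparr>)"
    if "submodule N R E" for N
    using that ann_hat_ideal[OF E.submoduleE(1)[OF that]]
    by (simp add: T.saturated_def ideal_A A_sel divisible_iff)
  have sat_annE_hat: "submodule (annE_hat J) R E" "ann_hat (annE_hat J) = J" "divisible_module R (E\<lparr>carrier := annE_hat J\<rparr>)"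
    "annE_hat J = {\<zero>\<^bsub>E\<^esub>} \<longleftrightarrow> J = carrier C" if "T.saturated J" for J
  proof -
    have J: "ideal J C" using that by (simp add: T.saturated_def ideal_A)
    then show sub: "submodule (annE_hat J) R E" using ideal.Icarr by (intro annE_hat_submodule) auto
    show eq: "ann_hat (annE_hat J) = J" using J by (rule ann_hat_annE_hat)
    show "divisible_module R (E\<lparr>carrier := annE_hat J\<rparr>)" using sat_ann_hat[OF sub] eq that by simp
    show "annE_hat J = {\<zero>\<^bsub>E\<^esub>} \<longleftrightarrow> J = carrier C" using ann_hat_carrier_iff[OF sub] eq by simp
  qed
  have simple_iff: "simple_divisible_module R (E\<lparr>carrier := N\<rparr>) \<longleftrightarrow>
      divisible_module R (E\<lparr>carrier := N\<rparr>) \<and> N \<noteq> {\<zero>\<^bsub>E\<^esub>} \<and>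
      (\<forall>V. submodule V R E \<and> V \<subseteq> N \<and> V \<noteq> {\<zero>\<^bsub>E\<^esub>} \<and> divisible_module R (E\<lparr>carrier := V\<rparr>) \<longrightarrow> V = N)"
    if "submodule N R E" for N
    unfolding simple_divisible_module_def E.submodule_restrict_iff[OF that] by auto
  show ?thesis
  proof (rule bij_betwI')
    fix N N'
    assume "N \<in> {N. submodule N R E \<and> simple_divisible_module R (E\<lparr>carrier := N\<rparr>)}"
      "N' \<in> {N. submodule N R E \<and> simple_divisible_module R (E\<lparr>carrier := N\<rparr>)}"
    then have N: "submodule N R E" "T.saturated (ann_hat N)" "submodule N' R E" "T.saturated (ann_hat N')"
      using sat_ann_hat by (auto simp: simple_divisible_module_def)
    show "T.ext (ann_hat N) = T.ext (ann_hat N') \<longleftrightarrow> N = N'"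
      using T.ext_inj[OF N(2,4)] annE_hat_ann_hat[OF N(1)] annE_hat_ann_hat[OF N(3)] by metis
  next
    fix N assume "N \<in> {N. submodule N R E \<and> simple_divisible_module R (E\<lparr>carrier := N\<rparr>)}"
    then have N: "submodule N R E" and simple: "divisible_module R (E\<lparr>carrier := N\<rparr>)" "N \<noteq> {\<zero>\<^bsub>E\<^esub>}"
      "\<And>V. submodule V R E \<Longrightarrow> V \<subseteq> N \<Longrightarrow> V \<noteq> {\<zero>\<^bsub>E\<^esub>} \<Longrightarrow>
         divisible_module R (E\<lparr>carrier := V\<rparr>) \<Longrightarrow> V = N"
      using simple_iff by auto
    have "maximalideal (T.ext (ann_hat N)) T.T"
    proof (rule T.maximal_ext)
      show "T.saturated (ann_hat N)" using sat_ann_hat[OF N] simple(1) by simp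
      show "ann_hat N \<noteq> carrier ?A" using ann_hat_carrier_iff[OF N] simple(2) by (simp add: A_sel)
      fix J assume J: "T.saturated J" "ann_hat N \<subseteq> J" "J \<noteq> carrier ?A"
      have "annE_hat J \<subseteq> annE_hat (ann_hat N)" using J(2) by (auto simp: annE_hat_def)
      then have "annE_hat J = N"
        using simple(3)[OF sat_annE_hat(1)[OF J(1)]] sat_annE_hat[OF J(1)] J(3) annE_hat_ann_hat[OF N] by (simp add: A_sel)
      then show "J = ann_hat N" using sat_annE_hat(2)[OF J(1)] by simp
    qed
    then show "T.ext (ann_hat N) \<in> {P. maximalideal P T.T}" by simp
  next
    fix P assume "P \<in> {P. maximalideal P T.T}"
    then have "maximalideal P T.T" by simp
    note P = T.maximal_contraction[OF this]
    let ?I = "T.contraction P"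
    note Z = sat_annE_hat[OF P(1)]
    have "simple_divisible_module R (E\<lparr>carrier := annE_hat ?I\<rparr>)"
      unfolding simple_iff[OF Z(1)]
    proof (intro conjI allI impI; (elim conjE)?)
      show "divisible_module R (E\<lparr>carrier := annE_hat ?I\<rparr>)" by (rule Z(3))
      show "annE_hat ?I \<noteq> {\<zero>\<^bsub>E\<^esub>}" using Z(4) P(2) by (simp add: A_sel)
      fix V assume V: "submodule V R E" "V \<subseteq> annE_hat ?I" "V \<noteq> {\<zero>\<^bsub>E\<^esub>}" "divisible_module R (E\<lparr>carrier := V\<rparr>)"
      have "ann_hat (annE_hat ?I) \<subseteq> ann_hat V" using V(2) by (simp add: subset_iff mem_ann_hat)
      then have "?I \<subseteq> ann_hat V" using Z(2) by simp
      moreover have "T.saturated (ann_hat V)" "ann_hat V \<noteq> carrier ?A"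
        using sat_ann_hat[OF V(1)] V(4) ann_hat_carrier_iff[OF V(1)] V(3) by (simp_all add: A_sel)
      ultimately have "ann_hat V = ?I" using P(4) by blast
      then show "V = annE_hat ?I" using annE_hat_ann_hat[OF V(1)] by simp
    qed
    moreover have "P = T.ext (ann_hat (annE_hat ?I))" using Z(2) P(3) by simp
    ultimately show "\<exists>N \<in> {N. submodule N R E \<and> simple_divisible_module R (E\<lparr>carrier := N\<rparr>)}. P = T.ext (ann_hat N)"
      using Z(1) by blast
  qed
qed

end
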